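(* Let $\mathscr{X}=(\mathbb{R}/\mathbb{Z},d,\mu)$ be the circle endowed with its geodesic distance $d(\overline{x},\overline{y})=\inf_{k\in\mathbb{Z}}|x-y-k|$ and with the projection $\mu$ of the Lebesgue measure. Let $\Phi$ be the observable of metric measure spaces $$\Phi(\mathcal{Y},\delta,m)=\int_{\mathcal{Y}^3}\min(1,\delta(x,y))\,\min(1,\delta(y,z))\,m^{\otimes3}(dx\,dy\,dz).$$ Then the Gromov--Prohorov sample model yields a sequence of random variables $$\frac{\Phi(\mathscr{X}_n)-\Phi(\mathscr{X})}{\sqrt{\mathrm{var}(\Phi(\mathscr{X}_n))}}$$ which converges in distribution, as $n\to\infty$, towards a law which is centered, with variance $1$ and with third cumulant equal to $$-\frac{168836}{44385}\sqrt{\frac{70}{269}}\simeq-1.94044;$$ in particular, this distribution is not the Gaussian distribution.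
   Context: Let $(X_i)_{i\geq1}$ be i.i.d. random variables with law $\mu$. The Gromov--Prohorov sample model of a metric measure space $\mathscr{X}=(\mathcal{X},d,\mu)$ (a complete separable metric space with a Borel probability measure) is the random metric measure space $\mathscr{X}_n=(\{X_1,\dots,X_n\},d,\frac1n\sum_{i=1}^n\delta_{X_i})$, so that here $\Phi(\mathscr{X}_n)=\frac{1}{n^3}\sum_{1\leq i,j,k\leq n}d(X_i,X_j)\,d(X_j,X_k)$ (the circle has diameter $\frac12$). The third cumulant of $Z$ is $\kappa^{(3)}(Z)=\mathbb{E}[Z^3]-3\mathbb{E}[Z]\mathbb{E}[Z^2]+2\mathbb{E}[Z]^3$.
   Formalization: Centred at Φ(𝒳), the limit law has mean −(5/2)√(70/269), not 0; the formal theorem states "centered" for the sequence centred at E[Φ(𝒳_n)], and shows the printed sequence converges to that law translated by −(5/2)√(70/269). *)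

theory Defs
  imports "HOL-Probability.Probability"
begin

subsection \<open>Metric measure spaces\<close>

text \<open>A triple consisting of the underlying set, the distance and the measure.\<close>

type_synonym 'a mm_triple = "'a set \<times> ('a \<Rightarrow> 'a \<Rightarrow> real) \<times> 'a measure"

definition metric_measure_space :: "'a mm_triple \<Rightarrow> bool" where
  "metric_measure_space = (\<lambda>(Y, \<delta>, m).
     Metric_space Y \<delta> \<and>
     Metric_space.mcomplete Y \<delta> \<and>
     separable_space (Metric_space.mtopology Y \<delta>) \<and>
     prob_space m \<and> space m = Y \<and>
     sets m = sigma_sets Y {U. openin (Metric_space.mtopology Y \<delta>) U})"

definition observable :: "'a mm_triple \<Rightarrow> real" where
  "observable = (\<lambda>(Y, \<delta>, m).
     \<integral>(x, y, z). min 1 (\<delta> x y) * min 1 (\<delta> y z) \<partial>(m \<Otimes>\<^sub>M (m \<Otimes>\<^sub>M m)))"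


subsection \<open>The Gromov--Prohorov sample model\<close>

text \<open>The measure \<open>(1/n) \<Sum>\<^sub>i \<delta>\<^bsub>x i\<^esub>\<close> with \<open>i = 1, \<dots>, n\<close>, living on the finite set
  \<open>{x 1, \<dots>, x n}\<close>, all of whose subsets are Borel.\<close>

definition empirical_measure :: "nat \<Rightarrow> (nat \<Rightarrow> 'a) \<Rightarrow> 'a measure" where
  "empirical_measure n x =
     measure_of (x ` {1..n}) (Pow (x ` {1..n})) (\<lambda>A. (\<Sum>i = 1..n. indicator A (x i)) / of_nat n)"

definition sample_model :: "('a \<Rightarrow> 'a \<Rightarrow> real) \<Rightarrow> nat \<Rightarrow> (nat \<Rightarrow> 'a) \<Rightarrow> 'a mm_triple" where
  "sample_model d n x = (x ` {1..n}, d, empirical_measure n x)"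


subsection \<open>The circle\<close>

quotient_type circle = real / "\<lambda>x y::real. x - y \<in> \<int>"
proof (rule equivpI)
  show "reflp (\<lambda>x y::real. x - y \<in> \<int>)" by (simp add: reflp_def)
  show "symp (\<lambda>x y::real. x - y \<in> \<int>)"
    by (auto simp: symp_def) (metis Ints_minus minus_diff_eq)
  show "transp (\<lambda>x y::real. x - y \<in> \<int>)"
    by (auto simp: transp_def) (metis Ints_add diff_add_cancel add_diff_eq)
qed

lift_definition circle_proj :: "real \<Rightarrow> circle" is "\<lambda>x. x" .

lemma circle_proj_eq_iff: "circle_proj x = circle_proj y \<longleftrightarrow> x - y \<in> \<int>"
  by transfer simp

lemma circle_proj_surj: "\<exists>x. a = circle_proj x"
proof transfer
  fix a :: real
  have "a - a \<in> \<int>" by simp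
  then show "\<exists>x. a - x \<in> \<int>" ..
qed

instantiation circle :: metric_space
begin

lift_definition dist_circle :: "circle \<Rightarrow> circle \<Rightarrow> real" is
  "\<lambda>x y. INF k::int. \<bar>x - y - of_int k\<bar>"
proof -
  fix x x' y y' :: real
  assume "x - x' \<in> \<int>" "y - y' \<in> \<int>"
  then obtain m n where mn: "x = x' + of_int m" "y = y' + of_int n"
    by (auto elim!: Ints_cases simp: algebra_simps)
  have "range (\<lambda>k::int. \<bar>x - y - of_int k\<bar>) = (\<lambda>k. \<bar>x' - y' - of_int k\<bar>) ` range (\<lambda>k. k - m + n)"
    by (simp add: image_image mn algebra_simps)
  also have "range (\<lambda>k. k - m + n) = (UNIV :: int set)"
    by (rule surjI[of _ "\<lambda>k. k + m - n"]) simp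
  finally show "(INF k::int. \<bar>x - y - of_int k\<bar>) = (INF k::int. \<bar>x' - y' - of_int k\<bar>)"
    by simp
qed

definition uniformity_circle :: "(circle \<times> circle) filter" where
  "uniformity_circle = (INF e\<in>{0<..}. principal {(x, y). dist x y < e})"

definition open_circle :: "circle set \<Rightarrow> bool" where
  "open_circle U \<longleftrightarrow> (\<forall>x\<in>U. eventually (\<lambda>(x', y). x' = x \<longrightarrow> y \<in> U) uniformity)"

lemma dist_circle_proj: "dist (circle_proj x) (circle_proj y) = \<bar>x - y - of_int (round (x - y))\<bar>"
proof -
  have "(INF k::int. \<bar>x - y - of_int k\<bar>) = \<bar>x - y - of_int (round (x - y))\<bar>"
    by (rule cInf_eq_minimum) (auto simp: round_diff_minimal)
  then show ?thesis by transfer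
qed

lemma dist_circle_proj_le: "dist (circle_proj x) (circle_proj y) \<le> \<bar>x - y - of_int k\<bar>"
  unfolding dist_circle_proj by (rule round_diff_minimal)

instance
proof
  fix a b c :: circle
  obtain x y z where xyz: "a = circle_proj x" "b = circle_proj y" "c = circle_proj z"
    using circle_proj_surj by metis
  show "dist a b = 0 \<longleftrightarrow> a = b"
  proof
    assume "dist a b = 0"
    then have "x - y = of_int (round (x - y))" by (simp add: xyz dist_circle_proj)
    then show "a = b" unfolding xyz circle_proj_eq_iff by (metis Ints_of_int)
  next
    assume "a = b"
    then obtain k where "x - y = of_int k" unfolding xyz circle_proj_eq_iff by (auto elim: Ints_cases)
    then show "dist a b = 0" by (simp add: xyz dist_circle_proj)
  qed
  have "dist a b \<le> \<bar>x - y - of_int (round (x - z) - round (y - z))\<bar>"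
    unfolding xyz by (rule dist_circle_proj_le)
  also have "\<dots> \<le> dist a c + dist b c"
    by (simp add: xyz dist_circle_proj)
  finally show "dist a b \<le> dist a c + dist b c" .
qed (simp_all only: uniformity_circle_def open_circle_def)

end

definition circle_measure :: "circle measure" where
  "circle_measure = distr (restrict_space lborel {0..<1}) borel circle_proj"

definition circle_space :: "circle mm_triple" where
  "circle_space = (UNIV, dist, circle_measure)"


subsection \<open>Well-formedness of the two constructions\<close>

lemma continuous_on_circle_proj: "continuous_on S circle_proj"
proof -
  have "dist (circle_proj x) (circle_proj y) \<le> dist x y" for x y
    using dist_circle_proj_le[of x y 0] by (simp add: dist_real_def)
  then show ?thesis unfolding continuous_on_iff by (meson le_less_trans)
qed

lemma circle_proj_measurable [measurable]: "circle_proj \<in> borel_measurable borel"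
  by (rule borel_measurable_continuous_onI[OF continuous_on_circle_proj])

lemma compact_UNIV_circle: "compact (UNIV :: circle set)"
proof -
  have "circle_proj ` {0..1} = UNIV"
  proof safe
    fix a :: circle
    obtain x where x: "a = circle_proj x" using circle_proj_surj by metis
    have "a = circle_proj (frac x)"
      unfolding x circle_proj_eq_iff by (simp add: frac_def)
    moreover have "frac x \<in> {0..1}" using frac_lt_1[of x] by simp
    ultimately show "a \<in> circle_proj ` {0..1}" by blast
  qed simp
  then show ?thesis
    by (metis compact_Icc compact_continuous_image continuous_on_circle_proj)
qed

lemma prob_space_circle_measure: "prob_space circle_measure"
proof -
  interpret prob_space "restrict_space lborel {0..<1::real}"
    by (rule prob_spaceI) (simp add: emeasure_restrict_space space_restrict_space)
  show ?thesis unfolding circle_measure_def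
    by (rule prob_space_distr) (simp add: measurable_restrict_space1)
qed

lemma metric_measure_space_circle: "metric_measure_space circle_space"
proof -
  have "compact_space (Met_TC.mtopology :: circle topology)"
    by (simp add: compact_space_def compact_UNIV_circle)
  then have complete: "Met_TC.mcomplete TYPE(circle)"
    by (rule Met_TC.compact_space_imp_mcomplete)
  have "x \<in> closure \<rat>" for x :: real
    unfolding closure_approachable dist_real_def
    using Rats_dense_in_real[of x "x + e" for e] by (smt (verit, best))
  then have rat: "closure (\<rat> :: real set) = UNIV" by blast
  have "closure (circle_proj ` \<rat>) = UNIV"
  proof -
    have "circle_proj ` closure \<rat> \<subseteq> closure (circle_proj ` \<rat>)"
      by (intro image_closure_subset continuous_on_circle_proj closed_closure closure_subset)
    moreover have "range circle_proj = UNIV"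
      using circle_proj_surj unfolding surj_def by blast
    ultimately show ?thesis unfolding rat by blast
  qed
  then have "separable_space (euclidean :: circle topology)"
    unfolding separable_space_def
    by (intro exI[of _ "circle_proj ` \<rat>"]) (simp add: countable_rat)
  with complete show ?thesis
    unfolding metric_measure_space_def circle_space_def
    by (simp add: Met_TC.Metric_space_axioms prob_space_circle_measure)
       (simp add: circle_measure_def borel_def sets_measure_of_conv)
qed

lemma space_empirical_measure [simp]: "space (empirical_measure n x) = x ` {1..n}"
  by (simp add: empirical_measure_def space_measure_of_conv)

lemma sets_empirical_measure [simp]: "sets (empirical_measure n x) = Pow (x ` {1..n})"
  by (simp add: empirical_measure_def sigma_algebra.sigma_sets_eq[OF sigma_algebra_Pow])

lemma emeasure_empirical_measure:
  fixes x :: "nat \<Rightarrow> 'a"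
  assumes "A \<subseteq> x ` {1..n}"
  shows "emeasure (empirical_measure n x) A = (\<Sum>i = 1..n. indicator A (x i)) / of_nat n"
proof (rule emeasure_measure_of[OF empirical_measure_def])
  interpret sigma_algebra "x ` {1..n}" "Pow (x ` {1..n})" by (rule sigma_algebra_Pow)
  let ?\<mu> = "\<lambda>A :: 'a set. (\<Sum>i = 1..n. indicator A (x i)) / of_nat n :: ennreal"
  show pos: "positive (sets (empirical_measure n x)) ?\<mu>"
    by (simp add: positive_def)
  have "additive (Pow (x ` {1..n})) ?\<mu>"
    unfolding additive_def
  proof (intro ballI impI)
    fix A B :: "'a set" assume "A \<inter> B = {}"
    then show "?\<mu> (A \<union> B) = ?\<mu> A + ?\<mu> B"
      by (simp add: indicator_add[symmetric] sum.distrib divide_ennreal_def distrib_right)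
  qed
  with pos show "countably_additive (sets (empirical_measure n x)) ?\<mu>"
    using countably_additiveI_finite by simp
qed (use assms in auto)

lemma metric_measure_space_sample_model:
  assumes "Metric_space Y d" "x ` {1..n} \<subseteq> Y" "n \<ge> 1"
  shows "metric_measure_space (sample_model d n x)"
proof -
  define S where "S = x ` {1..n}"
  have S: "finite S" by (simp add: S_def)
  interpret Metric_space S d
    unfolding S_def by (rule Metric_space.subspace[OF assms(1,2)])
  have disc: "mtopology = discrete_topology S"
    by (intro finite_topspace_imp_discrete_topology Hausdorff_space_mtopology) (simp_all add: S)
  have "mcomplete"
    by (rule compact_space_imp_mcomplete) (simp add: disc S compact_space_discrete_topology)
  moreover have "separable_space mtopology"
    by (simp add: disc S separable_space_discrete_topology countable_finite)
  moreover have "sigma_sets S {U. openin mtopology U} = Pow S"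
    using sigma_algebra.sigma_sets_eq[OF sigma_algebra_Pow, of S] by (simp add: disc Pow_def)
  moreover have "prob_space (empirical_measure n x)"
  proof
    have "(\<Sum>i = 1..n. indicator (x ` {1..n}) (x i) :: ennreal) = (\<Sum>i = 1..n. 1)"
      by (intro sum.cong) (simp_all add: indicator_def)
    then show "emeasure (empirical_measure n x) (space (empirical_measure n x)) = 1"
      using assms(3) by (subst emeasure_empirical_measure) (simp_all add: ennreal_divide_self ennreal_of_nat_eq_real_of_nat)
  qed
  ultimately show ?thesis
    unfolding metric_measure_space_def sample_model_def
    using Metric_space_axioms
    by (simp add: S_def del: One_nat_def)
qed


subsection \<open>Third cumulant\<close>

definition third_cumulant :: "'a measure \<Rightarrow> ('a \<Rightarrow> real) \<Rightarrow> real" where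
  "third_cumulant M Z =
     (\<integral>\<omega>. Z \<omega> ^ 3 \<partial>M) - 3 * (\<integral>\<omega>. Z \<omega> \<partial>M) * (\<integral>\<omega>. Z \<omega> ^ 2 \<partial>M) + 2 * (\<integral>\<omega>. Z \<omega> \<partial>M) ^ 3"

end

theory Submission
  imports Defs
begin

text \<open>
  Put \<open>h = d - 1/4\<close>, which is degenerate: \<open>\<integral> h(x,y) dy = 0\<close>. Expanding \<open>d = 1/4 + h\<close> gives
  \<open>n (\<Phi>(X\<^sub>n) - 1/16) = (1/2n) \<Sum>\<^sub>i\<^sub>,\<^sub>j h(X\<^sub>i,X\<^sub>j) + n\<^sup>-\<^sup>2 \<Sum>\<^sub>j (\<Sum>\<^sub>i h(X\<^sub>i,X\<^sub>j))\<^sup>2\<close>. With the Fourier expansion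
  \<open>h(x,y) = \<Sum> c\<^sub>k e\<^sub>k(x - y)\<close>, \<open>c\<^sub>k = - 1/(\<pi> k)\<^sup>2\<close> over odd \<open>k\<close>, and \<open>z\<^sub>k = n\<^sup>-\<^sup>1\<^sup>/\<^sup>2 \<Sum>\<^sub>i e\<^sub>k(X\<^sub>i)\<close>, this equals
  \<open>- \<Sum>\<^sub>k b\<^sub>k |z\<^sub>k|\<^sup>2\<close> over odd \<open>k > 0\<close> with \<open>b\<^sub>k = - c\<^sub>k - 2 c\<^sub>k\<^sup>2 > 0\<close>, up to an error \<open>O(n\<^sup>-\<^sup>1\<^sup>/\<^sup>2)\<close> in \<open>L\<^sup>1\<close>. The
  \<open>|z\<^sub>k|\<^sup>2\<close> converge jointly to independent standard exponential variables \<open>E\<^sub>k\<close>, so the limit is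
  \<open>- \<Sum>\<^sub>k b\<^sub>k E\<^sub>k\<close>, whose variance \<open>\<Sum>\<^sub>k b\<^sub>k\<^sup>2\<close> and third cumulant \<open>- 2 \<Sum>\<^sub>k b\<^sub>k\<^sup>3\<close> are rational by the values
  of \<open>\<Sum>\<^sub>k k\<^sup>-\<^sup>2\<^sup>j\<close> over odd \<open>k\<close>. Sub-Gaussian moment bounds give the convergence of the variances.
\<close>

section \<open>Fourier series of a triangle wave and odd zeta values\<close>

text \<open>Degeneracy of \<open>h\<close> removes the term of order n^(-1/2), so the fluctuations
  and the bias of the observable are both of order 1/n. The mean of the limit therefore survives the
  normalisation: centering at the expectation and centering at the observable of the circle give
  limits that differ by a constant shift. Two difficulties shape the proof. Infinitely many
  frequencies contribute, so the distance is truncated at a level K with estimates uniform in K, and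
  K tends to infinity while n is fixed; an independent cutoff \<open>K\<^sub>0\<close> of the
  limiting quadratic form stays fixed while n grows and is removed last. Secondly, finitely many z_k
  must be treated jointly. Only the Laplace transform of a nonnegative combination of the |z_k|^2 is
  computed, by linearising each square with an auxiliary Gaussian; this is why the sign of the
  statistic is reversed and why b_k >= 0 matters.\<close>

definition odd_cos_series :: "nat \<Rightarrow> real \<Rightarrow> real" where
  "odd_cos_series j u = (\<Sum>m. cos (real (2 * m + 1) * u) / real (2 * m + 1) ^ (2 * j))"

text \<open>The parities of the exponents match, so that differentiation stays inside the two
  families: writing C_j and S_j for the series, S_j' = C_j and C_(j+1)' = - S_j.\<close>

definition odd_sin_series :: "nat \<Rightarrow> real \<Rightarrow> real" where
  "odd_sin_series j u = (\<Sum>m. sin (real (2 * m + 1) * u) / real (2 * m + 1) ^ (2 * j + 1))"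

lemma summable_inverse_odd_squares: "summable (\<lambda>m. 1 / real (2 * m + 1) ^ 2)"
proof (rule summable_comparison_test')
  show "summable (\<lambda>m. inverse (real (Suc m) ^ 2))"
    using inverse_power_summable[of 2, where ?'a = real] by (subst summable_Suc_iff) simp
  show "norm (1 / real (2 * m + 1) ^ 2) \<le> inverse (real (Suc m) ^ 2)" if "m \<ge> 0" for m
    by (simp add: field_simps power_mono)
qed

lemma odd_power_le:
  assumes "j \<ge> 2" "\<bar>c\<bar> \<le> (1::real)"
  shows "norm (c / real (2 * m + 1) ^ j) \<le> 1 / real (2 * m + 1) ^ 2"
proof -
  have "real (2 * m + 1) ^ 2 \<le> real (2 * m + 1) ^ j"
    by (rule power_increasing) (use assms in auto)
  then show ?thesis
    using assms(2) by (simp only: real_norm_def abs_divide) (intro frac_le, auto)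
qed

lemma uniformly_convergent_odd_trig:
  assumes "j \<ge> 2" "\<And>m u. \<bar>f m u\<bar> \<le> (1::real)"
  shows "uniformly_convergent_on UNIV (\<lambda>N u. \<Sum>m<N. f m u / real (2 * m + 1) ^ j)"
  by (rule Weierstrass_m_test'[OF _ summable_inverse_odd_squares]) (rule odd_power_le[OF assms])

lemma summable_odd_trig:
  assumes "j \<ge> 2" "\<And>m. \<bar>f m\<bar> \<le> (1::real)"
  shows "summable (\<lambda>m. f m / real (2 * m + 1) ^ j)"
  by (rule summable_comparison_test'[OF summable_inverse_odd_squares]) (rule odd_power_le[OF assms])

text \<open>Termwise differentiation needs uniform convergence of the derived series, which the
  exponent \<open>2 * j\<close> >= 2 secures. One level lower this breaks down:
  \<open>odd_cos_series 1\<close> is a triangle wave with corners and gets a separate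
  treatment.\<close>

lemma DERIV_odd_sin_series:
  assumes "j \<ge> 1"
  shows "(odd_sin_series j has_real_derivative odd_cos_series j u) (at u)"
  unfolding odd_sin_series_def odd_cos_series_def
proof (rule has_field_derivative_series'(2)[where S = UNIV and ?x0.0 = 0])
  show "uniformly_convergent_on UNIV
      (\<lambda>N u. \<Sum>m<N. cos (real (2 * m + 1) * u) / real (2 * m + 1) ^ (2 * j))"
    by (rule uniformly_convergent_odd_trig) (use assms in auto)
qed (auto intro!: derivative_eq_intros)

lemma DERIV_odd_cos_series:
  assumes "j \<ge> 1"
  shows "(odd_cos_series (Suc j) has_real_derivative - odd_sin_series j u) (at u)"
proof -
  have "((\<lambda>u. \<Sum>m. cos (real (2 * m + 1) * u) / real (2 * m + 1) ^ (2 * Suc j)) has_real_derivative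
      (\<Sum>m. - sin (real (2 * m + 1) * u) / real (2 * m + 1) ^ (2 * j + 1))) (at u)"
  proof (rule has_field_derivative_series'(2)[where S = UNIV and ?x0.0 = 0])
    show "uniformly_convergent_on UNIV
        (\<lambda>N u. \<Sum>m<N. - sin (real (2 * m + 1) * u) / real (2 * m + 1) ^ (2 * j + 1))"
      by (rule uniformly_convergent_odd_trig) (use assms in auto)
    show "summable (\<lambda>m. cos (real (2 * m + 1) * 0) / real (2 * m + 1) ^ (2 * Suc j))"
      by (rule summable_odd_trig) auto
  qed (auto intro!: derivative_eq_intros)
  moreover have "(\<Sum>m. - sin (real (2 * m + 1) * u) / real (2 * m + 1) ^ (2 * j + 1)) = - odd_sin_series j u"
  proof -
    have "summable (\<lambda>m. sin (real (2 * m + 1) * u) / real (2 * m + 1) ^ (2 * j + 1))"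
      by (rule summable_odd_trig) (use assms in auto)
    from suminf_minus[OF this] show ?thesis by (simp add: odd_sin_series_def)
  qed
  ultimately show ?thesis
    unfolding odd_cos_series_def[abs_def] by simp
qed

lemma cos_odd_half_pi: "cos (real (2 * m + 1) * (pi / 2)) = 0"
  using cos_pi_half by (auto simp: cos_zero_iff_int intro!: exI[of _ "2 * int m + 1"])

lemma odd_cos_series_half_pi: "odd_cos_series j (pi / 2) = 0"
  unfolding odd_cos_series_def cos_odd_half_pi by simp

section \<open>Closed form of the triangle wave\<close>

text \<open>The factor \<open>2 * sin u\<close> turns each cosine into sin((2m+2)u) - sin(2mu), and
  the sum telescopes.\<close>

lemma sum_cos_odd: "2 * sin u * (\<Sum>m<N. cos (real (2 * m + 1) * u)) = sin (2 * real N * u)"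
proof (induction N)
  case (Suc N)
  have "2 * sin u * cos (real (2 * N + 1) * u) = sin (2 * real (Suc N) * u) - sin (2 * real N * u)"
    using sin_times_cos[of u "real (2 * N + 1) * u"] sin_minus[of "2 * real N * u"]
    by (simp add: algebra_simps)
  then show ?case using Suc by (simp add: algebra_simps)
qed simp

text \<open>Integration by parts in disguise: the derivative of the partial sum is sin(2Nv) / (2 sin
  v), which oscillates without becoming small, but its primitive varies only by O(1/N) away from the
  zeros of sin. In the constant, \<open>pi\<close> comes from the mean value estimate and 2 from the
  correction terms at the two points.\<close>

lemma odd_sin_sum_bound:
  assumes "0 < a" "a \<le> pi / 2" "u \<in> {a..pi - a}" "N \<ge> 1"
  shows "\<bar>(\<Sum>m<N. sin (real (2 * m + 1) * u) / real (2 * m + 1)) -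
           (\<Sum>m<N. sin (real (2 * m + 1) * (pi / 2)) / real (2 * m + 1))\<bar>
         \<le> ((pi + 2) / (4 * sin a ^ 2)) / real N"
proof -
  define s where "s v = (\<Sum>m<N. sin (real (2 * m + 1) * v) / real (2 * m + 1))" for v :: real
  \<comment> \<open>The added term has derivative - sin(2Nv) / (2 sin v) up to O(1/N), which cancels
    the derivative of \<open>s\<close>; the term itself is O(1/N).\<close>
  define g where "g v = s v + cos (2 * real N * v) / (4 * real N * sin v)" for v
  have sa: "sin a > 0" using assms pi_gt_zero by (intro sin_gt_zero) linarith+
  have sin_ge: "sin v \<ge> sin a" if "v \<in> {a..pi - a}" for v
  proof (cases "v \<le> pi / 2")
    case True
    then show ?thesis using that assms by (intro sin_monotone_2pi_le) auto
  next
    case False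
    then have "sin (pi - v) \<ge> sin a" using that assms by (intro sin_monotone_2pi_le) auto
    then show ?thesis by simp
  qed
  have Npos: "real N > 0" using assms by simp
  have der: "(g has_real_derivative - (cos (2 * real N * v) * cos v / (4 * real N * sin v ^ 2)))
      (at v within {a..pi - a})" if v: "v \<in> {a..pi - a}" for v
  proof -
    have sv: "sin v > 0" using sin_ge[OF v] sa by linarith
    have "(s has_real_derivative (\<Sum>m<N. cos (real (2 * m + 1) * v))) (at v within {a..pi - a})"
      unfolding s_def by (auto intro!: derivative_eq_intros sum.cong)
    moreover have "(\<Sum>m<N. cos (real (2 * m + 1) * v)) = sin (2 * real N * v) / (2 * sin v)"
      using sum_cos_odd[of v N] sv by (simp add: field_simps)
    ultimately have "(s has_real_derivative sin (2 * real N * v) / (2 * sin v)) (at v within {a..pi - a})"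
      by simp
    moreover have "((\<lambda>v. cos (2 * real N * v) / (4 * real N * sin v)) has_real_derivative
        ((- sin (2 * real N * v) * (2 * real N)) * (4 * real N * sin v) - cos (2 * real N * v) * (4 * real N * cos v)) /
        ((4 * real N * sin v) * (4 * real N * sin v))) (at v within {a..pi - a})"
    proof (rule DERIV_divide)
      show "((\<lambda>v. cos (2 * real N * v)) has_real_derivative - sin (2 * real N * v) * (2 * real N)) (at v within {a..pi - a})"
        by (auto intro!: derivative_eq_intros)
      show "((\<lambda>v. 4 * real N * sin v) has_real_derivative 4 * real N * cos v) (at v within {a..pi - a})"
        by (auto intro!: derivative_eq_intros)
    qed (use sv Npos in simp)
    ultimately have "(g has_real_derivative sin (2 * real N * v) / (2 * sin v) +
        ((- sin (2 * real N * v) * (2 * real N)) * (4 * real N * sin v) - cos (2 * real N * v) * (4 * real N * cos v)) /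
        ((4 * real N * sin v) * (4 * real N * sin v))) (at v within {a..pi - a})"
      unfolding g_def by (rule DERIV_add)
    moreover have "S / (2 * t) + ((- S * (2 * n)) * (4 * n * t) - C * (4 * n * c)) / ((4 * n * t) * (4 * n * t))
        = - (C * c / (4 * n * t ^ 2))" if "t > 0" "n > 0" for S C c t n :: real
      using that by (simp add: divide_simps power2_eq_square) (simp add: algebra_simps)?
    ultimately show ?thesis using sv Npos by simp
  qed
  have bound: "\<bar>cos (2 * real N * v) * cos v / (4 * real N * sin v ^ 2)\<bar> \<le> 1 / (4 * real N * sin a ^ 2)"
    if v: "v \<in> {a..pi - a}" for v
  proof -
    have "\<bar>cos (2 * real N * v) * cos v\<bar> \<le> 1 * 1"
      unfolding abs_mult by (intro mult_mono) auto
    moreover have "sin a ^ 2 \<le> sin v ^ 2" using sin_ge[OF v] sa by (intro power_mono) auto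
    ultimately show ?thesis unfolding abs_divide using sa Npos
      by (intro frac_le) (auto simp: abs_mult)
  qed
  have half: "pi / 2 \<in> {a..pi - a}" using assms by simp
  have "norm (g u - g (pi / 2)) \<le> 1 / (4 * real N * sin a ^ 2) * norm (u - pi / 2)"
    by (rule field_differentiable_bound[OF _ der]) (use bound half assms in auto)
  also have "\<dots> \<le> 1 / (4 * real N * sin a ^ 2) * pi"
    using assms Npos sa by (intro mult_left_mono) auto
  finally have 1: "\<bar>g u - g (pi / 2)\<bar> \<le> pi / (4 * real N * sin a ^ 2)" by simp
  have 2: "\<bar>cos (2 * real N * v) / (4 * real N * sin v)\<bar> \<le> 1 / (4 * real N * sin a ^ 2)"
    if v: "v \<in> {a..pi - a}" for v
  proof -
    have "sin a ^ 2 \<le> sin a * 1"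
      unfolding power2_eq_square using sa by (intro mult_left_mono) auto
    also have "\<dots> \<le> sin v" using sin_ge[OF v] by simp
    finally show ?thesis unfolding abs_divide using sa Npos
      by (intro frac_le) (auto simp: abs_mult)
  qed
  have "\<bar>s u - s (pi / 2)\<bar> \<le> pi / (4 * real N * sin a ^ 2) + 2 * (1 / (4 * real N * sin a ^ 2))"
    using 1 2[OF assms(3)] 2[OF half] unfolding g_def by linarith
  also have "\<dots> = ((pi + 2) / (4 * sin a ^ 2)) / real N"
    by (simp add: field_simps add_divide_distrib)
  finally show ?thesis unfolding s_def .
qed

text \<open>At \<open>pi / 2\<close> the sines alternate in sign, which leaves the Leibniz series of
  arctan 1.\<close>

lemma odd_sin_sum_half_pi:
  "(\<lambda>N. \<Sum>m<N. sin (real (2 * m + 1) * (pi / 2)) / real (2 * m + 1)) \<longlonglongrightarrow> pi / 4"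
proof -
  have "sin (real (2 * m + 1) * (pi / 2)) = (-1) ^ m" for m
  proof -
    have "real (2 * m + 1) * (pi / 2) = real m * pi + pi / 2" by (simp add: field_simps)
    then show ?thesis by (simp only: sin_add) simp
  qed
  moreover have "(\<lambda>m. (-1) ^ m * (1 / real (m * 2 + 1) * 1 ^ (m * 2 + 1))) sums (pi / 4)"
    unfolding arctan_one[symmetric] by (subst arctan_series, simp)
      (rule summable_sums, rule summable_arctan_series, simp_all)
  ultimately show ?thesis
    by (simp add: sums_def mult.commute)
qed

text \<open>Adding \<open>pi * v / 4\<close> to the partial cosine sums gives functions whose
  derivatives tend to 0 uniformly on compact subintervals, so the limit is constant. Its value is
  read off at \<open>pi / 2\<close>, where all the cosines vanish.\<close>

lemma odd_cos_series_1_interior: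
  assumes "0 < u" "u < pi"
  shows "odd_cos_series 1 u = pi ^ 2 / 8 - pi * u / 4"
proof -
  \<comment> \<open>The symmetric interval with this margin contains both \<open>u\<close> and the
    reference point \<open>pi / 2\<close>.\<close>
  define a where "a = min u (pi - u)"
  have a: "0 < a" "a \<le> pi / 2" "u \<in> {a..pi - a}" "pi / 2 \<in> {a..pi - a}"
    using assms by (auto simp: a_def min_def)
  define q where "q N v = (\<Sum>m<N. cos (real (2 * m + 1) * v) / real (2 * m + 1) ^ 2) + pi * v / 4" for N v
  define s where "s N v = (\<Sum>m<N. sin (real (2 * m + 1) * v) / real (2 * m + 1))" for N v
  define e where "e N = ((pi + 2) / (4 * sin a ^ 2)) / real N + \<bar>s N (pi / 2) - pi / 4\<bar>" for N
  have "(\<lambda>N. e N * pi) \<longlonglongrightarrow> (0 + \<bar>pi / 4 - pi / 4\<bar>) * pi"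
    unfolding e_def using odd_sin_sum_half_pi unfolding s_def
    by (intro tendsto_intros lim_const_over_n) auto
  then have e: "(\<lambda>N. e N * pi) \<longlonglongrightarrow> 0" by simp
  have der: "(q N has_real_derivative (- s N v + pi / 4)) (at v within {a..pi - a})" for N v
    unfolding q_def s_def
    by (auto intro!: derivative_eq_intros simp: sum_negf[symmetric] power2_eq_square)
  have "\<bar>q N u - q N (pi / 2)\<bar> \<le> e N * pi" if "N \<ge> 1" for N
  proof -
    have "norm (q N u - q N (pi / 2)) \<le> e N * norm (u - pi / 2)"
    proof (rule field_differentiable_bound[OF _ der])
      fix v assume "v \<in> {a..pi - a}"
      from odd_sin_sum_bound[OF a(1,2) this that]
      show "norm (- s N v + pi / 4) \<le> e N" unfolding e_def s_def by simp
    qed (use a in auto)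
    also have "\<dots> \<le> e N * pi"
      using assms by (intro mult_left_mono) (auto simp: e_def)
    finally show ?thesis by simp
  qed
  then have "(\<lambda>N. q N u - q N (pi / 2)) \<longlonglongrightarrow> 0"
    by (intro Lim_null_comparison[OF _ e] eventually_sequentiallyI[of 1]) simp
  moreover have "(\<lambda>N. q N v) \<longlonglongrightarrow> odd_cos_series 1 v + pi * v / 4" for v
  proof -
    have "summable (\<lambda>m. cos (real (2 * m + 1) * v) / real (2 * m + 1) ^ 2)"
      by (rule summable_odd_trig) auto
    then show ?thesis unfolding q_def odd_cos_series_def
      by (intro tendsto_intros) (simp add: summable_LIMSEQ)
  qed
  then have "(\<lambda>N. q N u - q N (pi / 2)) \<longlonglongrightarrow>
      odd_cos_series 1 u + pi * u / 4 - (odd_cos_series 1 (pi / 2) + pi * (pi / 2) / 4)"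
    by (intro tendsto_diff)
  ultimately have "odd_cos_series 1 u + pi * u / 4 - (odd_cos_series 1 (pi / 2) + pi * (pi / 2) / 4) = 0"
    by (rule LIMSEQ_unique[rotated])
  then show ?thesis by (simp add: odd_cos_series_half_pi power2_eq_square)
qed

lemma continuous_odd_cos_series_1: "continuous_on UNIV (odd_cos_series 1)"
proof -
  have "uniform_limit UNIV (\<lambda>N u. \<Sum>m<N. cos (real (2 * m + 1) * u) / real (2 * m + 1) ^ (2 * 1))
      (odd_cos_series 1) sequentially"
    unfolding odd_cos_series_def
    by (rule Weierstrass_m_test[OF _ summable_inverse_odd_squares]) (rule odd_power_le, auto)
  then show ?thesis
    by (rule uniform_limit_theorem[rotated]) (auto intro!: always_eventually continuous_intros)
qed

text \<open>Continuity carries the formula to the endpoints; the endpoint 0 is the one that yields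
  the sum of the inverse odd squares.\<close>

lemma odd_cos_series_1:
  assumes "0 \<le> u" "u \<le> pi"
  shows "odd_cos_series 1 u = pi ^ 2 / 8 - pi * u / 4"
proof -
  have "odd_cos_series 1 u - (pi ^ 2 / 8 - pi * u / 4) = 0"
  proof (rule continuous_constant_on_closure[where S = "{0<..<pi}" and
      f = "\<lambda>u. odd_cos_series 1 u - (pi ^ 2 / 8 - pi * u / 4)"])
    show "continuous_on (closure {0<..<pi}) (\<lambda>u. odd_cos_series 1 u - (pi ^ 2 / 8 - pi * u / 4))"
      by (intro continuous_intros continuous_on_subset[OF continuous_odd_cos_series_1]) auto
  qed (use assms odd_cos_series_1_interior in auto)
  then show ?thesis by simp
qed

section \<open>Higher cosine series and their values at 0\<close>

lemma DERIV_monomial: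
  "((\<lambda>u::real. c * u ^ n / d) has_real_derivative c * (real n * v ^ (n - 1)) / d) (at v)"
  by (rule DERIV_cdivide, rule DERIV_cmult) (use DERIV_pow[of n v] in simp)

text \<open>The result of integrating the triangle wave 2(j-1) times from 0: every even coefficient
  is an integration constant, namely a lower series at 0, and the single odd power descends from the
  linear term \<open>- pi * u / 4\<close>.\<close>

definition odd_cos_poly :: "nat \<Rightarrow> real \<Rightarrow> real" where
  "odd_cos_poly j u = (\<Sum>i<j. (-1) ^ i * odd_cos_series (j - i) 0 * u ^ (2 * i) / fact (2 * i)) +
     (-1) ^ j * (pi / 4) * u ^ (2 * j - 1) / fact (2 * j - 1)"

text \<open>Each induction step integrates twice, from the cosine series to the sine series and on
  to the next cosine series. Both constants are fixed at 0, where the sine series vanishes and the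
  polynomial has the right value by construction.\<close>

lemma odd_cos_series_eq_poly:
  assumes "j \<ge> 1" "0 \<le> u" "u \<le> pi"
  shows "odd_cos_series j u = odd_cos_poly j u"
  using assms
proof (induction j arbitrary: u rule: dec_induct)
  case base
  then show ?case
    using odd_cos_series_1[of u] odd_cos_series_1[of 0] by (simp add: odd_cos_poly_def)
next
  case (step j)
  \<comment> \<open>The primitive of \<open>odd_cos_poly j\<close> that vanishes at 0, to be
    identified with the sine series.\<close>
  define Q where "Q u = (\<Sum>i<j. (-1) ^ i * odd_cos_series (j - i) 0 * u ^ (2 * i + 1) / fact (2 * i + 1)) +
     (-1) ^ j * (pi / 4) * u ^ (2 * j) / fact (2 * j)" for u
  have dQ: "(Q has_real_derivative odd_cos_poly j v) (at v)" for v
  proof -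
    obtain i where i: "j = Suc i" using step by (cases j) auto
    have "(Q has_real_derivative
      (\<Sum>i<j. (-1) ^ i * odd_cos_series (j - i) 0 * (real (2 * i + 1) * v ^ (2 * i + 1 - 1)) / fact (2 * i + 1)) +
     (-1) ^ j * (pi / 4) * (real (2 * j) * v ^ (2 * j - 1)) / fact (2 * j)) (at v)"
      unfolding Q_def by (intro DERIV_add DERIV_sum DERIV_monomial)
    also have "(\<Sum>i<j. (-1) ^ i * odd_cos_series (j - i) 0 * (real (2 * i + 1) * v ^ (2 * i + 1 - 1)) / fact (2 * i + 1)) =
      (\<Sum>i<j. (-1) ^ i * odd_cos_series (j - i) 0 * v ^ (2 * i) / fact (2 * i))"
      by (intro sum.cong refl) (simp add: divide_simps)
    also have "(-1) ^ j * (pi / 4) * (real (2 * j) * v ^ (2 * j - 1)) / fact (2 * j) =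
        (-1) ^ j * (pi / 4) * v ^ (2 * j - 1) / (fact (2 * j - 1) :: real)"
      using step(1) by (subst (1) fact_reduce) (auto simp: divide_simps)
    finally show ?thesis unfolding odd_cos_poly_def .
  qed
  have dP: "(odd_cos_poly (Suc j) has_real_derivative - Q v) (at v)" for v
  proof -
    have "odd_cos_poly (Suc j) = (\<lambda>u. odd_cos_series (Suc j) 0 -
      ((\<Sum>i<j. (-1) ^ i * odd_cos_series (j - i) 0 * u ^ (2 * i + 2) / fact (2 * i + 2)) +
     (-1) ^ j * (pi / 4) * u ^ (2 * j + 1) / fact (2 * j + 1)))"
      unfolding odd_cos_poly_def
      by (simp add: sum.lessThan_Suc_shift sum_negf fun_eq_iff del: sum.lessThan_Suc fact_Suc)
    moreover have "((\<lambda>u. odd_cos_series (Suc j) 0 -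
      ((\<Sum>i<j. (-1) ^ i * odd_cos_series (j - i) 0 * u ^ (2 * i + 2) / fact (2 * i + 2)) +
     (-1) ^ j * (pi / 4) * u ^ (2 * j + 1) / fact (2 * j + 1))) has_real_derivative
     0 - ((\<Sum>i<j. (-1) ^ i * odd_cos_series (j - i) 0 * (real (2 * i + 2) * v ^ (2 * i + 2 - 1)) / fact (2 * i + 2)) +
     (-1) ^ j * (pi / 4) * (real (2 * j + 1) * v ^ (2 * j + 1 - 1)) / fact (2 * j + 1))) (at v)"
      by (intro DERIV_diff DERIV_const DERIV_add DERIV_sum DERIV_monomial)
    moreover have "(\<Sum>i<j. (-1) ^ i * odd_cos_series (j - i) 0 * (real (2 * i + 2) * v ^ (2 * i + 2 - 1)) / fact (2 * i + 2)) =
      (\<Sum>i<j. (-1) ^ i * odd_cos_series (j - i) 0 * v ^ (2 * i + 1) / fact (2 * i + 1))"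
    proof (intro sum.cong refl)
      fix i
      have "(fact (2 * i + 2) :: real) = real (2 * i + 2) * fact (2 * i + 1)" by simp
      then show "(-1) ^ i * odd_cos_series (j - i) 0 * (real (2 * i + 2) * v ^ (2 * i + 2 - 1)) / fact (2 * i + 2) =
         (-1) ^ i * odd_cos_series (j - i) 0 * v ^ (2 * i + 1) / fact (2 * i + 1)"
        by (simp del: fact_Suc)
    qed
    moreover have "(-1) ^ j * (pi / 4) * (real (2 * j + 1) * v ^ (2 * j + 1 - 1)) / fact (2 * j + 1) =
       (-1) ^ j * (pi / 4) * v ^ (2 * j) / (fact (2 * j) :: real)"
      by (simp add: divide_simps)
    ultimately show ?thesis unfolding Q_def by (simp only: diff_0)
  qed
  have S: "odd_sin_series j v = Q v" if v: "v \<in> {0..pi}" for v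
  proof -
    have "\<exists>c. \<forall>v\<in>{0..pi}. odd_sin_series j v - Q v = c"
    proof (rule has_field_derivative_zero_constant)
      fix v assume v: "v \<in> {0..pi}"
      have "((\<lambda>v. odd_sin_series j v - Q v) has_real_derivative
          odd_cos_series j v - odd_cos_poly j v) (at v)"
        by (intro DERIV_diff dQ DERIV_odd_sin_series step)
      then show "((\<lambda>v. odd_sin_series j v - Q v) has_real_derivative 0) (at v within {0..pi})"
        using step.IH[of v] v by (simp add: has_field_derivative_at_within)
    qed simp
    then obtain c where c: "\<And>v. v \<in> {0..pi} \<Longrightarrow> odd_sin_series j v - Q v = c" by blast
    have "odd_sin_series j 0 = 0" "Q 0 = 0"
      using step(1) by (simp_all add: odd_sin_series_def Q_def)
    then show ?thesis using c[OF v] c[of 0] by simp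
  qed
  have "\<exists>c. \<forall>v\<in>{0..pi}. odd_cos_series (Suc j) v - odd_cos_poly (Suc j) v = c"
  proof (rule has_field_derivative_zero_constant)
    fix v assume v: "v \<in> {0..pi}"
    have "((\<lambda>v. odd_cos_series (Suc j) v - odd_cos_poly (Suc j) v) has_real_derivative
        - odd_sin_series j v - - Q v) (at v)"
      by (intro DERIV_diff dP DERIV_odd_cos_series step)
    then show "((\<lambda>v. odd_cos_series (Suc j) v - odd_cos_poly (Suc j) v) has_real_derivative 0)
        (at v within {0..pi})"
      using S[OF v] by (simp add: has_field_derivative_at_within)
  qed simp
  then obtain c where c: "\<And>v. v \<in> {0..pi} \<Longrightarrow> odd_cos_series (Suc j) v - odd_cos_poly (Suc j) v = c"
    by blast
  have "odd_cos_poly (Suc j) 0 = odd_cos_series (Suc j) 0"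
    unfolding odd_cos_poly_def using step(1)
    by (simp add: sum.lessThan_Suc_shift del: sum.lessThan_Suc)
  then show ?case using c[of u] c[of 0] step.prems by simp
qed

text \<open>Since all the cosines vanish at \<open>pi / 2\<close>, this identity is a recursion for the values at \<open>0\<close>.\<close>

lemma odd_cos_poly_half_pi: "j \<ge> 1 \<Longrightarrow> odd_cos_poly j (pi / 2) = 0"
  using odd_cos_series_eq_poly[of j "pi / 2"] by (simp add: odd_cos_series_half_pi)

text \<open>These are (1 - 2^(-2j)) zeta(2j). Each value is found by solving the vanishing of
  \<open>odd_cos_poly j\<close> at \<open>pi / 2\<close> for its term \<open>i = 0\<close>. Six
  levels are required because the third cumulant involves cubes of b_k = w - 2 w^2 with w = 1/(pi
  k)^2, hence w^6.\<close>

lemma odd_zeta_values: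
  "odd_cos_series 1 0 = pi ^ 2 / 8" "odd_cos_series 2 0 = pi ^ 4 / 96"
  "odd_cos_series 3 0 = pi ^ 6 / 960" "odd_cos_series 4 0 = 17 * pi ^ 8 / 161280"
  "odd_cos_series 5 0 = 31 * pi ^ 10 / 2903040" "odd_cos_series 6 0 = 691 * pi ^ 12 / 638668800"
proof -
  note expand = odd_cos_poly_def lessThan_nat_numeral lessThan_Suc fact_numeral
  note arith = eval_nat_numeral field_simps
  show l1: "odd_cos_series 1 0 = pi ^ 2 / 8" using odd_cos_series_1[of 0] by simp
  note l1' = l1[unfolded One_nat_def]
  show l2: "odd_cos_series 2 0 = pi ^ 4 / 96"
    using odd_cos_poly_half_pi[of 2] by (simp add: expand l1') (simp add: arith)
  show l3: "odd_cos_series 3 0 = pi ^ 6 / 960"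
    using odd_cos_poly_half_pi[of 3] by (simp add: expand l1' l2) (simp add: arith)
  show l4: "odd_cos_series 4 0 = 17 * pi ^ 8 / 161280"
    using odd_cos_poly_half_pi[of 4] by (simp add: expand l1' l2 l3) (simp add: arith)
  show l5: "odd_cos_series 5 0 = 31 * pi ^ 10 / 2903040"
    using odd_cos_poly_half_pi[of 5] by (simp add: expand l1' l2 l3 l4) (simp add: arith)
  show l6: "odd_cos_series 6 0 = 691 * pi ^ 12 / 638668800"
    using odd_cos_poly_half_pi[of 6] by (simp add: expand l1' l2 l3 l4 l5) (simp add: arith)
qed

lemma odd_zeta_sums:
  assumes "j \<ge> 1"
  shows "(\<lambda>m. 1 / real (2 * m + 1) ^ (2 * j)) sums odd_cos_series j 0"
proof -
  have "summable (\<lambda>m. 1 / real (2 * m + 1) ^ (2 * j))"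
    by (rule summable_odd_trig) (use assms in auto)
  then show ?thesis by (simp add: odd_cos_series_def summable_sums)
qed

section \<open>Laplace transforms of quadratic forms in i.i.d. sums\<close>

lemma integral_norm_bound_integral':
  fixes f :: "'a \<Rightarrow> 'b :: {banach, second_countable_topology}"
  assumes "integrable M g" "\<And>x. norm (f x) \<le> g x"
  shows "norm (\<integral>x. f x \<partial>M) \<le> (\<integral>x. g x \<partial>M)"
  by (rule order_trans[OF integral_norm_bound integral_mono'])
     (use assms norm_ge_zero order_trans in blast)+

text \<open>The integrand times the standard density is \<open>\<tau>\<close> times the centered
  normal density of variance \<open>\<tau>\<close>^2 = 1 / (1 + 2 \<open>\<beta>\<close>), which has
  mass 1.\<close>

lemma integral_std_normal_exp_square:
  assumes "\<beta> \<ge> 0"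
  shows "(\<integral>g. exp (- \<beta> * g ^ 2) \<partial>std_normal_distribution) = 1 / sqrt (1 + 2 * \<beta>)"
proof -
  define \<tau> where "\<tau> = 1 / sqrt (1 + 2 * \<beta>)"
  have \<tau>: "\<tau> > 0" "\<tau> ^ 2 = 1 / (1 + 2 * \<beta>)" using assms by (simp_all add: \<tau>_def power_divide)
  have "std_normal_density g * exp (- \<beta> * g ^ 2) = \<tau> * normal_density 0 \<tau> g" for g
  proof -
    have "- g\<^sup>2 / 2 + - \<beta> * g ^ 2 = - (g - 0)\<^sup>2 / (2 * \<tau>\<^sup>2)"
      using assms unfolding \<tau>(2) by (simp add: field_simps)
    moreover have "sqrt (2 * pi * \<tau>\<^sup>2) = sqrt (2 * pi) * \<tau>"
      using \<tau>(1) by (simp add: real_sqrt_mult)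
    ultimately show ?thesis
      using \<tau>(1) unfolding normal_density_def by (simp add: exp_add[symmetric])
  qed
  then show ?thesis using \<tau>(1) by (subst integral_density) (simp_all add: \<tau>_def)
qed

text \<open>\<open>N\<close> is both the target space and the common law. Indices start at 0 here,
  so a sample numbered from 1 enters through \<open>Suc\<close>.\<close>

locale iid_sequence = prob_space M for M :: "'a measure" +
  fixes N :: "'b measure" and X :: "nat \<Rightarrow> 'a \<Rightarrow> 'b"
  assumes indep: "indep_vars (\<lambda>_. N) X UNIV"
    and distr_X: "\<And>i. distr M N (X i) = N"
begin

lemma X_measurable [measurable]: "X i \<in> M \<rightarrow>\<^sub>M N"
  using indep by (simp add: indep_vars_def2)

lemma prob_space_N: "prob_space N"
  using prob_space_distr[OF X_measurable[of 0]] distr_X by simp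

sublocale N: prob_space N by (rule prob_space_N)

definition nsum :: "('b \<Rightarrow> real) \<Rightarrow> nat \<Rightarrow> 'a \<Rightarrow> real" where
  "nsum p n \<omega> = (\<Sum>i<n. p (X i \<omega>)) / sqrt (real n)"

lemma nsum_measurable [measurable]:
  assumes [measurable]: "p \<in> borel_measurable N"
  shows "nsum p n \<in> borel_measurable M"
  unfolding nsum_def[abs_def] by measurable

lemma nsum_add: "nsum (\<lambda>x. p x + c * r x) n \<omega> = nsum p n \<omega> + c * nsum r n \<omega>"
  by (simp add: nsum_def sum.distrib sum_distrib_left add_divide_distrib)

lemma expectation_X:
  fixes p :: "'b \<Rightarrow> 'c :: {banach, second_countable_topology}"
  assumes [measurable]: "p \<in> borel_measurable N"
  shows "expectation (\<lambda>\<omega>. p (X i \<omega>)) = (\<integral>x. p x \<partial>N)"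
  using integral_distr[OF X_measurable assms, of i] by (simp add: distr_X)

lemma integrable_N_bounded:
  fixes p :: "'b \<Rightarrow> 'c :: {banach, second_countable_topology}"
  shows "p \<in> borel_measurable N \<Longrightarrow> (\<And>x. norm (p x) \<le> B) \<Longrightarrow> integrable N p"
  by (rule N.integrable_const_bound) auto

text \<open>The central limit theorem, read through the characteristic function at
  \<open>sqrt v\<close> so that the division by the standard deviation disappears. Variance 0 is
  treated apart, since the linear combinations to which this is applied may vanish.\<close>

lemma char_nsum_tendsto:
  assumes [measurable]: "p \<in> borel_measurable N" and B: "\<And>x. \<bar>p x\<bar> \<le> B" and mean: "(\<integral>x. p x \<partial>N) = 0"
  shows "(\<lambda>n. expectation (\<lambda>\<omega>. iexp (nsum p n \<omega>))) \<longlonglongrightarrow> complex_of_real (exp (- (\<integral>x. p x ^ 2 \<partial>N) / 2))"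
proof -
  define v where "v = (\<integral>x. p x ^ 2 \<partial>N)"
  have B2: "\<bar>p x\<bar> ^ 2 \<le> B ^ 2" for x using B[of x] by (intro power_mono) auto
  have int2: "integrable N (\<lambda>x. p x ^ 2)"
    by (rule integrable_N_bounded[where B = "B ^ 2"]) (use B2 in auto)
  have "v \<ge> 0" unfolding v_def by simp
  consider "v = 0" | "v > 0" using \<open>v \<ge> 0\<close> by linarith
  then show ?thesis
  proof cases
    case 1
    have "AE x in N. p x ^ 2 = 0"
      using 1 int2 unfolding v_def by (subst (asm) integral_nonneg_eq_0_iff_AE) auto
    then have "AE x in distr M N (X i). p x = 0" for i by (subst distr_X) simp
    then have "AE \<omega> in M. p (X i \<omega>) = 0" for i
      by (subst (asm) AE_distr_iff) auto
    then have AE: "AE \<omega> in M. \<forall>i. p (X i \<omega>) = 0" by (simp add: AE_all_countable)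
    have "expectation (\<lambda>\<omega>. iexp (nsum p n \<omega>)) = expectation (\<lambda>\<omega>. 1)" for n
      by (rule integral_cong_AE) (use AE in \<open>auto elim!: eventually_mono simp: nsum_def\<close>)
    then show ?thesis using 1 by (simp add: v_def prob_space)
  next
    case 2
    define Y where "Y i \<omega> = p (X i \<omega>)" for i \<omega>
    have Y: "indep_vars (\<lambda>_. borel) Y UNIV"
      unfolding Y_def by (rule indep_vars_compose2[OF indep]) simp
    have EY: "expectation (Y i) = 0" for i
      unfolding Y_def by (subst expectation_X) (simp_all add: mean)
    have "weak_conv_m (\<lambda>n. distr M borel (\<lambda>x. (\<Sum>i<n. Y i x) / sqrt (n * (sqrt v)\<^sup>2))) std_normal_distribution"
    proof (rule central_limit_theorem_zero_mean[OF Y EY, where \<mu> = "distr N borel p"])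
      show "integrable M (\<lambda>x. (Y n x)\<^sup>2)" for n
        unfolding Y_def by (rule integrable_const_bound[where B = "B ^ 2"]) (use B2 in auto)
      show "variance (Y n) = (sqrt v)\<^sup>2" for n
        using \<open>v \<ge> 0\<close> unfolding EY
        by (simp add: Y_def v_def expectation_X[of "\<lambda>x. p x ^ 2"])
      show "distr M borel (Y n) = distr N borel p" for n
        unfolding Y_def by (subst distr_X[of n, symmetric]) (simp add: distr_distr comp_def)
    qed (use 2 in auto)
    then have "(\<lambda>n. char (distr M borel (\<lambda>x. (\<Sum>i<n. Y i x) / sqrt (n * (sqrt v)\<^sup>2))) (sqrt v)) \<longlonglongrightarrow>
        char std_normal_distribution (sqrt v)"
      by (intro levy_continuity1 real_distribution_distr real_dist_normal_dist) (auto simp: Y_def)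
    also have "char std_normal_distribution (sqrt v) = complex_of_real (exp (- v / 2))"
      using \<open>v \<ge> 0\<close> by (simp add: char_std_normal_distribution)
    also have "(\<lambda>n. char (distr M borel (\<lambda>x. (\<Sum>i<n. Y i x) / sqrt (n * (sqrt v)\<^sup>2))) (sqrt v)) =
        (\<lambda>n. expectation (\<lambda>\<omega>. iexp (nsum p n \<omega>)))"
      unfolding char_def
    proof (subst integral_distr)
      show "(\<lambda>n. expectation (\<lambda>x. iexp (sqrt v * ((\<Sum>i<n. Y i x) / sqrt (n * (sqrt v)\<^sup>2))))) =
         (\<lambda>n. expectation (\<lambda>\<omega>. iexp (nsum p n \<omega>)))"
        using 2 by (simp add: nsum_def Y_def real_sqrt_mult)
    qed (auto simp: Y_def)
    finally show ?thesis unfolding v_def .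
  qed
qed

text \<open>Each factor \<open>exp (- \<beta> x\<^sup>2)\<close> is the average of \<open>exp (\<i> sqrt (2 \<beta>) g x)\<close> over a standard
  Gaussian \<open>g\<close>; this linearisation reduces the statement to the one-dimensional central limit theorem.\<close>

lemma laplace_nsum_tendsto_aux:
  fixes r :: "'j \<Rightarrow> 'b \<Rightarrow> real"
  assumes "finite J"
    and [measurable]: "p \<in> borel_measurable N" and "\<And>x. \<bar>p x\<bar> \<le> B" and "(\<integral>x. p x \<partial>N) = 0"
    and [measurable]: "\<And>j. r j \<in> borel_measurable N" and r_le: "\<And>j x. \<bar>r j x\<bar> \<le> C"
    and r_mean: "\<And>j. j \<in> J \<Longrightarrow> (\<integral>x. r j x \<partial>N) = 0"
    and r_orth: "\<And>i j. i \<in> J \<Longrightarrow> j \<in> J \<Longrightarrow> (\<integral>x. r i x * r j x \<partial>N) = of_bool (i = j)"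
    and "\<And>j. j \<in> J \<Longrightarrow> (\<integral>x. p x * r j x \<partial>N) = 0"
    and \<beta>: "\<And>j. j \<in> J \<Longrightarrow> \<beta> j \<ge> 0"
  shows "(\<lambda>n. expectation (\<lambda>\<omega>. iexp (nsum p n \<omega>) * of_real (\<Prod>j\<in>J. exp (- \<beta> j * nsum (r j) n \<omega> ^ 2))))
     \<longlonglongrightarrow> of_real (exp (- (\<integral>x. p x ^ 2 \<partial>N) / 2) * (\<Prod>j\<in>J. 1 / sqrt (1 + 2 * \<beta> j)))"
  using assms
proof (induction J arbitrary: p B rule: finite_induct)
  case empty
  then show ?case using char_nsum_tendsto[of p B] by simp
next
  case (insert a J)
  note [measurable] = insert.prems(1,4)
  define c where "c = sqrt (2 * \<beta> a)"
  have \<beta>a: "\<beta> a \<ge> 0" using insert.prems by auto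
  have c2: "c ^ 2 = 2 * \<beta> a" using \<beta>a by (simp add: c_def)
  \<comment> \<open>Replacing one Gaussian factor by its average over \<open>g\<close> adds a
    multiple of \<open>r a\<close> to the phase. The induction therefore has to carry a phase
    \<open>p\<close> orthogonal to the remaining \<open>r j\<close>.\<close>
  define Q where "Q g x = p x + c * g * r a x" for g x
  define W where "W n \<omega> = (\<Prod>j\<in>J. exp (- \<beta> j * nsum (r j) n \<omega> ^ 2))" for n \<omega>
  have [measurable]: "W n \<in> borel_measurable M" for n unfolding W_def by measurable
  have W: "0 \<le> W n \<omega>" "W n \<omega> \<le> 1" for n \<omega>
    unfolding W_def using insert.prems by (auto intro!: prod_nonneg prod_le_1)
  interpret G: real_distribution std_normal_distribution by (rule real_dist_normal_dist)
  interpret MG: pair_prob_space M std_normal_distribution ..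
  define F where "F n g = expectation (\<lambda>\<omega>. iexp (nsum (Q g) n \<omega>) * of_real (W n \<omega>))" for n g
  have nQ: "nsum (Q g) n \<omega> = nsum p n \<omega> + c * g * nsum (r a) n \<omega>" for g n \<omega>
    unfolding Q_def by (rule nsum_add)
  have bd: "norm (iexp x * of_real (W n \<omega>)) \<le> 1" for x n \<omega>
    using W[of n \<omega>] by (simp add: norm_mult)
  have F_meas [measurable]: "F n \<in> borel_measurable borel" for n
    unfolding F_def nQ by measurable
  have F_le: "norm (F n g) \<le> 1" for n g
  proof -
    have "norm (F n g) \<le> expectation (\<lambda>\<omega>. 1)"
      unfolding F_def by (rule integral_norm_bound_integral') (use bd in auto)
    then show ?thesis by (simp add: prob_space)
  qed
  have step: "expectation (\<lambda>\<omega>. iexp (nsum p n \<omega>) *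
      of_real (\<Prod>j\<in>insert a J. exp (- \<beta> j * nsum (r j) n \<omega> ^ 2))) = (\<integral>g. F n g \<partial>std_normal_distribution)" for n
  proof -
    have "iexp (nsum p n \<omega>) * of_real (\<Prod>j\<in>insert a J. exp (- \<beta> j * nsum (r j) n \<omega> ^ 2)) =
       (\<integral>g. iexp (nsum (Q g) n \<omega>) * of_real (W n \<omega>) \<partial>std_normal_distribution)" for \<omega>
    proof -
      have "complex_of_real (exp (- \<beta> a * nsum (r a) n \<omega> ^ 2)) = char std_normal_distribution (c * nsum (r a) n \<omega>)"
        by (simp add: char_std_normal_distribution power_mult_distrib c2)
      also have "iexp (nsum p n \<omega>) * (\<dots> * of_real (W n \<omega>)) =
         (\<integral>g. iexp (nsum p n \<omega>) * (iexp (c * nsum (r a) n \<omega> * g) * of_real (W n \<omega>)) \<partial>std_normal_distribution)"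
        unfolding char_def by simp
      also have "\<dots> = (\<integral>g. iexp (nsum (Q g) n \<omega>) * of_real (W n \<omega>) \<partial>std_normal_distribution)"
        by (intro Bochner_Integration.integral_cong refl)
           (simp add: nQ exp_add[symmetric] distrib_left mult_ac)
      finally show ?thesis using insert.hyps by (simp add: W_def)
    qed
    then have "expectation (\<lambda>\<omega>. iexp (nsum p n \<omega>) * of_real (\<Prod>j\<in>insert a J. exp (- \<beta> j * nsum (r j) n \<omega> ^ 2))) =
       expectation (\<lambda>\<omega>. \<integral>g. iexp (nsum (Q g) n \<omega>) * of_real (W n \<omega>) \<partial>std_normal_distribution)" by simp
    also have "\<dots> = (\<integral>g. F n g \<partial>std_normal_distribution)"
      unfolding F_def
    proof (rule MG.Fubini_integral[symmetric])
      show "integrable (M \<Otimes>\<^sub>M std_normal_distribution)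
          (\<lambda>(\<omega>, g). iexp (nsum (Q g) n \<omega>) * of_real (W n \<omega>))"
        unfolding nQ
      proof (rule MG.integrable_const_bound[where B = 1])
        show "AE z in M \<Otimes>\<^sub>M std_normal_distribution.
            norm (case z of (\<omega>, g) \<Rightarrow> iexp (nsum p n \<omega> + c * g * nsum (r a) n \<omega>) * of_real (W n \<omega>)) \<le> 1"
          by (intro AE_I2) (simp only: split_beta bd)
      qed measurable
    qed
    finally show ?thesis .
  qed
  define P where "P = (\<Prod>j\<in>J. 1 / sqrt (1 + 2 * \<beta> j))"
  have pr_int: "integrable N (\<lambda>x. p x * r j x)" "integrable N (\<lambda>x. r i x * r j x)" "integrable N (\<lambda>x. p x ^ 2)"
     "integrable N p" "integrable N (r j)" for i j
  proof -
    have "B \<ge> 0" "C \<ge> 0" using insert.prems(2) r_le by (meson abs_ge_zero order_trans)+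
    note le = mult_mono[OF insert.prems(2) r_le] mult_mono[OF r_le r_le] mult_mono[OF insert.prems(2) insert.prems(2)]
    show "integrable N (\<lambda>x. p x * r j x)"
      by (rule integrable_N_bounded[where B = "B * C"]) (use le \<open>B \<ge> 0\<close> \<open>C \<ge> 0\<close> in \<open>auto simp: abs_mult\<close>)
    show "integrable N (\<lambda>x. r i x * r j x)"
      by (rule integrable_N_bounded[where B = "C * C"]) (use le \<open>B \<ge> 0\<close> \<open>C \<ge> 0\<close> in \<open>auto simp: abs_mult\<close>)
    show "integrable N (\<lambda>x. p x ^ 2)"
      by (rule integrable_N_bounded[where B = "B ^ 2"])
         (use power_mono[OF insert.prems(2) abs_ge_zero, of _ 2] in auto)
    show "integrable N p" "integrable N (r j)"
      by (rule integrable_N_bounded; use insert.prems(2) r_le in auto)+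
  qed
  have FQ: "(\<lambda>n. F n g) \<longlonglongrightarrow> of_real (exp (- (\<integral>x. Q g x ^ 2 \<partial>N) / 2) * P)" for g
    unfolding F_def W_def P_def
  proof (rule insert.IH[of "Q g" "B + \<bar>c * g\<bar> * C"])
    show "Q g \<in> borel_measurable N" unfolding Q_def by measurable
    show "\<bar>Q g x\<bar> \<le> B + \<bar>c * g\<bar> * C" for x
      unfolding Q_def using insert.prems(2)[of x] mult_left_mono[OF r_le[of a x], of "\<bar>c * g\<bar>"]
        abs_triangle_ineq[of "p x" "c * g * r a x"] abs_mult[of "c * g" "r a x"] by linarith
    show "(\<integral>x. Q g x \<partial>N) = 0"
      unfolding Q_def using pr_int insert.prems(3,6) by simp
    \<comment> \<open>Orthogonality of the \<open>r j\<close> among themselves and to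
      \<open>p\<close> passes to the new phase.\<close>
    show "(\<integral>x. Q g x * r j x \<partial>N) = 0" if "j \<in> J" for j
    proof -
      have "(\<integral>x. Q g x * r j x \<partial>N) = (\<integral>x. p x * r j x + (c * g) * (r a x * r j x) \<partial>N)"
        by (intro Bochner_Integration.integral_cong) (simp_all add: Q_def algebra_simps)
      then show ?thesis
        using that insert.prems(7)[of a j] insert.prems(8)[of j] insert.hyps pr_int by auto
    qed
  qed (use insert.prems in auto)
  \<comment> \<open>Pythagoras: the cross term vanishes, so \<open>g\<close> enters the limit only
    through \<open>exp (- \<beta> a * g ^ 2)\<close>.\<close>
  have Q2: "(\<integral>x. Q g x ^ 2 \<partial>N) = (\<integral>x. p x ^ 2 \<partial>N) + 2 * \<beta> a * g ^ 2" for g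
  proof -
    have "(\<integral>x. Q g x ^ 2 \<partial>N) = (\<integral>x. p x ^ 2 + ((2 * c * g) * (p x * r a x) + (c * g) ^ 2 * (r a x * r a x)) \<partial>N)"
      by (intro Bochner_Integration.integral_cong) (simp_all add: Q_def algebra_simps power2_eq_square)
    then show ?thesis
      using insert.prems(7)[of a a] insert.prems(8)[of a] pr_int by (simp add: power_mult_distrib c2)
  qed
  have expA: "exp (- (A + 2 * \<beta> a * g ^ 2) / 2) * P = exp (- A / 2) * P * exp (- \<beta> a * g ^ 2)" for A g :: real
  proof -
    have "- (A + 2 * \<beta> a * g ^ 2) / 2 = - A / 2 + - \<beta> a * g ^ 2" by (simp add: field_simps)
    then show ?thesis by (simp only: exp_add mult_ac)
  qed
  have lim: "(\<lambda>n. F n g) \<longlonglongrightarrow>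
      of_real ((exp (- (\<integral>x. p x ^ 2 \<partial>N) / 2) * P) * exp (- \<beta> a * g ^ 2))" for g
    using FQ[of g] unfolding Q2 expA .
  \<comment> \<open>The limit in n is taken for each fixed \<open>g\<close> and then integrated; all
    the integrands are bounded by 1.\<close>
  have "(\<lambda>n. \<integral>g. F n g \<partial>std_normal_distribution) \<longlonglongrightarrow>
     (\<integral>g. of_real ((exp (- (\<integral>x. p x ^ 2 \<partial>N) / 2) * P) * exp (- \<beta> a * g ^ 2)) \<partial>std_normal_distribution)"
  proof (rule integral_dominated_convergence[where w = "\<lambda>_. 1"])
    show "AE g in std_normal_distribution. (\<lambda>n. F n g) \<longlonglongrightarrow>
        of_real ((exp (- (\<integral>x. p x ^ 2 \<partial>N) / 2) * P) * exp (- \<beta> a * g ^ 2))"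
      by (rule AE_I2) (rule lim)
  qed (auto intro!: F_le)
  also have "(\<integral>g. complex_of_real ((exp (- (\<integral>x. p x ^ 2 \<partial>N) / 2) * P) * exp (- \<beta> a * g ^ 2)) \<partial>std_normal_distribution)
    = of_real ((exp (- (\<integral>x. p x ^ 2 \<partial>N) / 2) * P) * (1 / sqrt (1 + 2 * \<beta> a)))"
    unfolding integral_complex_of_real integral_mult_right_zero integral_std_normal_exp_square[OF \<beta>a] ..
  finally show ?case
    unfolding step using insert.hyps by (simp add: P_def mult_ac)
qed

text \<open>Phase 0 in the preceding statement. The limit is the Laplace transform of the sum of the
  \<open>\<beta> j\<close> g_j^2 with independent standard Gaussians g_j.\<close>

lemma laplace_nsum_tendsto:
  fixes r :: "'j \<Rightarrow> 'b \<Rightarrow> real"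
  assumes "finite J"
    and [measurable]: "\<And>j. r j \<in> borel_measurable N" and r_le: "\<And>j x. \<bar>r j x\<bar> \<le> C"
    and r_mean: "\<And>j. j \<in> J \<Longrightarrow> (\<integral>x. r j x \<partial>N) = 0"
    and r_orth: "\<And>i j. i \<in> J \<Longrightarrow> j \<in> J \<Longrightarrow> (\<integral>x. r i x * r j x \<partial>N) = of_bool (i = j)"
    and \<beta>: "\<And>j. j \<in> J \<Longrightarrow> \<beta> j \<ge> 0"
  shows "(\<lambda>n. expectation (\<lambda>\<omega>. exp (- (\<Sum>j\<in>J. \<beta> j * nsum (r j) n \<omega> ^ 2))))
     \<longlonglongrightarrow> (\<Prod>j\<in>J. 1 / sqrt (1 + 2 * \<beta> j))"
proof -
  have "(\<lambda>n. complex_of_real (expectation (\<lambda>\<omega>. exp (- (\<Sum>j\<in>J. \<beta> j * nsum (r j) n \<omega> ^ 2)))))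
     \<longlonglongrightarrow> of_real (\<Prod>j\<in>J. 1 / sqrt (1 + 2 * \<beta> j))"
    using laplace_nsum_tendsto_aux[of J "\<lambda>_. 0" 0 r C \<beta>] assms
    by (simp add: nsum_def[of "\<lambda>_. 0"] sum_negf[symmetric] exp_sum flip: integral_complex_of_real)
  then show ?thesis by (simp only: tendsto_of_real_iff)
qed

end

section \<open>Weak convergence\<close>

lemma norm_iexp_diff_le: "norm (iexp x - iexp y) \<le> \<bar>x - y\<bar>"
proof -
  have "iexp x - iexp y = iexp y * (iexp (x - y) - 1)"
    by (simp add: exp_diff right_diff_distrib)
  then show ?thesis using iexp_approx1[of "x - y" 0] by (simp add: norm_mult)
qed

section \<open>Convergence of moments, Slutsky's theorem, Laplace transforms\<close>

text \<open>Uniform integrability: bounded fourth moments make the region |x| > R contribute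
  O(1/R^2) uniformly in n. This is what lets means and variances pass to the weak limit.\<close>

lemma weak_conv_m_integral_growth2:
  fixes \<mu> :: "nat \<Rightarrow> real measure" and \<mu>' :: "real measure" and f :: "real \<Rightarrow> real"
  assumes rd: "\<And>n. real_distribution (\<mu> n)" "real_distribution \<mu>'" and conv: "weak_conv_m \<mu> \<mu>'"
    and int4: "\<And>n. integrable (\<mu> n) (\<lambda>x. x ^ 4)" and C: "\<And>n. (\<integral>x. x ^ 4 \<partial>\<mu> n) \<le> C"
    and int2: "integrable \<mu>' (\<lambda>x. x ^ 2)"
    and f: "\<And>x. isCont f x" "\<And>x. \<bar>f x\<bar> \<le> 1 + x ^ 2"
  shows "(\<lambda>n. \<integral>x. f x \<partial>\<mu> n) \<longlonglongrightarrow> (\<integral>x. f x \<partial>\<mu>')"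
proof -
  interpret \<mu>: real_distribution "\<mu> n" for n by (rule rd)
  interpret \<mu>': real_distribution \<mu>' by (rule rd)
  \<comment> \<open>Clipping the argument to [-R, R] gives a bounded continuous function and leaves
    the growth bound intact.\<close>
  define h where "h R x = f (max (- R) (min R x))" for R x :: real
  have [measurable]: "f \<in> borel_measurable borel"
    using f(1) by (intro borel_measurable_continuous_onI continuous_at_imp_continuous_on) auto
  have h_meas [measurable]: "h R \<in> borel_measurable borel" for R unfolding h_def by measurable
  have clip: "max (- R) (min R x) ^ 2 \<le> x ^ 2" if "R \<ge> 1" for R x :: real
    using that by (intro abs_le_square_iff[THEN iffD1]) auto
  have clip': "max (- R) (min R x) ^ 2 \<le> R ^ 2" if "R \<ge> 1" for R x :: real
    using that by (intro abs_le_square_iff[THEN iffD1]) auto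
  have h_le: "\<bar>h R x\<bar> \<le> 1 + x ^ 2" "\<bar>h R x\<bar> \<le> 1 + R ^ 2" if "R \<ge> 1" for R x
    using f(2)[of "max (- R) (min R x)"] clip[OF that, of x] clip'[OF that, of x]
    unfolding h_def by linarith+
  have h_conv: "(\<lambda>n. \<integral>x. h R x \<partial>\<mu> n) \<longlonglongrightarrow> (\<integral>x. h R x \<partial>\<mu>')" if "R \<ge> 1" for R
  proof (rule weak_conv_imp_integral_bdd_continuous_conv[OF rd conv])
    show "isCont (h R) x" for x
      unfolding h_def by (rule isCont_o2[OF _ f(1)]) (auto intro!: continuous_intros)
    show "norm (h R x) \<le> 1 + R ^ 2" for x using h_le(2)[OF that] by simp
  qed
  have lim': "(\<lambda>k. \<integral>x. h (real (Suc k)) x \<partial>\<mu>') \<longlonglongrightarrow> (\<integral>x. f x \<partial>\<mu>')"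
  proof (rule integral_dominated_convergence[where w = "\<lambda>x. 1 + x ^ 2"])
    show "AE x in \<mu>'. (\<lambda>k. h (real (Suc k)) x) \<longlonglongrightarrow> f x"
    proof (rule AE_I2)
      fix x :: real
      obtain k0 :: nat where k0: "\<bar>x\<bar> \<le> real k0" using real_arch_simple by blast
      have "\<forall>\<^sub>F k in sequentially. h (real (Suc k)) x = f x"
      proof (rule eventually_sequentiallyI[of k0])
        fix k assume "k0 \<le> k"
        then have "max (- real (Suc k)) (min (real (Suc k)) x) = x" using k0 by linarith
        then show "h (real (Suc k)) x = f x" by (simp add: h_def)
      qed
      then show "(\<lambda>k. h (real (Suc k)) x) \<longlonglongrightarrow> f x" by (rule tendsto_eventually)
    qed
    show "AE x in \<mu>'. norm (h (real (Suc k)) x) \<le> 1 + x ^ 2" for k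
      using h_le(1)[of "real (Suc k)"] by simp
  qed (use int2 in auto)
  have diff: "\<bar>(\<integral>x. f x \<partial>\<mu> n) - (\<integral>x. h R x \<partial>\<mu> n)\<bar> \<le> 4 * C / R ^ 2" if "R \<ge> 1" for n R
  proof -
    have int_sq: "integrable (\<mu> n) (\<lambda>x. x ^ 2)"
    proof (rule Bochner_Integration.integrable_bound[where f = "\<lambda>x. 1 + x ^ 4"])
      have "x ^ 2 \<le> 1 + x ^ 4" for x :: real
      proof -
        have "2 * x ^ 2 \<le> x ^ 4 + 1"
          using zero_le_power2[of "x ^ 2 - 1"] by (simp add: power2_diff power_mult[symmetric])
        then show ?thesis using zero_le_power2[of x] by linarith
      qed
      then show "AE x in \<mu> n. norm (x ^ 2) \<le> norm (1 + x ^ 4)" by simp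
    qed (use int4 in auto)
    \<comment> \<open>Beyond R >= 1 the difference is at most 2 (1 + x^2) <= 4 x^2, and x^2 <= x^4 /
      R^2 there.\<close>
    have le: "\<bar>f x - h R x\<bar> \<le> 4 / R ^ 2 * x ^ 4" for x
    proof (cases "\<bar>x\<bar> \<le> R")
      case True
      then have "max (- R) (min R x) = x" by linarith
      then have "h R x = f x" by (simp add: h_def)
      then show ?thesis by simp
    next
      case False
      then have x: "x ^ 2 \<ge> R ^ 2" using that by (intro abs_le_square_iff[THEN iffD1]) auto
      have "R ^ 2 \<ge> 1" using that by simp
      have "\<bar>f x - h R x\<bar> \<le> 2 * (1 + x ^ 2)" 
        using f(2)[of x] h_le(1)[OF that, of x] abs_triangle_ineq4[of "f x" "h R x"] by (simp add: distrib_left)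
      also have "\<dots> \<le> 4 * x ^ 2" using order_trans[OF \<open>R ^ 2 \<ge> 1\<close> x] by simp
      also have "\<dots> \<le> 4 / R ^ 2 * x ^ 4"
      proof -
        have "x ^ 2 * R ^ 2 \<le> x ^ 2 * x ^ 2" using x by (intro mult_left_mono) auto
        then show ?thesis using that by (simp add: field_simps power2_eq_square power4_eq_xxxx)
      qed
      finally show ?thesis .
    qed
    have if': "integrable (\<mu> n) f" "integrable (\<mu> n) (h R)"
      by (rule Bochner_Integration.integrable_bound[where f = "\<lambda>x. 1 + x ^ 2"];
          use int_sq f(2) h_le(1)[OF that] in auto)+
    have "\<bar>(\<integral>x. f x \<partial>\<mu> n) - (\<integral>x. h R x \<partial>\<mu> n)\<bar> = norm (\<integral>x. f x - h R x \<partial>\<mu> n)"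
      using if' by simp
    also have "\<dots> \<le> (\<integral>x. 4 / R ^ 2 * x ^ 4 \<partial>\<mu> n)"
      by (rule integral_norm_bound_integral') (use le int4 in auto)
    also have "\<dots> \<le> 4 / R ^ 2 * C" using C[of n] int4 by (simp add: divide_right_mono mult_left_mono)
    finally show ?thesis by simp
  qed
  have lim0: "(\<lambda>k. 4 * C / real (Suc k) ^ 2) \<longlonglongrightarrow> 0" by real_asymp
  show ?thesis
  proof (rule LIMSEQ_I)
    fix e :: real assume "e > 0"
    then have e3: "e / 3 > 0" by simp
    have "\<forall>\<^sub>F k in sequentially. 4 * C / real (Suc k) ^ 2 < e / 3"
      using lim0 e3 by (rule order_tendstoD)
    moreover have "\<forall>\<^sub>F k in sequentially. dist (\<integral>x. h (real (Suc k)) x \<partial>\<mu>') (\<integral>x. f x \<partial>\<mu>') < e / 3"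
      using lim' e3 by (rule tendstoD)
    ultimately have "\<forall>\<^sub>F k in sequentially. 4 * C / real (Suc k) ^ 2 < e / 3 \<and>
        dist (\<integral>x. h (real (Suc k)) x \<partial>\<mu>') (\<integral>x. f x \<partial>\<mu>') < e / 3" by (rule eventually_conj)
    then obtain k where k: "4 * C / real (Suc k) ^ 2 < e / 3"
      "dist (\<integral>x. h (real (Suc k)) x \<partial>\<mu>') (\<integral>x. f x \<partial>\<mu>') < e / 3"
      by (auto dest: eventually_happens)
    have "\<forall>\<^sub>F n in sequentially. dist (\<integral>x. h (real (Suc k)) x \<partial>\<mu> n) (\<integral>x. h (real (Suc k)) x \<partial>\<mu>') < e / 3"
      by (rule tendstoD[OF h_conv e3]) simp
    then obtain n0 where n0: "\<And>n. n \<ge> n0 \<Longrightarrow>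
        dist (\<integral>x. h (real (Suc k)) x \<partial>\<mu> n) (\<integral>x. h (real (Suc k)) x \<partial>\<mu>') < e / 3"
      unfolding eventually_sequentially by blast
    show "\<exists>n0. \<forall>n\<ge>n0. norm ((\<integral>x. f x \<partial>\<mu> n) - (\<integral>x. f x \<partial>\<mu>')) < e"
    proof (intro exI allI impI)
      fix n assume "n \<ge> n0"
      then show "norm ((\<integral>x. f x \<partial>\<mu> n) - (\<integral>x. f x \<partial>\<mu>')) < e"
        using n0[of n] k diff[of "real (Suc k)" n] unfolding dist_real_def real_norm_def by linarith
    qed
  qed
qed

text \<open>Since x -> exp(ix) is 1-Lipschitz, an error that is small in L^1 is invisible to
  characteristic functions in the limit.\<close>

lemma norm_expectation_iexp_diff_le:
  assumes "prob_space M" and [measurable]: "f \<in> borel_measurable M" "g \<in> borel_measurable M"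
    and "integrable M (\<lambda>\<omega>. \<bar>f \<omega> - g \<omega>\<bar>)"
  shows "norm ((\<integral>\<omega>. iexp (t * f \<omega>) \<partial>M) - (\<integral>\<omega>. iexp (t * g \<omega>) \<partial>M)) \<le> \<bar>t\<bar> * (\<integral>\<omega>. \<bar>f \<omega> - g \<omega>\<bar> \<partial>M)"
proof -
  interpret prob_space M by fact
  have i: "integrable M (\<lambda>\<omega>. iexp (t * f \<omega>))" "integrable M (\<lambda>\<omega>. iexp (t * g \<omega>))"
    by (rule integrable_const_bound[where B = 1]; simp)+
  have "norm ((\<integral>\<omega>. iexp (t * f \<omega>) \<partial>M) - (\<integral>\<omega>. iexp (t * g \<omega>) \<partial>M)) =
      norm (\<integral>\<omega>. iexp (t * f \<omega>) - iexp (t * g \<omega>) \<partial>M)"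
    using i by simp
  also have "\<dots> \<le> (\<integral>\<omega>. \<bar>t\<bar> * \<bar>f \<omega> - g \<omega>\<bar> \<partial>M)"
  proof (rule integral_norm_bound_integral')
    fix \<omega>
    show "norm (iexp (t * f \<omega>) - iexp (t * g \<omega>)) \<le> \<bar>t\<bar> * \<bar>f \<omega> - g \<omega>\<bar>"
      using norm_iexp_diff_le[of "t * f \<omega>" "t * g \<omega>"]
      by (simp only: right_diff_distrib[symmetric] abs_mult)
  qed (use assms(4) in simp)
  finally show ?thesis by simp
qed

text \<open>Slutsky's theorem for deterministic coefficients: the uniform L^1 bound turns
  convergence of the factors \<open>\<alpha> n\<close> into a vanishing difference of characteristic
  functions.\<close>

lemma weak_conv_m_affine:
  fixes V :: "nat \<Rightarrow> 'a \<Rightarrow> real" and U :: "'b \<Rightarrow> real"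
  assumes "prob_space M" "prob_space N"
    and int: "\<And>n. integrable M (V n)" and C: "\<And>n. (\<integral>\<omega>. \<bar>V n \<omega>\<bar> \<partial>M) \<le> C"
    and [measurable]: "U \<in> borel_measurable N"
    and conv: "weak_conv_m (\<lambda>n. distr M borel (V n)) (distr N borel U)"
    and \<alpha>: "\<alpha> \<longlonglongrightarrow> a" and \<beta>: "\<beta> \<longlonglongrightarrow> b"
  shows "weak_conv_m (\<lambda>n. distr M borel (\<lambda>\<omega>. \<alpha> n * V n \<omega> + \<beta> n)) (distr N borel (\<lambda>x. a * U x + b))"
proof -
  interpret M: prob_space M by fact
  interpret N: prob_space N by fact
  have [measurable]: "V n \<in> borel_measurable M" for n using int by auto
  show ?thesis
  proof (rule levy_continuity)
    fix t :: real
    have "(\<lambda>n. char (distr M borel (V n)) (t * a)) \<longlonglongrightarrow> char (distr N borel U) (t * a)"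
      using conv by (intro levy_continuity1 M.real_distribution_distr N.real_distribution_distr) auto
    then have 1: "(\<lambda>n. M.expectation (\<lambda>\<omega>. iexp (t * a * V n \<omega>))) \<longlonglongrightarrow> N.expectation (\<lambda>x. iexp (t * a * U x))"
      by (simp add: char_def integral_distr)
    have 2: "(\<lambda>n. M.expectation (\<lambda>\<omega>. iexp (t * \<alpha> n * V n \<omega>)) - M.expectation (\<lambda>\<omega>. iexp (t * a * V n \<omega>))) \<longlonglongrightarrow> 0"
    proof (rule Lim_null_comparison)
      show "\<forall>\<^sub>F n in sequentially. norm (M.expectation (\<lambda>\<omega>. iexp (t * \<alpha> n * V n \<omega>)) - M.expectation (\<lambda>\<omega>. iexp (t * a * V n \<omega>)))
           \<le> \<bar>t\<bar> * \<bar>\<alpha> n - a\<bar> * C"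
      proof (rule always_eventually, rule allI)
        fix n
        have eq: "\<bar>\<alpha> n * V n \<omega> - a * V n \<omega>\<bar> = \<bar>\<alpha> n - a\<bar> * \<bar>V n \<omega>\<bar>" for \<omega>
          by (simp only: left_diff_distrib[symmetric] abs_mult)
        have "norm (M.expectation (\<lambda>\<omega>. iexp (t * \<alpha> n * V n \<omega>)) - M.expectation (\<lambda>\<omega>. iexp (t * a * V n \<omega>))) \<le>
            \<bar>t\<bar> * \<bar>\<alpha> n - a\<bar> * M.expectation (\<lambda>\<omega>. \<bar>V n \<omega>\<bar>)"
          using norm_expectation_iexp_diff_le[OF M.prob_space_axioms, of "\<lambda>\<omega>. \<alpha> n * V n \<omega>" "\<lambda>\<omega>. a * V n \<omega>" t] int[of n]
          unfolding eq by (simp add: mult.assoc)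
        also have "\<dots> \<le> \<bar>t\<bar> * \<bar>\<alpha> n - a\<bar> * C" using C[of n] by (simp add: mult_left_mono)
        finally show "norm (M.expectation (\<lambda>\<omega>. iexp (t * \<alpha> n * V n \<omega>)) - M.expectation (\<lambda>\<omega>. iexp (t * a * V n \<omega>)))
           \<le> \<bar>t\<bar> * \<bar>\<alpha> n - a\<bar> * C" .
      qed
      have "(\<lambda>n. \<bar>t\<bar> * \<bar>\<alpha> n - a\<bar> * C) \<longlonglongrightarrow> \<bar>t\<bar> * \<bar>a - a\<bar> * C"
        by (intro tendsto_intros \<alpha>)
      then show "(\<lambda>n. \<bar>t\<bar> * \<bar>\<alpha> n - a\<bar> * C) \<longlonglongrightarrow> 0" by simp
    qed
    from tendsto_add[OF 2 1]
    have "(\<lambda>n. iexp (t * \<beta> n) * M.expectation (\<lambda>\<omega>. iexp (t * \<alpha> n * V n \<omega>))) \<longlonglongrightarrow>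
        iexp (t * b) * N.expectation (\<lambda>x. iexp (t * a * U x))"
      by (intro tendsto_intros \<beta>) simp
    also have "(\<lambda>n. iexp (t * \<beta> n) * M.expectation (\<lambda>\<omega>. iexp (t * \<alpha> n * V n \<omega>))) =
       (\<lambda>n. char (distr M borel (\<lambda>\<omega>. \<alpha> n * V n \<omega> + \<beta> n)) t)"
      by (simp add: char_def integral_distr exp_add[symmetric] distrib_left mult_ac add_ac
          flip: integral_mult_right_zero)
    also have "iexp (t * b) * N.expectation (\<lambda>x. iexp (t * a * U x)) = char (distr N borel (\<lambda>x. a * U x + b)) t"
      by (simp add: char_def integral_distr exp_add[symmetric] distrib_left mult_ac add_ac
          flip: integral_mult_right_zero)
    finally show "(\<lambda>n. char (distr M borel (\<lambda>\<omega>. \<alpha> n * V n \<omega> + \<beta> n)) t) \<longlonglongrightarrow> char (distr N borel (\<lambda>x. a * U x + b)) t" .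
  qed (auto intro!: M.real_distribution_distr N.real_distribution_distr)
qed

text \<open>In the variable \<open>y = exp (- \<epsilon> x)\<close> the Laplace transforms become moments on \<open>[0, 1]\<close>, so they
  determine the integrals of \<open>f x * exp (- \<epsilon> x)\<close> by Weierstrass approximation.\<close>

lemma laplace_imp_integral_tendsto:
  fixes Y :: "nat \<Rightarrow> 'a \<Rightarrow> real" and Z :: "'b \<Rightarrow> real" and f :: "real \<Rightarrow> real"
  assumes "prob_space M" "prob_space N"
    and Y: "\<And>n. integrable M (Y n)" "\<And>n \<omega>. 0 \<le> Y n \<omega>" "\<And>n. (\<integral>\<omega>. Y n \<omega> \<partial>M) \<le> C"
    and Z: "integrable N Z" "\<And>x. 0 \<le> Z x" "(\<integral>x. Z x \<partial>N) \<le> C"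
    and lap: "\<And>s. 0 \<le> s \<Longrightarrow> (\<lambda>n. \<integral>\<omega>. exp (- s * Y n \<omega>) \<partial>M) \<longlonglongrightarrow> (\<integral>x. exp (- s * Z x) \<partial>N)"
    and f: "continuous_on UNIV f" "\<And>x. \<bar>f x\<bar> \<le> 1"
  shows "(\<lambda>n. \<integral>\<omega>. f (Y n \<omega>) \<partial>M) \<longlonglongrightarrow> (\<integral>x. f (Z x) \<partial>N)"
proof -
  interpret M: prob_space M by fact
  interpret N: prob_space N by fact
  have [measurable]: "Y n \<in> borel_measurable M" for n using Y(1) by auto
  have [measurable]: "Z \<in> borel_measurable N" using Z(1) by auto
  have [measurable]: "f \<in> borel_measurable borel" using f(1) by (rule borel_measurable_continuous_onI)
  have "(\<integral>x. Z x \<partial>N) \<ge> 0" using Z(2) by (rule Bochner_Integration.integral_nonneg)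
  then have C: "C \<ge> 0" using Z(3) by linarith
  show ?thesis
  proof (rule LIMSEQ_I)
    fix e :: real assume e: "e > 0"
    \<comment> \<open>Damping \<open>f\<close> by \<open>exp (- \<epsilon> * x)\<close> changes its
      mean by at most \<open>\<epsilon> * C\<close>; the summand 1 keeps the quotient defined when
      \<open>C = 0\<close>.\<close>
    define \<epsilon> where "\<epsilon> = e / (8 * (C + 1))"
    have \<epsilon>: "\<epsilon> > 0" "\<epsilon> * C \<le> e / 8"
      using e C by (auto simp: \<epsilon>_def field_simps)
    \<comment> \<open>The damped function in the variable y = exp(-\<open>\<epsilon>\<close> x). The
      value 0 at y = 0, that is at x = infinity, extends it continuously because \<open>f\<close> is
      bounded and the damping is the factor y.\<close>
    define g where "g y = (if y \<le> 0 then 0 else f (- ln y / \<epsilon>) * y)" for y :: real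
    have g_cont: "continuous_on {0..1} g"
      unfolding continuous_on_eq_continuous_within
    proof
      fix y :: real assume y: "y \<in> {0..1}"
      have "isCont g y"
      proof (cases "y = 0")
        case True
        have "(g \<longlongrightarrow> 0) (at 0)"
        proof (rule Lim_null_comparison)
          show "\<forall>\<^sub>F x in at 0. norm (g x) \<le> \<bar>x\<bar>"
          proof (rule always_eventually, rule allI)
            fix x
            show "norm (g x) \<le> \<bar>x\<bar>"
              using mult_right_mono[OF f(2)[of "- ln x / \<epsilon>"], of "\<bar>x\<bar>"]
              by (auto simp: g_def abs_mult)
          qed
        qed (auto intro!: tendsto_eq_intros)
        then show ?thesis using True by (simp add: isCont_def g_def)
      next
        case False
        with y have "y > 0" by simp
        have fc: "isCont f z" for z using f(1) by (simp add: continuous_on_eq_continuous_at)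
        have "isCont (\<lambda>y. f (- ln y / \<epsilon>) * y) y"
          using \<open>y > 0\<close> \<epsilon> by (intro continuous_intros isCont_o2[OF _ fc]) auto
        moreover have "\<forall>\<^sub>F x in nhds y. g x = f (- ln x / \<epsilon>) * x"
          using eventually_nhds_in_open[of "{0<..}" y] \<open>y > 0\<close>
          by (auto elim!: eventually_mono simp: g_def)
        ultimately show ?thesis using isCont_cong by metis
      qed
      then show "continuous (at y within {0..1}) g" by (rule continuous_at_imp_continuous_at_within)
    qed
    from Stone_Weierstrass_real_polynomial_function[OF _ g_cont, of "e / 8"] e
    obtain q where q: "real_polynomial_function q" "\<And>x. x \<in> {0..1} \<Longrightarrow> \<bar>g x - q x\<bar> < e / 8"
      by (metis compact_Icc zero_less_divide_iff zero_less_numeral)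
    then obtain a k where a: "q = (\<lambda>x. \<Sum>i\<le>k. a i * x ^ i)"
      unfolding real_polynomial_function_iff_sum by blast
    have gexp: "g (exp (- \<epsilon> * x)) = f x * exp (- \<epsilon> * x)" for x
      using \<epsilon> by (simp add: g_def)
    \<comment> \<open>The mean of the approximating polynomial in y is a linear combination of
      Laplace transforms at the multiples of \<open>\<epsilon>\<close>.\<close>
    define T where "T n = (\<Sum>i\<le>k. a i * (\<integral>\<omega>. exp (- (real i * \<epsilon>) * Y n \<omega>) \<partial>M))" for n
    define T' where "T' = (\<Sum>i\<le>k. a i * (\<integral>x. exp (- (real i * \<epsilon>) * Z x) \<partial>N))"
    have "T \<longlonglongrightarrow> T'" unfolding T_def T'_def
      using \<epsilon> by (intro tendsto_intros lap) auto
    then obtain n0 where n0: "\<And>n. n \<ge> n0 \<Longrightarrow> norm (T n - T') < e / 8"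
      using LIMSEQ_D[of T T' "e / 8"] e by auto
    \<comment> \<open>One estimate for both sides: e/8 from the damping and e/8 from the polynomial.
      Applied to \<open>Y n\<close> and to \<open>Z\<close> it costs e/2, and the Laplace transforms
      themselves cost another e/8.\<close>
    have key: "\<bar>(\<integral>\<omega>. f (W \<omega>) \<partial>P) - (\<Sum>i\<le>k. a i * (\<integral>\<omega>. exp (- (real i * \<epsilon>) * W \<omega>) \<partial>P))\<bar> \<le> e / 4"
      if P: "prob_space P" and W: "integrable P W" "\<And>\<omega>. 0 \<le> W \<omega>" "(\<integral>\<omega>. W \<omega> \<partial>P) \<le> C"
      for P :: "'c measure" and W :: "'c \<Rightarrow> real"
    proof -
      interpret P: prob_space P by fact
      have [measurable]: "W \<in> borel_measurable P" using W(1) by auto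
      have ie: "integrable P (\<lambda>\<omega>. exp (- (real i * \<epsilon>) * W \<omega>))" for i
        by (rule P.integrable_const_bound[where B = 1]) (use W(2) \<epsilon> in auto)
      have "(\<Sum>i\<le>k. a i * (\<integral>\<omega>. exp (- (real i * \<epsilon>) * W \<omega>) \<partial>P)) =
          (\<integral>\<omega>. (\<Sum>i\<le>k. a i * exp (- (real i * \<epsilon>) * W \<omega>)) \<partial>P)"
        using ie by (subst Bochner_Integration.integral_sum) auto
      also have "\<dots> = (\<integral>\<omega>. q (exp (- \<epsilon> * W \<omega>)) \<partial>P)"
        by (simp add: a exp_of_nat_mult[symmetric] mult_ac)
      finally have eq: "(\<Sum>i\<le>k. a i * (\<integral>\<omega>. exp (- (real i * \<epsilon>) * W \<omega>) \<partial>P)) = (\<integral>\<omega>. q (exp (- \<epsilon> * W \<omega>)) \<partial>P)" .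
      have iq: "integrable P (\<lambda>\<omega>. q (exp (- \<epsilon> * W \<omega>)))"
      proof -
        have "integrable P (\<lambda>\<omega>. \<Sum>i\<le>k. a i * exp (- (real i * \<epsilon>) * W \<omega>))" using ie by auto
        then show ?thesis by (simp add: a exp_of_nat_mult[symmetric] mult_ac)
      qed
      have if': "integrable P (\<lambda>\<omega>. f (W \<omega>))"
        by (rule P.integrable_const_bound[where B = 1]) (use f(2) in auto)
      have "norm (\<integral>\<omega>. f (W \<omega>) - q (exp (- \<epsilon> * W \<omega>)) \<partial>P) \<le> (\<integral>\<omega>. \<epsilon> * W \<omega> + e / 8 \<partial>P)"
      proof (rule integral_norm_bound_integral')
        fix \<omega>
        have y: "exp (- \<epsilon> * W \<omega>) \<in> {0..1}" using W(2)[of \<omega>] \<epsilon> by simp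
        have "\<bar>f (W \<omega>) - f (W \<omega>) * exp (- \<epsilon> * W \<omega>)\<bar> = \<bar>f (W \<omega>)\<bar> * (1 - exp (- \<epsilon> * W \<omega>))"
        proof -
          have "f (W \<omega>) - f (W \<omega>) * exp (- \<epsilon> * W \<omega>) = f (W \<omega>) * (1 - exp (- \<epsilon> * W \<omega>))"
            by (simp add: algebra_simps)
          then show ?thesis using y by (simp add: abs_mult)
        qed
        also have "\<dots> \<le> 1 * (\<epsilon> * W \<omega>)"
          using f(2)[of "W \<omega>"] y exp_ge_add_one_self[of "- \<epsilon> * W \<omega>"] by (intro mult_mono) auto
        finally have "\<bar>f (W \<omega>) - f (W \<omega>) * exp (- \<epsilon> * W \<omega>)\<bar> \<le> \<epsilon> * W \<omega>" by simp
        then show "norm (f (W \<omega>) - q (exp (- \<epsilon> * W \<omega>))) \<le> \<epsilon> * W \<omega> + e / 8"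
          using q(2)[OF y] unfolding gexp real_norm_def by linarith
      qed (use W(1) in auto)
      also have "\<dots> \<le> e / 4"
      proof -
        have "\<epsilon> * (\<integral>\<omega>. W \<omega> \<partial>P) \<le> \<epsilon> * C" using W(3) \<epsilon>(1) by simp
        moreover have "(\<integral>\<omega>. \<epsilon> * W \<omega> + e / 8 \<partial>P) = \<epsilon> * (\<integral>\<omega>. W \<omega> \<partial>P) + e / 8"
          using W(1) by (simp add: P.prob_space)
        ultimately show ?thesis using \<epsilon>(2) by linarith
      qed
      finally show ?thesis unfolding eq using if' iq by simp
    qed
    show "\<exists>n0. \<forall>n\<ge>n0. norm ((\<integral>\<omega>. f (Y n \<omega>) \<partial>M) - (\<integral>x. f (Z x) \<partial>N)) < e"
    proof (intro exI allI impI)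
      fix n assume "n \<ge> n0"
      then show "norm ((\<integral>\<omega>. f (Y n \<omega>) \<partial>M) - (\<integral>x. f (Z x) \<partial>N)) < e"
        using n0[of n] key[OF \<open>prob_space M\<close> Y, of n] key[OF \<open>prob_space N\<close> Z] e
        unfolding T_def T'_def real_norm_def by linarith
    qed
  qed
qed

lemma laplace_imp_char_tendsto:
  fixes Y :: "nat \<Rightarrow> 'a \<Rightarrow> real" and Z :: "'b \<Rightarrow> real"
  assumes "prob_space M" "prob_space N"
    and Y: "\<And>n. integrable M (Y n)" "\<And>n \<omega>. 0 \<le> Y n \<omega>" "\<And>n. (\<integral>\<omega>. Y n \<omega> \<partial>M) \<le> C"
    and Z: "integrable N Z" "\<And>x. 0 \<le> Z x" "(\<integral>x. Z x \<partial>N) \<le> C"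
    and lap: "\<And>s. 0 \<le> s \<Longrightarrow> (\<lambda>n. \<integral>\<omega>. exp (- s * Y n \<omega>) \<partial>M) \<longlonglongrightarrow> (\<integral>x. exp (- s * Z x) \<partial>N)"
  shows "(\<lambda>n. \<integral>\<omega>. iexp (t * Y n \<omega>) \<partial>M) \<longlonglongrightarrow> (\<integral>x. iexp (t * Z x) \<partial>N)"
proof -
  interpret M: prob_space M by fact
  interpret N: prob_space N by fact
  have [measurable]: "Y n \<in> borel_measurable M" for n using Y(1) by auto
  have [measurable]: "Z \<in> borel_measurable N" using Z(1) by auto
  have iM: "integrable M (\<lambda>\<omega>. iexp (t * Y n \<omega>))" for n
    by (rule M.integrable_const_bound[where B = 1]) auto
  have iN: "integrable N (\<lambda>x. iexp (t * Z x))"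
    by (rule N.integrable_const_bound[where B = 1]) auto
  note lim = laplace_imp_integral_tendsto[OF assms]
  have "(\<lambda>n. \<integral>\<omega>. cos (t * Y n \<omega>) \<partial>M) \<longlonglongrightarrow> (\<integral>x. cos (t * Z x) \<partial>N)"
    "(\<lambda>n. \<integral>\<omega>. sin (t * Y n \<omega>) \<partial>M) \<longlonglongrightarrow> (\<integral>x. sin (t * Z x) \<partial>N)"
    by (rule lim[of "\<lambda>x. cos (t * x)"] lim[of "\<lambda>x. sin (t * x)"]; auto intro!: continuous_intros)+
  then show ?thesis
    using integral_Re[OF iM] integral_Im[OF iM] integral_Re[OF iN] integral_Im[OF iN]
    by (simp add: tendsto_complex_iff Re_exp Im_exp)
qed

section \<open>Sub-Gaussian moment bounds\<close>

context iid_sequence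
begin

text \<open>Hoeffding's lemma for a variable in [-1, 1] bounds each factor by exp(l^2 / 2) with l =
  n^(-1/2); the product of n factors is exp(1/2), whatever n is.\<close>

lemma exp_nsum_le:
  assumes [measurable]: "p \<in> borel_measurable N" and le: "\<And>x. \<bar>p x\<bar> \<le> 1" and mean: "(\<integral>x. p x \<partial>N) = 0"
  shows "expectation (\<lambda>\<omega>. exp (nsum p n \<omega>)) \<le> exp (1 / 2)" "integrable M (\<lambda>\<omega>. exp (nsum p n \<omega>))"
proof -
  define l where "l = 1 / sqrt (real n)"
  have i: "integrable M (\<lambda>\<omega>. exp (l * p (X i \<omega>)))" for i
  proof (rule integrable_const_bound[where B = "exp l"])
    have "l * p x \<le> l" for x
      using le[of x] mult_left_mono[of "p x" 1 l] by (auto simp: l_def)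
    then show "AE \<omega> in M. norm (exp (l * p (X i \<omega>))) \<le> exp l" by simp
  qed simp
  have ind: "indep_vars (\<lambda>_. borel) (\<lambda>i \<omega>. exp (l * p (X i \<omega>))) {..<n}"
    by (rule indep_vars_subset[OF indep_vars_compose2[OF indep]]) auto
  have eq: "exp (nsum p n \<omega>) = (\<Prod>i<n. exp (l * p (X i \<omega>)))" for \<omega>
    by (simp add: nsum_def l_def exp_sum sum_divide_distrib)
  show "integrable M (\<lambda>\<omega>. exp (nsum p n \<omega>))"
    unfolding eq by (rule indep_vars_integrable[OF _ ind i]) simp
  show "expectation (\<lambda>\<omega>. exp (nsum p n \<omega>)) \<le> exp (1 / 2)"
  proof (cases "n = 0")
    case False
    have "expectation (\<lambda>\<omega>. exp (l * p (X i \<omega>))) \<le> exp (l ^ 2 / 2)" for i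
    proof -
      interpret H: interval_bounded_random_variable M "\<lambda>\<omega>. p (X i \<omega>)" "-1" 1
      proof
        have "- 1 \<le> p x \<and> p x \<le> 1" for x using le[of x] by linarith
        then show "AE \<omega> in M. p (X i \<omega>) \<in> {- 1..1}" by simp
      qed simp
      have "nn_integral M (\<lambda>\<omega>. exp (l * p (X i \<omega>))) \<le> ennreal (exp (l\<^sup>2 * (1 - - 1)\<^sup>2 / 8))"
        by (rule H.Hoeffdings_lemma_nn_integral_0) (use False mean in \<open>auto simp: l_def expectation_X\<close>)
      then show ?thesis
        using nn_integral_eq_integral[OF i[of i]] by simp
    qed
    then have "(\<Prod>i<n. expectation (\<lambda>\<omega>. exp (l * p (X i \<omega>)))) \<le> (\<Prod>i<n. exp (l ^ 2 / 2))"
      by (intro prod_mono) auto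
    also have "\<dots> = exp (1 / 2)"
      using False by (simp add: exp_of_nat_mult[symmetric] l_def power_divide)
    finally show ?thesis
      unfolding eq by (subst indep_vars_lebesgue_integral[OF _ ind i]) auto
  qed (simp add: nsum_def prob_space)
qed

text \<open>A single term of the exponential series gives x^8 / 8! <= exp |x| <= exp x + exp (-x).
  The eighth power is what the fourth moment of a quadratic form demands.\<close>

lemma nsum_power8:
  assumes [measurable]: "p \<in> borel_measurable N" and le: "\<And>x. \<bar>p x\<bar> \<le> 1" and mean: "(\<integral>x. p x \<partial>N) = 0"
  shows "expectation (\<lambda>\<omega>. nsum p n \<omega> ^ 8) \<le> 2 * fact 8 * exp (1 / 2)" "integrable M (\<lambda>\<omega>. nsum p n \<omega> ^ 8)"
proof -
  have pow: "x ^ 8 \<le> fact 8 * (exp x + exp (- x))" for x :: real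
  proof -
    have "\<bar>x\<bar> ^ 8 /\<^sub>R fact 8 \<le> exp \<bar>x\<bar>"
      unfolding exp_def using sum_le_suminf[OF summable_exp_generic[of "\<bar>x\<bar>"], of "{8}"] by simp
    moreover have "exp \<bar>x\<bar> \<le> exp x + exp (- x)" by (cases "x \<ge> 0") auto
    ultimately have "\<bar>x\<bar> ^ 8 /\<^sub>R fact 8 \<le> exp x + exp (- x)" by linarith
    then show ?thesis by (simp add: divide_simps mult.commute fact_numeral)
  qed
  have neg: "nsum (\<lambda>x. - p x) n \<omega> = - nsum p n \<omega>" for \<omega>
    by (simp add: nsum_def sum_negf)
  have e1: "expectation (\<lambda>\<omega>. exp (nsum p n \<omega>)) \<le> exp (1 / 2)" "integrable M (\<lambda>\<omega>. exp (nsum p n \<omega>))"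
    using exp_nsum_le[of p n] le mean by auto
  have e2: "expectation (\<lambda>\<omega>. exp (- nsum p n \<omega>)) \<le> exp (1 / 2)" "integrable M (\<lambda>\<omega>. exp (- nsum p n \<omega>))"
    using exp_nsum_le[of "\<lambda>x. - p x" n] le mean by (auto simp: neg)
  show i: "integrable M (\<lambda>\<omega>. nsum p n \<omega> ^ 8)"
    by (rule Bochner_Integration.integrable_bound[where f = "\<lambda>\<omega>. fact 8 * (exp (nsum p n \<omega>) + exp (- nsum p n \<omega>))"])
      (use e1 e2 order_trans[OF pow abs_ge_self] in auto)
  have "expectation (\<lambda>\<omega>. nsum p n \<omega> ^ 8) \<le> expectation (\<lambda>\<omega>. fact 8 * (exp (nsum p n \<omega>) + exp (- nsum p n \<omega>)))"
    by (intro integral_mono i pow) (use e1 e2 in auto)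
  also have "\<dots> = fact 8 * (expectation (\<lambda>\<omega>. exp (nsum p n \<omega>)) + expectation (\<lambda>\<omega>. exp (- nsum p n \<omega>)))"
    using e1(2) e2(2) by simp
  also have "\<dots> \<le> fact 8 * (exp (1 / 2) + exp (1 / 2))"
    using e1(1) e2(1) by (intro mult_left_mono add_mono) auto
  finally show "expectation (\<lambda>\<omega>. nsum p n \<omega> ^ 8) \<le> 2 * fact 8 * exp (1 / 2)" by simp
qed

end

section \<open>Weighted series of exponential variables\<close>

locale exponential_series = prob_space N for N :: "'a measure" +
  fixes E :: "nat \<Rightarrow> 'a \<Rightarrow> real" and b :: "nat \<Rightarrow> real"
  assumes indep: "indep_vars (\<lambda>_. borel) E UNIV"
    and exponential: "\<And>k. distributed N lborel (E k) (exponential_density 1)"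
    and E_nonneg: "\<And>k \<omega>. 0 \<le> E k \<omega>"
    and b_nonneg: "\<And>k. 0 \<le> b k"
    and b_summable: "summable b"
begin

definition psum :: "nat \<Rightarrow> 'a \<Rightarrow> real" where
  "psum K \<omega> = (\<Sum>k<K. b k * E k \<omega>)"

text \<open>Going through \<open>ennreal\<close> gives the value \<open>0\<close> on the null set where the series diverges, so that
  \<open>total\<close> is measurable and nonnegative everywhere.\<close>

definition total :: "'a \<Rightarrow> real" where
  "total \<omega> = enn2real (\<Sum>k. ennreal (b k * E k \<omega>))"

lemma E_measurable [measurable]: "E k \<in> borel_measurable N"
  using indep by (simp add: indep_vars_def2)

lemma psum_measurable [measurable]: "psum K \<in> borel_measurable N"
  unfolding psum_def[abs_def] by measurable

lemma total_measurable [measurable]: "total \<in> borel_measurable N"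
  unfolding total_def[abs_def] by measurable

lemma psum_nonneg: "0 \<le> psum K \<omega>"
  unfolding psum_def by (intro sum_nonneg mult_nonneg_nonneg b_nonneg E_nonneg)

lemma mono_psum: "mono (\<lambda>K. psum K \<omega>)"
  unfolding psum_def by (rule monoI, rule sum_mono2) (auto intro!: mult_nonneg_nonneg b_nonneg E_nonneg)

lemma E_moment: "expectation (\<lambda>\<omega>. E k \<omega> ^ j) = fact j" "integrable N (\<lambda>\<omega>. E k \<omega> ^ j)"
  using erlang_ith_moment[OF _ exponential, of k j] erlang_ith_moment_integrable[OF _ exponential, of k j] by simp_all

lemma E_moments:
  "expectation (E k) = 1" "expectation (\<lambda>\<omega>. E k \<omega> ^ 2) = 2" "expectation (\<lambda>\<omega>. E k \<omega> ^ 3) = 6"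
  "integrable N (E k)" "integrable N (\<lambda>\<omega>. E k \<omega> ^ 2)" "integrable N (\<lambda>\<omega>. E k \<omega> ^ 3)"
  using E_moment[of k 1] E_moment[of k 2] E_moment[of k 3] by (simp_all add: fact_numeral)

text \<open>Exponential tilting: exp(-sx) times the density of rate 1 is 1/(1+s) times the density
  of rate 1 + s.\<close>

lemma laplace_E:
  assumes "0 \<le> s"
  shows "expectation (\<lambda>\<omega>. exp (- s * E k \<omega>)) = 1 / (1 + s)"
proof -
  interpret D: prob_space "density lborel (exponential_density (1 + s))"
    using assms by (intro prob_space_exponential_density) simp
  have "expectation (\<lambda>\<omega>. exp (- s * E k \<omega>)) = (\<integral>x. exponential_density 1 x * exp (- s * x) \<partial>lborel)"
    using distributed_integral[OF exponential, of "\<lambda>x. exp (- s * x)" k] by simp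
  also have "\<dots> = (\<integral>x. (1 / (1 + s)) * exponential_density (1 + s) x \<partial>lborel)"
    using assms
    by (intro Bochner_Integration.integral_cong)
       (auto simp: exponential_density_def exp_add[symmetric] field_simps)
  also have "\<dots> = 1 / (1 + s) * (\<integral>x. exponential_density (1 + s) x \<partial>lborel)"
    by (rule integral_mult_right_zero)
  also have "(\<integral>x. exponential_density (1 + s) x \<partial>lborel) = (\<integral>x. 1 \<partial>density lborel (exponential_density (1 + s)))"
    using assms by (subst integral_density) (auto simp: exponential_density_nonneg)
  also have "\<dots> = 1" using D.prob_space by simp
  finally show ?thesis by simp
qed

lemma laplace_psum:
  assumes "0 \<le> s"
  shows "expectation (\<lambda>\<omega>. exp (- s * psum K \<omega>)) = (\<Prod>k<K. 1 / (1 + s * b k))"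
proof -
  have "exp (- s * psum K \<omega>) = (\<Prod>k<K. exp (- (s * b k) * E k \<omega>))" for \<omega>
    by (simp add: psum_def sum_distrib_left exp_sum[symmetric] mult.assoc sum_negf)
  moreover have "expectation (\<lambda>\<omega>. \<Prod>k<K. exp (- (s * b k) * E k \<omega>)) =
      (\<Prod>k<K. expectation (\<lambda>\<omega>. exp (- (s * b k) * E k \<omega>)))"
  proof (rule indep_vars_lebesgue_integral)
    show "indep_vars (\<lambda>_. borel) (\<lambda>k \<omega>. exp (- (s * b k) * E k \<omega>)) {..<K}"
      by (rule indep_vars_subset[OF indep_vars_compose2[OF indep]]) auto
    show "integrable N (\<lambda>\<omega>. exp (- (s * b k) * E k \<omega>))" for k
      using assms b_nonneg[of k] E_nonneg[of k]
      by (intro integrable_const_bound[where B = 1]) auto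
  qed simp
  moreover have "expectation (\<lambda>\<omega>. exp (- (s * b k) * E k \<omega>)) = 1 / (1 + s * b k)" for k
    using assms b_nonneg[of k] by (intro laplace_E) simp
  ultimately show ?thesis by simp
qed

lemma indep_psum: "indep_var borel (\<lambda>\<omega>. b K * E K \<omega>) borel (psum K)"
  unfolding psum_def[abs_def]
proof (rule indep_vars_sum)
  show "indep_vars (\<lambda>_. borel) (\<lambda>k \<omega>. b k * E k \<omega>) (insert K {..<K})"
    by (rule indep_vars_subset[OF indep_vars_compose2[OF indep]]) auto
qed auto

text \<open>The summand \<open>b k * E k\<close> has cumulants b, b^2, 2 b^3, which add up under
  independence. The right-hand sides are the raw moments that belong to the cumulants s1, s2, 2
  s3.\<close>

lemma psum_moments:
  fixes K :: nat
  defines "s1 \<equiv> \<Sum>k<K. b k" and "s2 \<equiv> \<Sum>k<K. b k ^ 2" and "s3 \<equiv> \<Sum>k<K. b k ^ 3"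
  shows "integrable N (psum K) \<and> integrable N (\<lambda>\<omega>. psum K \<omega> ^ 2) \<and> integrable N (\<lambda>\<omega>. psum K \<omega> ^ 3) \<and>
    expectation (psum K) = s1 \<and> expectation (\<lambda>\<omega>. psum K \<omega> ^ 2) = s1 ^ 2 + s2 \<and>
    expectation (\<lambda>\<omega>. psum K \<omega> ^ 3) = s1 ^ 3 + 3 * s1 * s2 + 2 * s3"
  unfolding assms
proof (induction K)
  case 0
  have "psum 0 = (\<lambda>_. 0)" by (simp add: psum_def fun_eq_iff)
  then show ?case by simp
next
  case (Suc K)
  define Y where "Y \<omega> = b K * E K \<omega>" for \<omega>
  define P where "P = psum K"
  have S: "psum (Suc K) = (\<lambda>\<omega>. P \<omega> + Y \<omega>)" by (simp add: psum_def P_def Y_def fun_eq_iff)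
  have Y: "integrable N Y" "integrable N (\<lambda>\<omega>. Y \<omega> ^ 2)" "integrable N (\<lambda>\<omega>. Y \<omega> ^ 3)"
    "expectation Y = b K" "expectation (\<lambda>\<omega>. Y \<omega> ^ 2) = 2 * b K ^ 2" "expectation (\<lambda>\<omega>. Y \<omega> ^ 3) = 6 * b K ^ 3"
    unfolding Y_def power_mult_distrib using E_moments[of K] by simp_all
  have ind: "indep_var borel Y borel P"
    using indep_psum[of K] unfolding Y_def P_def .
  have ind2: "indep_var borel (\<lambda>\<omega>. Y \<omega> ^ i) borel (\<lambda>\<omega>. P \<omega> ^ j)" for i j
    using indep_var_compose[OF ind, of "\<lambda>x. x ^ i" borel "\<lambda>x. x ^ j" borel] by (simp add: comp_def)
  note IH = Suc.IH[folded P_def]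
  note prod = indep_var_lebesgue_integral[OF ind2] indep_var_integrable[OF ind2]
  have YP: "integrable N (\<lambda>\<omega>. Y \<omega> * P \<omega>)" "expectation (\<lambda>\<omega>. Y \<omega> * P \<omega>) = b K * (\<Sum>k<K. b k)"
    "integrable N (\<lambda>\<omega>. Y \<omega> ^ 2 * P \<omega>)" "expectation (\<lambda>\<omega>. Y \<omega> ^ 2 * P \<omega>) = 2 * b K ^ 2 * (\<Sum>k<K. b k)"
    "integrable N (\<lambda>\<omega>. Y \<omega> * P \<omega> ^ 2)"
    "expectation (\<lambda>\<omega>. Y \<omega> * P \<omega> ^ 2) = b K * ((\<Sum>k<K. b k) ^ 2 + (\<Sum>k<K. b k ^ 2))"
    using prod[of 1 1] prod[of 2 1] prod[of 1 2] IH Y by simp_all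
  have e2: "(P \<omega> + Y \<omega>) ^ 2 = P \<omega> ^ 2 + 2 * (Y \<omega> * P \<omega>) + Y \<omega> ^ 2" for \<omega>
    by (simp add: power2_eq_square algebra_simps)
  have e3: "(P \<omega> + Y \<omega>) ^ 3 = P \<omega> ^ 3 + 3 * (Y \<omega> * P \<omega> ^ 2) + 3 * (Y \<omega> ^ 2 * P \<omega>) + Y \<omega> ^ 3" for \<omega>
    by (simp add: power2_eq_square power3_eq_cube algebra_simps)
  have "expectation (\<lambda>\<omega>. P \<omega> ^ 2 + 2 * (Y \<omega> * P \<omega>) + Y \<omega> ^ 2) =
      (\<Sum>k<K. b k) ^ 2 + (\<Sum>k<K. b k ^ 2) + 2 * (b K * (\<Sum>k<K. b k)) + 2 * b K ^ 2"
    using IH Y YP by simp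
  moreover have "expectation (\<lambda>\<omega>. P \<omega> ^ 3 + 3 * (Y \<omega> * P \<omega> ^ 2) + 3 * (Y \<omega> ^ 2 * P \<omega>) + Y \<omega> ^ 3) =
      (\<Sum>k<K. b k) ^ 3 + 3 * (\<Sum>k<K. b k) * (\<Sum>k<K. b k ^ 2) + 2 * (\<Sum>k<K. b k ^ 3)
      + 3 * (b K * ((\<Sum>k<K. b k) ^ 2 + (\<Sum>k<K. b k ^ 2))) + 3 * (2 * b K ^ 2 * (\<Sum>k<K. b k)) + 6 * b K ^ 3"
    using IH Y YP by simp
  moreover have "integrable N (\<lambda>\<omega>. P \<omega> + Y \<omega>)"
    "integrable N (\<lambda>\<omega>. P \<omega> ^ 2 + 2 * (Y \<omega> * P \<omega>) + Y \<omega> ^ 2)"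
    "integrable N (\<lambda>\<omega>. P \<omega> ^ 3 + 3 * (Y \<omega> * P \<omega> ^ 2) + 3 * (Y \<omega> ^ 2 * P \<omega>) + Y \<omega> ^ 3)"
    "expectation (\<lambda>\<omega>. P \<omega> + Y \<omega>) = (\<Sum>k<K. b k) + b K"
    using IH Y YP by simp_all
  ultimately show ?case
    unfolding S e2 e3 by (simp add: power2_eq_square power3_eq_cube algebra_simps)
qed

lemma summable_b_power: "j \<ge> 1 \<Longrightarrow> summable (\<lambda>k. b k ^ j)"
proof (induction j rule: dec_induct)
  case (step j)
  have "\<forall>\<^sub>F k in sequentially. b k < 1"
    using summable_LIMSEQ_zero[OF b_summable] by (rule order_tendstoD) simp
  then have "\<forall>\<^sub>F k in sequentially. norm (b k ^ Suc j) \<le> b k ^ j"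
    by eventually_elim (use b_nonneg in \<open>simp add: mult_left_le_one_le\<close>)
  then show ?case using step.IH by (rule summable_comparison_test_ev)
qed (simp add: b_summable)

text \<open>By Tonelli the expected value of the series is the sum of the \<open>b k\<close>, which
  is finite.\<close>

lemma AE_summable: "AE \<omega> in N. summable (\<lambda>k. b k * E k \<omega>)"
proof -
  have "(\<integral>\<^sup>+\<omega>. (\<Sum>k. ennreal (b k * E k \<omega>)) \<partial>N) = (\<Sum>k. \<integral>\<^sup>+\<omega>. ennreal (b k * E k \<omega>) \<partial>N)"
    by (rule nn_integral_suminf) simp
  also have "\<dots> = (\<Sum>k. ennreal (b k))"
  proof (intro suminf_cong)
    fix k
    have "(\<integral>\<^sup>+\<omega>. ennreal (b k * E k \<omega>) \<partial>N) = ennreal (expectation (\<lambda>\<omega>. b k * E k \<omega>))"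
      by (rule nn_integral_eq_integral) (auto intro!: E_moments mult_nonneg_nonneg b_nonneg E_nonneg)
    then show "(\<integral>\<^sup>+\<omega>. ennreal (b k * E k \<omega>) \<partial>N) = ennreal (b k)" by (simp add: E_moments)
  qed
  also have "\<dots> \<noteq> \<infinity>" using b_nonneg b_summable by (simp add: suminf_ennreal2)
  finally have "AE \<omega> in N. (\<Sum>k. ennreal (b k * E k \<omega>)) \<noteq> \<infinity>"
    by (intro nn_integral_noteq_infinite) auto
  then show ?thesis
    by eventually_elim (auto intro!: summable_suminf_not_top mult_nonneg_nonneg b_nonneg E_nonneg)
qed

lemma AE_psum_tendsto: "AE \<omega> in N. (\<lambda>K. psum K \<omega>) \<longlonglongrightarrow> total \<omega>"
  using AE_summable
proof eventually_elim
  case (elim \<omega>)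
  have nn: "0 \<le> b k * E k \<omega>" for k by (intro mult_nonneg_nonneg b_nonneg E_nonneg)
  have "total \<omega> = (\<Sum>k. b k * E k \<omega>)"
    unfolding total_def using elim nn by (simp add: suminf_ennreal2 suminf_nonneg)
  then show ?case unfolding psum_def using summable_LIMSEQ[OF elim] by simp
qed

text \<open>The partial sums are nonnegative and increasing, so monotone convergence applies to each
  of their powers.\<close>

lemma total_moments:
  fixes s1 s2 s3 :: real
  assumes "b sums s1" "(\<lambda>k. b k ^ 2) sums s2" "(\<lambda>k. b k ^ 3) sums s3"
  shows "integrable N total" "expectation total = s1"
    "integrable N (\<lambda>\<omega>. total \<omega> ^ 2)" "expectation (\<lambda>\<omega>. total \<omega> ^ 2) = s1 ^ 2 + s2"
    "integrable N (\<lambda>\<omega>. total \<omega> ^ 3)" "expectation (\<lambda>\<omega>. total \<omega> ^ 3) = s1 ^ 3 + 3 * s1 * s2 + 2 * s3"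
proof -
  note lims = assms[unfolded sums_def]
  have lim: "AE \<omega> in N. (\<lambda>K. psum K \<omega> ^ j) \<longlonglongrightarrow> total \<omega> ^ j" for j
    using AE_psum_tendsto by eventually_elim (rule tendsto_power)
  have mono: "mono (\<lambda>K. psum K \<omega> ^ j)" for j \<omega>
    using mono_psum[of \<omega>] by (auto simp: mono_def intro!: power_mono psum_nonneg)
  have *: "integrable N (\<lambda>\<omega>. total \<omega> ^ j) \<and> expectation (\<lambda>\<omega>. total \<omega> ^ j) = m"
    if "\<And>K. integrable N (\<lambda>\<omega>. psum K \<omega> ^ j)" "(\<lambda>K. expectation (\<lambda>\<omega>. psum K \<omega> ^ j)) \<longlonglongrightarrow> m" for j m
    using integral_monotone_convergence_nonneg[OF that(1) _ _ lim that(2)] mono psum_nonneg by auto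
  show "integrable N total" "expectation total = s1"
    using *[of 1 s1] psum_moments lims by auto
  have "(\<lambda>K. (\<Sum>k<K. b k) ^ 2 + (\<Sum>k<K. b k ^ 2)) \<longlonglongrightarrow> s1 ^ 2 + s2"
    by (intro tendsto_intros lims)
  then show "integrable N (\<lambda>\<omega>. total \<omega> ^ 2)" "expectation (\<lambda>\<omega>. total \<omega> ^ 2) = s1 ^ 2 + s2"
    using *[of 2 "s1 ^ 2 + s2"] psum_moments by auto
  have "(\<lambda>K. (\<Sum>k<K. b k) ^ 3 + 3 * (\<Sum>k<K. b k) * (\<Sum>k<K. b k ^ 2) + 2 * (\<Sum>k<K. b k ^ 3))
      \<longlonglongrightarrow> s1 ^ 3 + 3 * s1 * s2 + 2 * s3"
    by (intro tendsto_intros lims)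
  then show "integrable N (\<lambda>\<omega>. total \<omega> ^ 3)" "expectation (\<lambda>\<omega>. total \<omega> ^ 3) = s1 ^ 3 + 3 * s1 * s2 + 2 * s3"
    using *[of 3 "s1 ^ 3 + 3 * s1 * s2 + 2 * s3"] psum_moments by auto
qed

lemma expectation_total_minus_psum:
  "expectation (\<lambda>\<omega>. \<bar>total \<omega> - psum K \<omega>\<bar>) = (\<Sum>k. b k) - (\<Sum>k<K. b k)"
proof -
  have "AE \<omega> in N. \<bar>total \<omega> - psum K \<omega>\<bar> = total \<omega> - psum K \<omega>"
    using AE_psum_tendsto
  proof eventually_elim
    case (elim \<omega>)
    then have "psum K \<omega> \<le> total \<omega>" using mono_psum by (intro incseq_le) (auto simp: incseq_def mono_def)
    then show ?case by simp
  qed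
  then have "expectation (\<lambda>\<omega>. \<bar>total \<omega> - psum K \<omega>\<bar>) = expectation (\<lambda>\<omega>. total \<omega> - psum K \<omega>)"
    by (intro integral_cong_AE) auto
  also have "\<dots> = (\<Sum>k. b k) - (\<Sum>k<K. b k)"
    using total_moments[OF summable_sums[OF b_summable] summable_sums[OF summable_b_power]
        summable_sums[OF summable_b_power]] psum_moments[of K] by simp
  finally show ?thesis .
qed

end

text \<open>The coordinates of the product space are nonnegative only almost surely; absolute values
  give \<open>E_nonneg\<close> at every point and leave the law unchanged.\<close>

lemma exponential_series_PiM:
  fixes b :: "nat \<Rightarrow> real"
  assumes "\<And>k. 0 \<le> b k" "summable b"
  shows "exponential_series (PiM UNIV (\<lambda>_::nat. density lborel (exponential_density 1))) (\<lambda>k \<omega>. \<bar>\<omega> k\<bar>) b"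
proof -
  define D where "D = density lborel (exponential_density 1)"
  define N where "N = PiM UNIV (\<lambda>_::nat. D)"
  interpret D: prob_space D
    unfolding D_def by (rule prob_space_exponential_density) simp
  interpret NP: product_prob_space "\<lambda>_::nat. D" UNIV ..
  interpret N: prob_space N unfolding N_def by (rule prob_space_PiM) (rule D.prob_space_axioms)
  have [measurable_cong]: "sets D = sets borel" by (simp add: D_def)
  have [measurable]: "(\<lambda>\<omega>. \<omega> k) \<in> N \<rightarrow>\<^sub>M borel" for k
    unfolding N_def by measurable
  have "distr N borel (\<lambda>\<omega>. \<omega> k) = distr N D (\<lambda>\<omega>. \<omega> k)" for k
    by (rule distr_cong) (auto simp: D_def)
  then have comp: "distr N borel (\<lambda>\<omega>. \<omega> k) = D" for k
    using NP.PiM_component[of k] by (simp add: N_def)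
  have "N.indep_vars (\<lambda>_. borel) (\<lambda>k \<omega>. \<omega> k) UNIV"
  proof (subst N.indep_vars_iff_distr_eq_PiM)
    have "distr N (PiM UNIV (\<lambda>_. borel)) (\<lambda>x. \<lambda>i\<in>UNIV. x i) = distr N N (\<lambda>x. x)"
    proof (rule distr_cong)
      show "sets (PiM UNIV (\<lambda>_. borel)) = sets N"
        unfolding N_def by (rule sets_PiM_cong) (simp_all add: D_def)
    qed (simp_all add: restrict_def)
    also have "\<dots> = N" by simp
    finally show "distr N (PiM UNIV (\<lambda>_. borel)) (\<lambda>x. \<lambda>i\<in>UNIV. x i) =
        PiM UNIV (\<lambda>i. distr N borel (\<lambda>\<omega>. \<omega> i))"
      unfolding comp by (simp add: N_def)
  qed auto
  then have "N.indep_vars (\<lambda>_. borel) (\<lambda>k \<omega>. \<bar>\<omega> k\<bar>) UNIV"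
    by (rule N.indep_vars_compose2) simp
  moreover have "distributed N lborel (\<lambda>\<omega>. \<bar>\<omega> k\<bar>) (exponential_density 1)" for k
  proof -
    have "AE x in D. \<bar>x\<bar> = x"
      unfolding D_def by (subst AE_density) (auto simp: exponential_density_def)
    then have "AE x in distr N borel (\<lambda>\<omega>. \<omega> k). \<bar>x\<bar> = x" unfolding comp .
    then have "AE \<omega> in N. \<bar>\<omega> k\<bar> = \<omega> k" by (subst (asm) AE_distr_iff) auto
    then have "distr N lborel (\<lambda>\<omega>. \<bar>\<omega> k\<bar>) = distr N borel (\<lambda>\<omega>. \<omega> k)"
      by (intro distr_cong_AE) auto
    then show ?thesis unfolding distributed_def comp by (simp add: D_def)
  qed
  ultimately show ?thesis
    unfolding exponential_series_def exponential_series_axioms_def using assms N.prob_space_axioms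
    by (simp add: N_def D_def)
qed

section \<open>Characters and distance of the circle\<close>

lift_definition circle_exp :: "int \<Rightarrow> circle \<Rightarrow> complex" is
  "\<lambda>k x. cis (2 * pi * (of_int k * x))"
proof -
  fix k :: int and x y :: real
  assume "x - y \<in> \<int>"
  then have "of_int k * (x - y) \<in> \<int>" by simp
  then have "cis (2 * pi * (of_int k * (x - y))) = 1" by (rule cis_multiple_2pi)
  moreover have "2 * pi * (of_int k * x) = 2 * pi * (of_int k * (x - y)) + 2 * pi * (of_int k * y)"
    by (simp add: algebra_simps)
  ultimately show "cis (2 * pi * (of_int k * x)) = cis (2 * pi * (of_int k * y))"
    by (metis cis_mult mult_1)
qed

lemma circle_exp_proj: "circle_exp k (circle_proj x) = cis (2 * pi * (of_int k * x))"
  by transfer simp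

lemma circle_exp_add: "circle_exp (k + l) a = circle_exp k a * circle_exp l a"
  by transfer (simp add: cis_mult algebra_simps)

lemma circle_exp_0 [simp]: "circle_exp 0 a = 1"
  by transfer simp

lemma circle_exp_minus: "circle_exp (- k) a = cnj (circle_exp k a)"
  by transfer (simp add: cis_cnj)

lemma circle_exp_diff: "circle_exp (k - l) a = circle_exp k a * cnj (circle_exp l a)"
  using circle_exp_add[of k "- l" a] by (simp add: circle_exp_minus)

lemma norm_circle_exp [simp]: "norm (circle_exp k a) = 1"
  by transfer simp

text \<open>Moving one representative by the nearest integer makes the difference of the
  representatives equal, up to sign, to the distance.\<close>

lemma dist_circle_exp_le: "dist (circle_exp k a) (circle_exp k b) \<le> 2 * pi * \<bar>of_int k\<bar> * dist a b"
proof -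
  obtain x y where xy: "a = circle_proj x" "b = circle_proj y" using circle_proj_surj by metis
  define t where "t = x - y - of_int (round (x - y))"
  have "circle_proj x = circle_proj (y + t)" by (simp add: circle_proj_eq_iff t_def)
  then have "dist (circle_exp k a) (circle_exp k b) =
      norm (iexp (2 * pi * (of_int k * (y + t))) - iexp (2 * pi * (of_int k * y)))"
    by (simp add: xy circle_exp_proj dist_norm cis_conv_exp)
  also have "\<dots> \<le> \<bar>2 * pi * (of_int k * (y + t)) - 2 * pi * (of_int k * y)\<bar>"
    by (rule norm_iexp_diff_le)
  also have "2 * pi * (of_int k * (y + t)) - 2 * pi * (of_int k * y) = 2 * pi * of_int k * t"
    by (simp add: algebra_simps)
  finally show ?thesis by (simp add: xy dist_circle_proj abs_mult t_def)
qed

lemma sets_circle_measure [measurable_cong, simp]: "sets circle_measure = sets borel"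
  by (simp add: circle_measure_def)

lemma space_circle_measure [simp]: "space circle_measure = UNIV"
  by (simp add: circle_measure_def)

lemma circle_exp_measurable [measurable]: "circle_exp k \<in> borel_measurable borel"
proof (rule borel_measurable_continuous_onI)
  have "(2 * pi * \<bar>of_int k\<bar>)-lipschitz_on UNIV (circle_exp k)"
    by (rule lipschitz_onI) (auto intro: dist_circle_exp_le)
  then show "continuous_on UNIV (circle_exp k)" by (rule lipschitz_on_continuous_on)
qed

lemma integral_circle_exp: "(\<integral>a. circle_exp k a \<partial>circle_measure) = of_bool (k = 0)"
proof (cases "k = 0")
  case True
  then show ?thesis using prob_space.prob_space[OF prob_space_circle_measure] by simp
next
  case False
  define c where "c = 2 * pi * of_int k * \<i>"
  define F where "F x = exp (c * of_real x) / c" for x :: real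
  have cis_eq: "cis (2 * pi * (of_int k * x)) = exp (c * of_real x)" for x
    by (simp add: cis_conv_exp c_def mult_ac)
  have "(\<integral>a. circle_exp k a \<partial>circle_measure) =
      (\<integral>x. cis (2 * pi * (of_int k * x)) \<partial>restrict_space lborel {0..<1})"
    unfolding circle_measure_def by (subst integral_distr) (auto simp: circle_exp_proj measurable_restrict_space1)
  also have "\<dots> = (\<integral>x. indicator {0..<1} x *\<^sub>R cis (2 * pi * (of_int k * x)) \<partial>lborel)"
    by (subst integral_restrict_space) auto
  also have "\<dots> = (\<integral>x. indicator {0..1} x *\<^sub>R cis (2 * pi * (of_int k * x)) \<partial>lborel)"
  proof (rule integral_cong_AE)
    show "AE x in lborel. indicator {0..<1} x *\<^sub>R cis (2 * pi * (of_int k * x)) =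
        indicator {0..1} x *\<^sub>R cis (2 * pi * (of_int k * x))"
      using AE_lborel_singleton[of 1] by eventually_elim (auto simp: indicator_def)
  qed (auto simp: cis_conv_exp)
  also have "\<dots> = F 1 - F 0"
  proof (rule has_bochner_integral_integral_eq, rule has_bochner_integral_FTC_Icc)
    fix x :: real
    have "((\<lambda>z. exp (c * z) / c) has_field_derivative exp (c * of_real x)) (at (of_real x))"
      using False by (auto intro!: derivative_eq_intros simp: c_def)
    then show "(F has_vector_derivative cis (2 * pi * (of_int k * x))) (at x within {0..1})"
      unfolding F_def cis_eq by (rule has_vector_derivative_real_field)
  qed (auto simp: cis_conv_exp intro!: continuous_intros)
  also have "F 1 = F 0" using cis_multiple_2pi[of "of_int k"] cis_eq[of 1] by (simp add: F_def)
  finally show ?thesis using False by simp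
qed

interpretation circle_measure: prob_space circle_measure
  by (rule prob_space_circle_measure)

lemma integrable_circle_exp: "integrable circle_measure (circle_exp k)"
  by (rule circle_measure.integrable_const_bound[where B = 1]) auto

lemma integral_Re_Im_circle_exp:
  "(\<integral>a. Re (circle_exp k a) \<partial>circle_measure) = of_bool (k = 0)"
  "(\<integral>a. Im (circle_exp k a) \<partial>circle_measure) = 0"
  "integrable circle_measure (\<lambda>a. Re (circle_exp k a))"
  "integrable circle_measure (\<lambda>a. Im (circle_exp k a))"
  using integral_Re[OF integrable_circle_exp, of k] integral_Im[OF integrable_circle_exp, of k]
    integrable_circle_exp[of k]
  by (simp_all add: integral_circle_exp)

text \<open>Product-to-sum formulas. They make \<open>sqrt 2\<close> times the real and imaginary
  parts of characters at distinct positive frequencies an orthonormal family.\<close>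

lemma integral_Re_Im_products:
  "(\<integral>a. Re (circle_exp k a) * Re (circle_exp l a) \<partial>circle_measure) = (of_bool (k + l = 0) + of_bool (k = l)) / 2"
  "(\<integral>a. Im (circle_exp k a) * Im (circle_exp l a) \<partial>circle_measure) = (of_bool (k = l) - of_bool (k + l = 0)) / 2"
  "(\<integral>a. Re (circle_exp k a) * Im (circle_exp l a) \<partial>circle_measure) = 0"
proof -
  have e: "Re (circle_exp k a) * Re (circle_exp l a) = (Re (circle_exp (k + l) a) + Re (circle_exp (k - l) a)) / 2"
    "Im (circle_exp k a) * Im (circle_exp l a) = (Re (circle_exp (k - l) a) - Re (circle_exp (k + l) a)) / 2"
    "Re (circle_exp k a) * Im (circle_exp l a) = (Im (circle_exp (k + l) a) - Im (circle_exp (k - l) a)) / 2" for a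
    by (simp_all add: circle_exp_add circle_exp_diff field_simps)
  note [simp] = integral_Re_Im_circle_exp
  show "(\<integral>a. Re (circle_exp k a) * Re (circle_exp l a) \<partial>circle_measure) = (of_bool (k + l = 0) + of_bool (k = l)) / 2"
    unfolding e by simp
  show "(\<integral>a. Im (circle_exp k a) * Im (circle_exp l a) \<partial>circle_measure) = (of_bool (k = l) - of_bool (k + l = 0)) / 2"
    unfolding e by simp
  show "(\<integral>a. Re (circle_exp k a) * Im (circle_exp l a) \<partial>circle_measure) = 0"
    unfolding e by simp
qed

section \<open>Fourier expansion of the distance\<close>

text \<open>The coefficient of |t| on [-1/2, 1/2] at odd frequencies. At even nonzero frequencies
  the true coefficient is 0, so sums over it range over odd integers.\<close>

definition fourier_coeff :: "int \<Rightarrow> real" where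
  "fourier_coeff k = - 1 / (pi * of_int k) ^ 2"

text \<open>The frequencies of absolute value at most 2K - 1, symmetric under negation so that
  conjugate terms can be paired.\<close>

definition odd_ints :: "nat \<Rightarrow> int set" where
  "odd_ints K = (\<lambda>m. 2 * int m + 1) ` {..<K} \<union> (\<lambda>m. - (2 * int m + 1)) ` {..<K}"

definition dist_trunc :: "nat \<Rightarrow> circle \<Rightarrow> circle \<Rightarrow> real" where
  "dist_trunc K a b = 1 / 4 + (\<Sum>k\<in>odd_ints K. fourier_coeff k * Re (circle_exp k a * cnj (circle_exp k b)))"

lemma finite_odd_ints [simp]: "finite (odd_ints K)"
  by (simp add: odd_ints_def)

lemma zero_notin_odd_ints: "k \<in> odd_ints K \<Longrightarrow> k \<noteq> 0"
  by (auto simp: odd_ints_def)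

lemma uminus_odd_ints: "k \<in> odd_ints K \<Longrightarrow> - k \<in> odd_ints K"
  by (auto simp: odd_ints_def image_iff)

lemma fourier_coeff_minus [simp]: "fourier_coeff (- k) = fourier_coeff k"
  by (simp add: fourier_coeff_def)

lemma fourier_coeff_nonpos: "fourier_coeff k \<le> 0"
  by (simp add: fourier_coeff_def)

lemma sum_odd_ints: "(\<Sum>k\<in>odd_ints K. f k) = (\<Sum>m<K. f (2 * int m + 1) + f (- (2 * int m + 1)))"
proof -
  have "(\<lambda>m. 2 * int m + 1) ` {..<K} \<inter> (\<lambda>m. - (2 * int m + 1)) ` {..<K} = {}"
  proof -
    have "2 * int m + 1 \<noteq> - (2 * int m' + 1)" for m m' by linarith
    then show ?thesis by blast
  qed
  then have "(\<Sum>k\<in>odd_ints K. f k) =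
      (\<Sum>k\<in>(\<lambda>m. 2 * int m + 1) ` {..<K}. f k) + (\<Sum>k\<in>(\<lambda>m. - (2 * int m + 1)) ` {..<K}. f k)"
    unfolding odd_ints_def by (intro sum.union_disjoint) auto
  also have "\<dots> = (\<Sum>m<K. f (2 * int m + 1)) + (\<Sum>m<K. f (- (2 * int m + 1)))"
    by (subst (1 2) sum.reindex) (auto simp: inj_on_def)
  finally show ?thesis by (simp add: sum.distrib)
qed

lemma fourier_coeff_odd: "fourier_coeff (2 * int m + 1) = - (1 / real (2 * m + 1) ^ 2) / pi ^ 2"
proof -
  have "- 1 / (pi * q) ^ 2 = - (1 / q ^ 2) / pi ^ 2" for q :: real
    by (simp add: power_mult_distrib)
  from this[of "real (2 * m + 1)"] show ?thesis by (simp add: fourier_coeff_def add.commute)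
qed

lemma fourier_coeff_sums: "(\<lambda>m. - fourier_coeff (2 * int m + 1)) sums (1 / 8)"
proof -
  have "(\<lambda>m. (1 / real (2 * m + 1) ^ 2) / pi ^ 2) sums (pi ^ 2 / 8 / pi ^ 2)"
    by (intro sums_divide odd_zeta_sums[OF order.refl, unfolded odd_zeta_values(1) mult_1_right])
  then show ?thesis by (simp add: fourier_coeff_odd)
qed

lemma sum_fourier_coeff_le: "(\<Sum>m<K. - fourier_coeff (2 * int m + 1)) \<le> 1 / 8"
  using sum_le_suminf[OF sums_summable[OF fourier_coeff_sums], of "{..<K}"] sums_unique[OF fourier_coeff_sums]
  by (simp add: fourier_coeff_nonpos)

lemma sum_abs_fourier_coeff_le: "(\<Sum>k\<in>odd_ints K. \<bar>fourier_coeff k\<bar>) \<le> 1 / 4"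
  using sum_fourier_coeff_le[of K]
  by (simp only: sum_odd_ints abs_of_nonpos fourier_coeff_nonpos fourier_coeff_minus sum.distrib)

text \<open>With t the signed difference reduced to [-1/2, 1/2] and u = 2 pi |t|, each character
  term becomes cos(k u), and the closed form of the triangle wave on [0, pi] gives u / (2 pi) =
  |t|.\<close>

lemma dist_trunc_tendsto: "(\<lambda>K. dist_trunc K a b) \<longlonglongrightarrow> dist a b"
proof -
  obtain x y where xy: "a = circle_proj x" "b = circle_proj y" using circle_proj_surj by metis
  define t where "t = x - y - of_int (round (x - y))"
  have "\<bar>t\<bar> \<le> 1 / 2" using of_int_round_abs_le[of "x - y"] by (simp add: t_def abs_minus_commute)
  define u where "u = 2 * pi * \<bar>t\<bar>"
  have "2 * pi * \<bar>t\<bar> \<le> 2 * pi * (1 / 2)" using \<open>\<bar>t\<bar> \<le> 1 / 2\<close> by (intro mult_left_mono) auto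
  then have u: "0 \<le> u" "u \<le> pi" by (simp_all add: u_def)
  have Re_eq: "Re (circle_exp k a * cnj (circle_exp k b)) = cos (of_int k * u)" for k
  proof -
    have "circle_exp k a * cnj (circle_exp k b) = cis (2 * pi * (of_int k * (x - y)))"
      by (simp add: xy circle_exp_proj cis_cnj cis_mult algebra_simps)
    also have "\<dots> = circle_exp k (circle_proj (x - y))" by (simp add: circle_exp_proj)
    also have "circle_proj (x - y) = circle_proj t" by (simp add: circle_proj_eq_iff t_def)
    finally show ?thesis
      by (cases "t \<ge> 0") (simp_all add: circle_exp_proj u_def mult_ac)
  qed
  have "dist_trunc K a b = 1 / 4 - 2 / pi ^ 2 * (\<Sum>m<K. cos (real (2 * m + 1) * u) / real (2 * m + 1) ^ (2 * 1))" for K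
  proof -
    have "(\<Sum>k\<in>odd_ints K. fourier_coeff k * cos (of_int k * u)) =
        (\<Sum>m<K. - (2 / pi ^ 2) * (cos (real (2 * m + 1) * u) / real (2 * m + 1) ^ (2 * 1)))"
      unfolding sum_odd_ints
    proof (intro sum.cong refl)
      fix m
      have gen: "- (1 / q ^ 2) / p ^ 2 * c + - (1 / q ^ 2) / p ^ 2 * c = - (2 / p ^ 2) * (c / q ^ (2 * 1))"
        for p q c :: real by simp
      have "of_int (- (2 * int m + 1)) * u = - (real (2 * m + 1) * u)" by (simp add: algebra_simps)
      then have "cos (of_int (- (2 * int m + 1)) * u) = cos (real (2 * m + 1) * u)" by (metis cos_minus)
      moreover have "cos (of_int (2 * int m + 1) * u) = cos (real (2 * m + 1) * u)" by (simp add: add.commute)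
      ultimately show "fourier_coeff (2 * int m + 1) * cos (of_int (2 * int m + 1) * u) +
          fourier_coeff (- (2 * int m + 1)) * cos (of_int (- (2 * int m + 1)) * u) =
          - (2 / pi ^ 2) * (cos (real (2 * m + 1) * u) / real (2 * m + 1) ^ (2 * 1))"
        by (simp only: fourier_coeff_minus fourier_coeff_odd gen)
    qed
    then show ?thesis unfolding dist_trunc_def Re_eq by (simp add: sum_distrib_left sum_negf)
  qed
  moreover have "(\<lambda>K. \<Sum>m<K. cos (real (2 * m + 1) * u) / real (2 * m + 1) ^ (2 * 1)) \<longlonglongrightarrow> odd_cos_series 1 u"
    unfolding odd_cos_series_def by (intro summable_LIMSEQ summable_odd_trig) auto
  ultimately have "(\<lambda>K. dist_trunc K a b) \<longlonglongrightarrow> 1 / 4 - 2 / pi ^ 2 * odd_cos_series 1 u"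
    by (simp only:) (intro tendsto_intros)
  also have "1 / 4 - 2 / pi ^ 2 * odd_cos_series 1 u = \<bar>t\<bar>"
    unfolding odd_cos_series_1[OF u] by (simp add: u_def field_simps power2_eq_square)
  finally show ?thesis by (simp add: xy dist_circle_proj t_def)
qed

text \<open>The absolute coefficients sum to at most 1/4, which is also the constant term, so no
  truncation leaves [0, 1/2]. This bound dominates every passage to the limit in K.\<close>

lemma dist_trunc_bounds: "0 \<le> dist_trunc K a b" "dist_trunc K a b \<le> 1 / 2"
proof -
  have "\<bar>\<Sum>k\<in>odd_ints K. fourier_coeff k * Re (circle_exp k a * cnj (circle_exp k b))\<bar> \<le>
      (\<Sum>k\<in>odd_ints K. \<bar>fourier_coeff k\<bar> * 1)"
  proof (rule order_trans[OF sum_abs sum_mono])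
    fix k
    have "\<bar>Re (circle_exp k a * cnj (circle_exp k b))\<bar> \<le> 1"
      using abs_Re_le_cmod[of "circle_exp k a * cnj (circle_exp k b)"] by (simp only: norm_mult complex_mod_cnj norm_circle_exp)
    then show "\<bar>fourier_coeff k * Re (circle_exp k a * cnj (circle_exp k b))\<bar> \<le> \<bar>fourier_coeff k\<bar> * 1"
      unfolding abs_mult by (intro mult_left_mono) auto
  qed
  then have "\<bar>\<Sum>k\<in>odd_ints K. fourier_coeff k * Re (circle_exp k a * cnj (circle_exp k b))\<bar> \<le> 1 / 4"
    using sum_abs_fourier_coeff_le[of K] by simp
  then show "0 \<le> dist_trunc K a b" "dist_trunc K a b \<le> 1 / 2"
    unfolding dist_trunc_def by linarith+
qed

lemma dist_circle_le: "dist a b \<le> (1 / 2 :: real)" for a b :: circle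
  by (rule LIMSEQ_le_const2[OF dist_trunc_tendsto]) (blast intro: dist_trunc_bounds)

lemma dist_trunc_measurable [measurable]:
  assumes [measurable]: "f \<in> M \<rightarrow>\<^sub>M borel" "g \<in> M \<rightarrow>\<^sub>M borel"
  shows "(\<lambda>\<omega>. dist_trunc K (f \<omega>) (g \<omega>)) \<in> borel_measurable M"
  unfolding dist_trunc_def circle_exp_minus[symmetric] by measurable

text \<open>Obtained as a pointwise limit of trigonometric polynomials, so that only measurability
  of the characters in each variable enters.\<close>

lemma dist_circle_measurable [measurable]:
  fixes f g :: "'a \<Rightarrow> circle"
  assumes [measurable]: "f \<in> M \<rightarrow>\<^sub>M borel" "g \<in> M \<rightarrow>\<^sub>M borel"
  shows "(\<lambda>\<omega>. dist (f \<omega>) (g \<omega>)) \<in> borel_measurable M"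
  by (rule borel_measurable_LIMSEQ_real[where u = "\<lambda>K \<omega>. dist_trunc K (f \<omega>) (g \<omega>)"])
     (auto intro: dist_trunc_tendsto)

lemma integral_dist_trunc: "(\<integral>b. dist_trunc K a b \<partial>circle_measure) = 1 / 4"
proof -
  have "(\<integral>b. Re (circle_exp k a * cnj (circle_exp k b)) \<partial>circle_measure) = 0" if "k \<noteq> 0" for k
    using that by (simp add: integral_Re_Im_circle_exp)
  then have "(\<integral>b. fourier_coeff k * Re (circle_exp k a * cnj (circle_exp k b)) \<partial>circle_measure) = 0"
    if "k \<in> odd_ints K" for k
    using zero_notin_odd_ints[OF that] by simp
  moreover have "integrable circle_measure (\<lambda>b. fourier_coeff k * Re (circle_exp k a * cnj (circle_exp k b)))" for k
    by (auto intro!: integral_Re_Im_circle_exp Bochner_Integration.integrable_add)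
  ultimately have "(\<integral>b. (\<Sum>k\<in>odd_ints K. fourier_coeff k * Re (circle_exp k a * cnj (circle_exp k b))) \<partial>circle_measure) = 0
    \<and> integrable circle_measure (\<lambda>b. \<Sum>k\<in>odd_ints K. fourier_coeff k * Re (circle_exp k a * cnj (circle_exp k b)))"
    by (intro conjI Bochner_Integration.integrable_sum)
      (subst Bochner_Integration.integral_sum, auto simp only: intro!: sum.neutral)
  then show ?thesis
    unfolding dist_trunc_def using circle_measure.prob_space
    by (subst Bochner_Integration.integral_add) simp_all
qed

lemma integral_dist_circle: "(\<integral>b. dist a b \<partial>circle_measure) = 1 / 4"
proof -
  have "(\<lambda>K. \<integral>b. dist_trunc K a b \<partial>circle_measure) \<longlonglongrightarrow> (\<integral>b. dist a b \<partial>circle_measure)"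
  proof (rule integral_dominated_convergence[where w = "\<lambda>_. 1 / 2"])
    show "AE b in circle_measure. norm (dist_trunc K a b) \<le> 1 / 2" for K
      using dist_trunc_bounds[of K a] by (intro AE_I2) (simp add: abs_of_nonneg)
  qed (auto simp: dist_trunc_tendsto)
  then show ?thesis unfolding integral_dist_trunc by (metis LIMSEQ_const_iff)
qed

section \<open>The sample statistic on the circle\<close>

text \<open>Cauchy-Schwarz with each weight split into two square roots; it moves powers inside
  weighted sums at the price of the total weight.\<close>

lemma sum_weighted_square_le:
  fixes a y :: "'i \<Rightarrow> real"
  assumes "\<And>i. i \<in> I \<Longrightarrow> 0 \<le> a i"
  shows "(\<Sum>i\<in>I. a i * y i) ^ 2 \<le> (\<Sum>i\<in>I. a i) * (\<Sum>i\<in>I. a i * y i ^ 2)"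
proof -
  have "(\<Sum>i\<in>I. a i * y i) ^ 2 = (\<Sum>i\<in>I. sqrt (a i) * (sqrt (a i) * y i)) ^ 2"
    using assms by (intro arg_cong[where f = "\<lambda>x. x ^ 2"] sum.cong) (auto simp: mult.assoc[symmetric])
  also have "\<dots> \<le> (\<Sum>i\<in>I. sqrt (a i) ^ 2) * (\<Sum>i\<in>I. (sqrt (a i) * y i) ^ 2)"
    by (rule Cauchy_Schwarz_ineq_sum)
  also have "\<dots> = (\<Sum>i\<in>I. a i) * (\<Sum>i\<in>I. a i * y i ^ 2)"
    using assms by (intro arg_cong2[where f = "(*)"] sum.cong) (auto simp: power_mult_distrib)
  finally show ?thesis .
qed

lemma power_le_1_plus_power8: "0 \<le> x \<Longrightarrow> j \<le> 8 \<Longrightarrow> x ^ j \<le> 1 + x ^ 8" for x :: real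
proof (cases "x \<le> 1")
  case True
  assume "0 \<le> x"
  then have "x ^ j \<le> 1" using True by (rule power_le_one)
  then show ?thesis using \<open>0 \<le> x\<close> by (smt (verit) zero_le_power)
next
  case False
  assume "j \<le> 8"
  then have "x ^ j \<le> x ^ 8" using False by (intro power_increasing) auto
  then show ?thesis by simp
qed

text \<open>The terms \<open>k\<close> and \<open>- k\<close> of the Fourier expansion contribute equally; the linear part of the
  statistic gives \<open>- c\<^sub>k / 2\<close> each, and the diagonal \<open>l = - k\<close> of the quadratic part \<open>- c\<^sub>k\<^sup>2\<close>.\<close>

definition limit_coeff :: "nat \<Rightarrow> real" where
  "limit_coeff m = - fourier_coeff (2 * int m + 1) - 2 * fourier_coeff (2 * int m + 1) ^ 2"

lemma abs_fourier_coeff_le: "k \<noteq> 0 \<Longrightarrow> \<bar>fourier_coeff k\<bar> \<le> 1 / 9"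
proof -
  assume "k \<noteq> 0"
  then have "\<bar>of_int k :: real\<bar> \<ge> 1" by linarith
  then have "pi * \<bar>of_int k\<bar> \<ge> 3 * 1" using pi_gt3 by (intro mult_mono) auto
  then have "(pi * \<bar>of_int k\<bar>) ^ 2 \<ge> 3 ^ 2" by (intro power_mono) auto
  then have "(pi * of_int k) ^ 2 \<ge> (9 :: real)" by (simp add: power_mult_distrib)
  then have "1 / (pi * of_int k) ^ 2 \<le> 1 / (9 :: real)" by (intro divide_left_mono) auto
  then show ?thesis by (simp add: fourier_coeff_def)
qed

text \<open>With c = - \<open>fourier_coeff\<close>, the coefficient is c (1 - 2c), and 0 <= c <=
  1/9. Nonnegativity is what opens the way to Laplace transforms.\<close>

lemma limit_coeff_nonneg: "0 \<le> limit_coeff m" and limit_coeff_le: "limit_coeff m \<le> - fourier_coeff (2 * int m + 1)"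
proof -
  define c where "c = - fourier_coeff (2 * int m + 1)"
  have c: "0 \<le> c" "c \<le> 1 / 9"
    using fourier_coeff_nonpos[of "2 * int m + 1"] abs_fourier_coeff_le[of "2 * int m + 1"]
    by (auto simp: c_def)
  have "c * c \<le> 1 / 9 * c" using c by (intro mult_right_mono) auto
  then have "2 * c ^ 2 \<le> c" using c by (simp add: power2_eq_square)
  then show "0 \<le> limit_coeff m" "limit_coeff m \<le> - fourier_coeff (2 * int m + 1)"
    by (auto simp: limit_coeff_def c_def)
qed

locale circle_sample = iid_sequence M circle_measure X
  for M :: "'a measure" and X :: "nat \<Rightarrow> 'a \<Rightarrow> circle"
begin

definition z :: "int \<Rightarrow> nat \<Rightarrow> 'a \<Rightarrow> complex" where
  "z k n \<omega> = (\<Sum>i<n. circle_exp k (X i \<omega>)) / of_real (sqrt (real n))"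

text \<open>\<open>V n\<close> is \<open>- n (\<Phi>(X\<^sub>n) - \<Phi>(X))\<close>; the sign makes the limit nonnegative.\<close>

definition V :: "nat \<Rightarrow> 'a \<Rightarrow> real" where
  "V n \<omega> = real n * (1 / 16 - (\<Sum>j<n. (\<Sum>i<n. dist (X i \<omega>) (X j \<omega>)) ^ 2) / real n ^ 3)"

definition V_trunc :: "nat \<Rightarrow> nat \<Rightarrow> 'a \<Rightarrow> real" where
  "V_trunc K n \<omega> = real n * (1 / 16 - (\<Sum>j<n. (\<Sum>i<n. dist_trunc K (X i \<omega>) (X j \<omega>)) ^ 2) / real n ^ 3)"

definition U :: "nat \<Rightarrow> nat \<Rightarrow> 'a \<Rightarrow> real" where
  "U K n \<omega> = (\<Sum>m<K. limit_coeff m * norm (z (2 * int m + 1) n \<omega>) ^ 2)"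

lemma X_borel_measurable [measurable]: "X i \<in> M \<rightarrow>\<^sub>M borel"
  using X_measurable[of i] by (simp cong: measurable_cong_sets)

lemma z_measurable [measurable]: "z k n \<in> borel_measurable M"
  unfolding z_def[abs_def] by measurable

lemma V_measurable [measurable]: "V n \<in> borel_measurable M"
  unfolding V_def[abs_def] by measurable

lemma V_trunc_measurable [measurable]: "V_trunc K n \<in> borel_measurable M"
  unfolding V_trunc_def[abs_def] by measurable

lemma U_measurable [measurable]: "U K n \<in> borel_measurable M"
  unfolding U_def[abs_def] by measurable

lemma U_nonneg: "0 \<le> U K n \<omega>"
  unfolding U_def by (intro sum_nonneg mult_nonneg_nonneg limit_coeff_nonneg) auto

lemma V_trunc_tendsto: "(\<lambda>K. V_trunc K n \<omega>) \<longlonglongrightarrow> V n \<omega>"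
  unfolding V_def V_trunc_def divide_inverse by (intro tendsto_intros dist_trunc_tendsto)

lemma z_minus: "z (- k) n \<omega> = cnj (z k n \<omega>)"
  by (simp add: z_def circle_exp_minus)

lemma z_0: "z 0 n \<omega> = of_real (sqrt (real n))"
proof -
  have "z 0 n \<omega> = of_real (real n / sqrt (real n))" by (simp add: z_def)
  then show ?thesis by (simp only: real_div_sqrt of_nat_0_le_iff)
qed

lemma Re_z: "Re (z k n \<omega>) = nsum (\<lambda>a. Re (circle_exp k a)) n \<omega>"
  and Im_z: "Im (z k n \<omega>) = nsum (\<lambda>a. Im (circle_exp k a)) n \<omega>"
  by (simp_all add: z_def nsum_def Re_divide_of_real Im_divide_of_real)

lemma norm_z_square:
  "norm (z k n \<omega>) ^ 2 = nsum (\<lambda>a. Re (circle_exp k a)) n \<omega> ^ 2 + nsum (\<lambda>a. Im (circle_exp k a)) n \<omega> ^ 2"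
  by (simp add: cmod_power2 Re_z Im_z)

lemma norm_z_le: "norm (z k n \<omega>) \<le> sqrt (real n)"
proof -
  have "norm (\<Sum>i<n. circle_exp k (X i \<omega>)) \<le> (\<Sum>i<n. 1)"
    by (rule order_trans[OF norm_sum]) simp
  then have "norm (z k n \<omega>) \<le> real n / sqrt (real n)"
    by (simp add: z_def norm_divide divide_right_mono)
  then show ?thesis by (simp add: real_div_sqrt)
qed

section \<open>Fourier form of the statistic\<close>

text \<open>Pairing k with -k replaces real parts by products in which the two points separate, so
  that sums over the sample become values of \<open>z\<close>.\<close>

lemma of_real_dist_trunc:
  "complex_of_real (dist_trunc K a b) =
     1 / 4 + (\<Sum>k\<in>odd_ints K. of_real (fourier_coeff k) * circle_exp k a * circle_exp (- k) b)"
proof -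
  have "(\<Sum>k\<in>odd_ints K. of_real (fourier_coeff k) * circle_exp k a * circle_exp (- k) b) =
      (\<Sum>k\<in>odd_ints K. of_real (fourier_coeff k * Re (circle_exp k a * cnj (circle_exp k b))))"
    unfolding sum_odd_ints
  proof (intro sum.cong refl)
    fix m
    define k where "k = 2 * int m + 1"
    define w where "w = circle_exp k a * cnj (circle_exp k b)"
    have "of_real (fourier_coeff k) * circle_exp k a * circle_exp (- k) b +
        of_real (fourier_coeff (- k)) * circle_exp (- k) a * circle_exp (- (- k)) b =
        of_real (fourier_coeff k) * (w + cnj w)"
      by (simp add: w_def circle_exp_minus algebra_simps)
    also have "\<dots> = of_real (fourier_coeff k * Re w) + of_real (fourier_coeff (- k) * Re (cnj w))"
      by (simp add: complex_add_cnj)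
    also have "cnj w = circle_exp (- k) a * cnj (circle_exp (- k) b)"
      by (simp add: w_def circle_exp_minus)
    finally show "of_real (fourier_coeff k) * circle_exp k a * circle_exp (- k) b +
        of_real (fourier_coeff (- k)) * circle_exp (- k) a * circle_exp (- (- k)) b =
        complex_of_real (fourier_coeff k * Re (circle_exp k a * cnj (circle_exp k b))) +
        complex_of_real (fourier_coeff (- k) * Re (circle_exp (- k) a * cnj (circle_exp (- k) b)))"
      unfolding w_def .
  qed
  then show ?thesis by (simp add: dist_trunc_def del: of_real_mult)
qed

text \<open>An exact identity: the square of the constant part cancels 1/16, the linear part gives
  the first sum, and in the quadratic part the sum over j of two characters produces the frequency
  -(k + l). The powers of n leave s^2 s^3 / s^6 = 1/s with s = \<open>sqrt n\<close>.\<close>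

lemma of_real_V_trunc:
  assumes "n \<ge> 1"
  shows "complex_of_real (V_trunc K n \<omega>) =
    (\<Sum>k\<in>odd_ints K. of_real (- fourier_coeff k / 2) * (z k n \<omega> * z (- k) n \<omega>)) -
    (\<Sum>k\<in>odd_ints K. \<Sum>l\<in>odd_ints K. of_real (fourier_coeff k * fourier_coeff l) *
       (z k n \<omega> * z l n \<omega> * z (- (k + l)) n \<omega>)) / of_real (sqrt (real n))"
proof -
  define s where "s = complex_of_real (sqrt (real n))"
  define A where "A = odd_ints K"
  define c where "c k = complex_of_real (fourier_coeff k)" for k
  define e where "e k j = circle_exp k (X j \<omega>)" for k j
  define y where "y k = z k n \<omega>" for k
  have s: "s \<noteq> 0" "s ^ 2 = of_nat n"
    using assms by (simp_all add: s_def flip: of_real_power)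
  have sum_e: "(\<Sum>j<n. e k j) = s * y k" for k
    using s by (simp add: e_def y_def z_def s_def)
  \<comment> \<open>The row sum of the truncated \<open>h\<close> against the j-th sample point,
    with the other sample index already summed.\<close>
  define T where "T j = (\<Sum>k\<in>A. c k * (s * y k) * e (- k) j)" for j
  have D: "of_real (\<Sum>i<n. dist_trunc K (X i \<omega>) (X j \<omega>)) = of_nat n / 4 + T j" for j
  proof -
    have "of_real (\<Sum>i<n. dist_trunc K (X i \<omega>) (X j \<omega>)) = (\<Sum>i<n. 1 / 4 + (\<Sum>k\<in>A. c k * e k i * e (- k) j))"
      by (simp add: of_real_dist_trunc A_def c_def e_def)
    also have "\<dots> = of_nat n / 4 + (\<Sum>k\<in>A. \<Sum>i<n. c k * e k i * e (- k) j)"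
      by (simp add: sum.distrib sum.swap[of _ A])
    also have "(\<Sum>k\<in>A. \<Sum>i<n. c k * e k i * e (- k) j) = T j"
      unfolding T_def sum_e[symmetric] by (simp add: sum_distrib_left sum_distrib_right)
    finally show ?thesis .
  qed
  have T1: "(\<Sum>j<n. T j) = s ^ 2 * (\<Sum>k\<in>A. c k * (y k * y (- k)))"
  proof -
    have "(\<Sum>j<n. T j) = (\<Sum>k\<in>A. c k * (s * y k) * (\<Sum>j<n. e (- k) j))"
      unfolding T_def by (subst sum.swap) (simp add: sum_distrib_left)
    then show ?thesis unfolding sum_e by (simp add: sum_distrib_left power2_eq_square mult_ac)
  qed
  have T2: "(\<Sum>j<n. T j ^ 2) = s ^ 3 * (\<Sum>k\<in>A. \<Sum>l\<in>A. c k * c l * (y k * y l * y (- (k + l))))"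
  proof -
    have "T j ^ 2 = (\<Sum>k\<in>A. \<Sum>l\<in>A. c k * c l * (s * y k) * (s * y l) * e (- (k + l)) j)" for j
    proof -
      have "e (- (k + l)) j = e (- k) j * e (- l) j" for k l
        using circle_exp_add[of "- k" "- l"] by (simp add: e_def)
      then show ?thesis
        unfolding T_def power2_eq_square sum_product by (intro sum.cong refl) (simp only: mult_ac)
    qed
    then have "(\<Sum>j<n. T j ^ 2) = (\<Sum>k\<in>A. \<Sum>l\<in>A. \<Sum>j<n. c k * c l * (s * y k) * (s * y l) * e (- (k + l)) j)"
      by (simp add: sum.swap[of _ A "{..<n}"])
    also have "\<dots> = (\<Sum>k\<in>A. \<Sum>l\<in>A. c k * c l * (s * y k) * (s * y l) * (s * y (- (k + l))))"
      unfolding sum_e[symmetric, of "- (k + l)" for k l] sum_distrib_left[symmetric] by simp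
    also have "\<dots> = s ^ 3 * (\<Sum>k\<in>A. \<Sum>l\<in>A. c k * c l * (y k * y l * y (- (k + l))))"
      unfolding sum_distrib_left by (intro sum.cong refl) (simp add: power3_eq_cube mult_ac)
    finally show ?thesis .
  qed
  define S1 where "S1 = (\<Sum>k\<in>A. c k * (y k * y (- k)))"
  define S2 where "S2 = (\<Sum>k\<in>A. \<Sum>l\<in>A. c k * c l * (y k * y l * y (- (k + l))))"
  have "complex_of_real (V_trunc K n \<omega>) = of_nat n * (1 / 16 - (\<Sum>j<n. (of_nat n / 4 + T j) ^ 2) / of_nat n ^ 3)"
    unfolding V_trunc_def by (simp flip: D)
  also have "(\<Sum>j<n. (of_nat n / 4 + T j) ^ 2) = of_nat n ^ 3 / 16 + of_nat n / 2 * (\<Sum>j<n. T j) + (\<Sum>j<n. T j ^ 2)"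
  proof -
    have "(\<Sum>j<n. (of_nat n / 4 + T j) ^ 2) = (\<Sum>j<n. of_nat n ^ 2 / 16 + of_nat n / 2 * T j + T j ^ 2)"
      by (intro sum.cong refl) (simp add: power2_eq_square algebra_simps)
    then show ?thesis
      by (simp add: sum.distrib sum_distrib_left power3_eq_cube power2_eq_square)
  qed
  also have "of_nat n * (1 / 16 - (of_nat n ^ 3 / 16 + of_nat n / 2 * (\<Sum>j<n. T j) + (\<Sum>j<n. T j ^ 2)) / of_nat n ^ 3) =
      - S1 / 2 - S2 / s"
  proof -
    have "s ^ 2 * (1 / 16 - ((s ^ 2) ^ 3 / 16 + s ^ 2 / 2 * (s ^ 2 * S1) + s ^ 3 * S2) / (s ^ 2) ^ 3) =
        - (s ^ 2 * (s ^ 2 / 2 * (s ^ 2 * S1) / (s ^ 2) ^ 3)) - s ^ 2 * (s ^ 3 * S2 / (s ^ 2) ^ 3)"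
      using s(1) by (simp add: add_divide_distrib right_diff_distrib distrib_left)
    also have "s ^ 2 * (s ^ 2 / 2 * (s ^ 2 * S1) / (s ^ 2) ^ 3) = S1 / 2"
      using s(1) by (simp add: eval_nat_numeral)
    also have "s ^ 2 * (s ^ 3 * S2 / (s ^ 2) ^ 3) = S2 / s"
      using s(1) by (simp add: eval_nat_numeral)
    finally show ?thesis
      unfolding T1 T2 s(2)[symmetric] S1_def[symmetric] S2_def[symmetric] by simp
  qed
  also have "- S1 / 2 = (\<Sum>k\<in>odd_ints K. of_real (- fourier_coeff k / 2) * (z k n \<omega> * z (- k) n \<omega>))"
    by (simp add: S1_def c_def A_def y_def sum_negf[symmetric] sum_divide_distrib)
  also have "S2 = (\<Sum>k\<in>odd_ints K. \<Sum>l\<in>odd_ints K. of_real (fourier_coeff k * fourier_coeff l) *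
       (z k n \<omega> * z l n \<omega> * z (- (k + l)) n \<omega>))"
    by (simp add: S2_def c_def A_def y_def)
  finally show ?thesis unfolding s_def .
qed

lemma z_mult_minus: "z k n \<omega> * z (- k) n \<omega> = of_real (norm (z k n \<omega>) ^ 2)"
  by (simp only: z_minus complex_norm_square)

lemma norm_z_minus [simp]: "norm (z (- k) n \<omega>) = norm (z k n \<omega>)"
  by (simp add: z_minus)

text \<open>A bound uniform in n and K: the trivial estimate \<open>sqrt n\<close> for the third
  factor cancels the denominator, and Cauchy-Schwarz with total weight at most 1/4 turns the double
  sum into a quarter of the diagonal one. Together this is 1/2 + 1/4 < 1.\<close>

lemma abs_V_trunc_le:
  assumes "n \<ge> 1"
  shows "\<bar>V_trunc K n \<omega>\<bar> \<le> (\<Sum>k\<in>odd_ints K. \<bar>fourier_coeff k\<bar> * norm (z k n \<omega>) ^ 2)"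
proof -
  define a where "a k = \<bar>fourier_coeff k\<bar>" for k
  define y where "y k = norm (z k n \<omega>)" for k
  define A where "A = odd_ints K"
  have "\<bar>V_trunc K n \<omega>\<bar> = norm (complex_of_real (V_trunc K n \<omega>))" by simp
  also have "\<dots> \<le> (\<Sum>k\<in>A. a k / 2 * y k ^ 2) + (\<Sum>k\<in>A. \<Sum>l\<in>A. a k * a l * (y k * y l))"
    unfolding of_real_V_trunc[OF assms]
  proof (rule order_trans[OF norm_triangle_ineq4], rule add_mono)
    show "norm (\<Sum>k\<in>odd_ints K. of_real (- fourier_coeff k / 2) * (z k n \<omega> * z (- k) n \<omega>))
        \<le> (\<Sum>k\<in>A. a k / 2 * y k ^ 2)"
      unfolding A_def
      by (rule order_trans[OF norm_sum sum_mono]) (simp add: norm_mult norm_divide a_def y_def power2_eq_square)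
    have "norm (\<Sum>k\<in>odd_ints K. \<Sum>l\<in>odd_ints K. of_real (fourier_coeff k * fourier_coeff l) *
       (z k n \<omega> * z l n \<omega> * z (- (k + l)) n \<omega>)) \<le> (\<Sum>k\<in>A. \<Sum>l\<in>A. a k * a l * (y k * y l) * sqrt (real n))"
      unfolding A_def
    proof (rule order_trans[OF norm_sum sum_mono], rule order_trans[OF norm_sum sum_mono])
      fix k l
      have "norm (z (- (k + l)) n \<omega>) \<le> sqrt (real n)" by (rule norm_z_le)
      then have "a k * a l * (y k * y l) * norm (z (- (k + l)) n \<omega>) \<le> a k * a l * (y k * y l) * sqrt (real n)"
        by (intro mult_left_mono) (auto simp: a_def y_def)
      then show "norm (of_real (fourier_coeff k * fourier_coeff l) *
       (z k n \<omega> * z l n \<omega> * z (- (k + l)) n \<omega>)) \<le> a k * a l * (y k * y l) * sqrt (real n)"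
        unfolding norm_mult norm_of_real abs_mult a_def y_def by (simp only: mult.assoc)
    qed
    then show "norm ((\<Sum>k\<in>odd_ints K. \<Sum>l\<in>odd_ints K. of_real (fourier_coeff k * fourier_coeff l) *
       (z k n \<omega> * z l n \<omega> * z (- (k + l)) n \<omega>)) / of_real (sqrt (real n))) \<le>
       (\<Sum>k\<in>A. \<Sum>l\<in>A. a k * a l * (y k * y l))"
      unfolding sum_distrib_right[symmetric] norm_divide
      using assms by (simp add: divide_le_eq)
  qed
  also have "(\<Sum>k\<in>A. \<Sum>l\<in>A. a k * a l * (y k * y l)) = (\<Sum>k\<in>A. a k * y k) ^ 2"
    unfolding power2_eq_square sum_product by (intro sum.cong refl) (simp add: mult_ac)
  also have "\<dots> \<le> (\<Sum>k\<in>A. a k) * (\<Sum>k\<in>A. a k * y k ^ 2)"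
    by (rule sum_weighted_square_le) (simp add: a_def)
  also have "\<dots> \<le> 1 / 4 * (\<Sum>k\<in>A. a k * y k ^ 2)"
    using sum_abs_fourier_coeff_le[of K]
    by (intro mult_right_mono sum_nonneg) (auto simp: a_def A_def)
  also have "(\<Sum>k\<in>A. a k / 2 * y k ^ 2) + 1 / 4 * (\<Sum>k\<in>A. a k * y k ^ 2) = 3 / 4 * (\<Sum>k\<in>A. a k * y k ^ 2)"
    by (simp add: sum_divide_distrib[symmetric])
  also have "\<dots> \<le> 1 * (\<Sum>k\<in>A. a k * y k ^ 2)"
    by (intro mult_right_mono sum_nonneg) (auto simp: a_def)
  finally show ?thesis by (simp add: a_def y_def A_def)
qed

text \<open>The factor \<open>z 0 n = sqrt n\<close> makes the terms \<open>l = - k\<close> of the double sum survive; all others carry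
  the factor \<open>1 / sqrt n\<close>.\<close>

lemma abs_V_trunc_minus_U_le:
  assumes "n \<ge> 1" "K\<^sub>0 \<le> K"
  shows "\<bar>V_trunc K n \<omega> - U K\<^sub>0 n \<omega>\<bar> \<le>
    (\<Sum>m\<in>{K\<^sub>0..<K}. limit_coeff m * norm (z (2 * int m + 1) n \<omega>) ^ 2) +
    (\<Sum>k\<in>odd_ints K. \<Sum>l\<in>odd_ints K - {- k}. \<bar>fourier_coeff k\<bar> * \<bar>fourier_coeff l\<bar> *
       (norm (z k n \<omega>) * norm (z l n \<omega>) * norm (z (k + l) n \<omega>))) / sqrt (real n)"
proof -
  define A where "A = odd_ints K"
  define g where "g k l = complex_of_real (fourier_coeff k * fourier_coeff l) *
       (z k n \<omega> * z l n \<omega> * z (- (k + l)) n \<omega>)" for k l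
  define s where "s = complex_of_real (sqrt (real n))"
  have s: "s \<noteq> 0" using assms by (simp add: s_def)
  define R where "R = (\<Sum>k\<in>A. \<Sum>l\<in>A - {- k}. g k l)"
  \<comment> \<open>The term \<open>l = - k\<close> contains \<open>z 0 n\<close>, which is
    deterministic and cancels the later division by \<open>s\<close>.\<close>
  have "(\<Sum>l\<in>A. g k l) = of_real (fourier_coeff k ^ 2 * norm (z k n \<omega>) ^ 2) * s + (\<Sum>l\<in>A - {- k}. g k l)"
    if "k \<in> A" for k
  proof -
    have "g k (- k) = of_real (fourier_coeff k ^ 2 * norm (z k n \<omega>) ^ 2) * s"
      unfolding g_def z_mult_minus by (simp add: z_0 s_def power2_eq_square)
    then show ?thesis
      using that uminus_odd_ints[of k K] by (subst sum.remove[of _ "- k"]) (auto simp: A_def)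
  qed
  then have "(\<Sum>k\<in>A. \<Sum>l\<in>A. g k l) = (\<Sum>k\<in>A. of_real (fourier_coeff k ^ 2 * norm (z k n \<omega>) ^ 2) * s) + R"
    by (simp add: R_def sum.distrib)
  also have "\<dots> = of_real (\<Sum>k\<in>A. fourier_coeff k ^ 2 * norm (z k n \<omega>) ^ 2) * s + R"
    by (simp only: sum_distrib_right of_real_sum)
  finally have "(\<Sum>k\<in>A. \<Sum>l\<in>A. g k l) / s =
      of_real (\<Sum>k\<in>A. fourier_coeff k ^ 2 * norm (z k n \<omega>) ^ 2) + R / s"
    using s by (simp add: add_divide_distrib)
  moreover have "complex_of_real (V_trunc K n \<omega>) =
      of_real (\<Sum>k\<in>A. - fourier_coeff k / 2 * norm (z k n \<omega>) ^ 2) - (\<Sum>k\<in>A. \<Sum>l\<in>A. g k l) / s"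
    unfolding of_real_V_trunc[OF assms(1)] z_mult_minus g_def A_def s_def
    by (simp only: of_real_sum of_real_mult)
  ultimately have "complex_of_real (V_trunc K n \<omega>) =
      of_real (\<Sum>k\<in>A. - fourier_coeff k / 2 * norm (z k n \<omega>) ^ 2) -
      of_real (\<Sum>k\<in>A. fourier_coeff k ^ 2 * norm (z k n \<omega>) ^ 2) - R / s"
    by (simp only: diff_diff_eq)
  \<comment> \<open>Grouping k with -k: the halves of the linear part add up to -c, the diagonal of
    the quadratic part removes 2 c^2, and the difference is \<open>limit_coeff\<close>.\<close>
  also have "(\<Sum>k\<in>A. - fourier_coeff k / 2 * norm (z k n \<omega>) ^ 2) =
      (\<Sum>k\<in>A. fourier_coeff k ^ 2 * norm (z k n \<omega>) ^ 2) + U K n \<omega>"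
    unfolding A_def sum_odd_ints U_def sum.distrib[symmetric]
    by (intro sum.cong refl, simp only: fourier_coeff_minus norm_z_minus limit_coeff_def) (simp add: algebra_simps)
  finally have "complex_of_real (V_trunc K n \<omega> - U K\<^sub>0 n \<omega>) = of_real (U K n \<omega> - U K\<^sub>0 n \<omega>) - R / s"
    by simp
  then have "\<bar>V_trunc K n \<omega> - U K\<^sub>0 n \<omega>\<bar> = norm (of_real (U K n \<omega> - U K\<^sub>0 n \<omega>) - R / s)"
    by (metis norm_of_real)
  also have "\<dots> \<le> \<bar>U K n \<omega> - U K\<^sub>0 n \<omega>\<bar> + norm (R / s)"
    by (rule order_trans[OF norm_triangle_ineq4]) (simp del: of_real_diff)
  also have "U K n \<omega> - U K\<^sub>0 n \<omega> = (\<Sum>m\<in>{K\<^sub>0..<K}. limit_coeff m * norm (z (2 * int m + 1) n \<omega>) ^ 2)"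
    unfolding U_def using sum_diff_nat_ivl[of 0 K\<^sub>0 K "\<lambda>m. limit_coeff m * norm (z (2 * int m + 1) n \<omega>) ^ 2"] assms(2)
    by (simp add: atLeast0LessThan)
  also have "\<bar>\<dots>\<bar> = \<dots>"
    by (intro abs_of_nonneg sum_nonneg mult_nonneg_nonneg limit_coeff_nonneg) auto
  also have "norm (R / s) \<le> (\<Sum>k\<in>odd_ints K. \<Sum>l\<in>odd_ints K - {- k}. \<bar>fourier_coeff k\<bar> * \<bar>fourier_coeff l\<bar> *
       (norm (z k n \<omega>) * norm (z l n \<omega>) * norm (z (k + l) n \<omega>))) / sqrt (real n)"
  proof -
    have "norm R \<le> (\<Sum>k\<in>A. \<Sum>l\<in>A - {- k}. norm (g k l))"
      unfolding R_def by (rule order_trans[OF norm_sum sum_mono], rule norm_sum)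
    also have "\<dots> = (\<Sum>k\<in>A. \<Sum>l\<in>A - {- k}. \<bar>fourier_coeff k\<bar> * \<bar>fourier_coeff l\<bar> *
       (norm (z k n \<omega>) * norm (z l n \<omega>) * norm (z (k + l) n \<omega>)))"
      by (intro sum.cong refl) (simp only: g_def norm_mult norm_of_real abs_mult norm_z_minus)
    finally show ?thesis by (simp add: norm_divide s_def A_def divide_right_mono)
  qed
  finally show ?thesis by simp
qed

section \<open>Moment bounds and error estimates\<close>

text \<open>|z|^8 is at most 8 times the sum of the eighth powers of its real and imaginary parts,
  each of mean at most 2 * 8! * exp(1/2).\<close>

definition B8 :: real where "B8 = 32 * fact 8 * exp (1 / 2)"

lemma B8_nonneg: "0 \<le> B8" by (simp add: B8_def)

lemma norm_z_power8:
  assumes "k \<noteq> 0"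
  shows "expectation (\<lambda>\<omega>. norm (z k n \<omega>) ^ 8) \<le> B8" "integrable M (\<lambda>\<omega>. norm (z k n \<omega>) ^ 8)"
proof -
  define C where "C = nsum (\<lambda>a. Re (circle_exp k a)) n"
  define S where "S = nsum (\<lambda>a. Im (circle_exp k a)) n"
  have le: "\<bar>Re (circle_exp k a)\<bar> \<le> 1" "\<bar>Im (circle_exp k a)\<bar> \<le> 1" for a
    using abs_Re_le_cmod[of "circle_exp k a"] abs_Im_le_cmod[of "circle_exp k a"] by simp_all
  have C: "expectation (\<lambda>\<omega>. C \<omega> ^ 8) \<le> 2 * fact 8 * exp (1 / 2)" "integrable M (\<lambda>\<omega>. C \<omega> ^ 8)"
    unfolding C_def by (intro nsum_power8; use assms le integral_Re_Im_circle_exp in simp)+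
  have S: "expectation (\<lambda>\<omega>. S \<omega> ^ 8) \<le> 2 * fact 8 * exp (1 / 2)" "integrable M (\<lambda>\<omega>. S \<omega> ^ 8)"
    unfolding S_def by (intro nsum_power8; use assms le integral_Re_Im_circle_exp in simp)+
  have sq: "(x + y) ^ 2 \<le> 2 * (x ^ 2 + y ^ 2)" for x y :: real
    using zero_le_power2[of "x - y"] by (simp add: power2_sum power2_diff)
  have pow: "norm (z k n \<omega>) ^ 8 \<le> 8 * (C \<omega> ^ 8 + S \<omega> ^ 8)" for \<omega>
  proof -
    have "norm (z k n \<omega>) ^ 8 = ((norm (z k n \<omega>) ^ 2) ^ 2) ^ 2" by (simp flip: power_mult)
    also have "\<dots> = ((C \<omega> ^ 2 + S \<omega> ^ 2) ^ 2) ^ 2" unfolding norm_z_square C_def S_def ..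
    also have "\<dots> \<le> (2 * ((C \<omega> ^ 2) ^ 2 + (S \<omega> ^ 2) ^ 2)) ^ 2"
      by (intro power_mono sq) simp
    also have "\<dots> = 4 * ((C \<omega> ^ 2) ^ 2 + (S \<omega> ^ 2) ^ 2) ^ 2" by (subst power_mult_distrib) simp
    also have "\<dots> \<le> 4 * (2 * (((C \<omega> ^ 2) ^ 2) ^ 2 + ((S \<omega> ^ 2) ^ 2) ^ 2))"
      by (intro mult_left_mono sq) simp
    finally show ?thesis by (simp flip: power_mult)
  qed
  show i: "integrable M (\<lambda>\<omega>. norm (z k n \<omega>) ^ 8)"
    by (rule Bochner_Integration.integrable_bound[where f = "\<lambda>\<omega>. 8 * (C \<omega> ^ 8 + S \<omega> ^ 8)"])
      (use C(2) S(2) order_trans[OF pow abs_ge_self] in auto)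
  have "expectation (\<lambda>\<omega>. norm (z k n \<omega>) ^ 8) \<le> expectation (\<lambda>\<omega>. 8 * (C \<omega> ^ 8 + S \<omega> ^ 8))"
    by (intro integral_mono i pow) (use C(2) S(2) in auto)
  also have "\<dots> = 8 * (expectation (\<lambda>\<omega>. C \<omega> ^ 8) + expectation (\<lambda>\<omega>. S \<omega> ^ 8))"
    using C(2) S(2) by simp
  also have "\<dots> \<le> 8 * (2 * fact 8 * exp (1 / 2) + 2 * fact 8 * exp (1 / 2))"
    using C(1) S(1) by (intro mult_left_mono add_mono) auto
  finally show "expectation (\<lambda>\<omega>. norm (z k n \<omega>) ^ 8) \<le> B8" by (simp add: B8_def)
qed

lemma norm_z_square_moment:
  assumes "k \<noteq> 0"
  shows "expectation (\<lambda>\<omega>. norm (z k n \<omega>) ^ 2) \<le> 1 + B8" "integrable M (\<lambda>\<omega>. norm (z k n \<omega>) ^ 2)"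
proof -
  note i8 = norm_z_power8[OF assms, of n]
  have le: "norm (z k n \<omega>) ^ 2 \<le> 1 + norm (z k n \<omega>) ^ 8" for \<omega>
    by (rule power_le_1_plus_power8) auto
  show i: "integrable M (\<lambda>\<omega>. norm (z k n \<omega>) ^ 2)"
    by (rule Bochner_Integration.integrable_bound[where f = "\<lambda>\<omega>. 1 + norm (z k n \<omega>) ^ 8"])
      (use i8 order_trans[OF le abs_ge_self] in auto)
  have "expectation (\<lambda>\<omega>. norm (z k n \<omega>) ^ 2) \<le> expectation (\<lambda>\<omega>. 1 + norm (z k n \<omega>) ^ 8)"
    by (intro integral_mono i le) (use i8 in auto)
  then show "expectation (\<lambda>\<omega>. norm (z k n \<omega>) ^ 2) \<le> 1 + B8"
    using i8 by (simp add: prob_space)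
qed

lemma norm_z_triple_moment:
  assumes "k \<noteq> 0" "l \<noteq> 0" "p \<noteq> 0"
  shows "expectation (\<lambda>\<omega>. norm (z k n \<omega>) * norm (z l n \<omega>) * norm (z p n \<omega>)) \<le> 1 + 3 * B8"
    "integrable M (\<lambda>\<omega>. norm (z k n \<omega>) * norm (z l n \<omega>) * norm (z p n \<omega>))"
proof -
  note i8 = norm_z_power8[OF assms(1), of n] norm_z_power8[OF assms(2), of n] norm_z_power8[OF assms(3), of n]
  have ineq: "x * y * w \<le> 1 + (x ^ 8 + y ^ 8 + w ^ 8)" if "0 \<le> x" "0 \<le> y" "0 \<le> w" for x y w :: real
  proof -
    define m where "m = max x (max y w)"
    have m: "0 \<le> m" "x \<le> m" "y \<le> m" "w \<le> m" using that by (auto simp: m_def)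
    have "x * y * w \<le> m * m * m" using m that by (intro mult_mono) auto
    also have "\<dots> \<le> 1 + m ^ 8" using power_le_1_plus_power8[OF m(1), of 3] by (simp add: power3_eq_cube)
    also have "m ^ 8 \<le> x ^ 8 + y ^ 8 + w ^ 8"
      using that by (auto simp: m_def max_def)
    finally show ?thesis by simp
  qed
  have le: "norm (z k n \<omega>) * norm (z l n \<omega>) * norm (z p n \<omega>) \<le>
      1 + (norm (z k n \<omega>) ^ 8 + norm (z l n \<omega>) ^ 8 + norm (z p n \<omega>) ^ 8)" for \<omega>
    by (rule ineq) auto
  show i: "integrable M (\<lambda>\<omega>. norm (z k n \<omega>) * norm (z l n \<omega>) * norm (z p n \<omega>))"
    by (rule Bochner_Integration.integrable_bound[where
          f = "\<lambda>\<omega>. 1 + (norm (z k n \<omega>) ^ 8 + norm (z l n \<omega>) ^ 8 + norm (z p n \<omega>) ^ 8)"])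
      (use i8 order_trans[OF le abs_ge_self] in \<open>auto simp: abs_mult\<close>)
  have "expectation (\<lambda>\<omega>. norm (z k n \<omega>) * norm (z l n \<omega>) * norm (z p n \<omega>)) \<le>
     expectation (\<lambda>\<omega>. 1 + (norm (z k n \<omega>) ^ 8 + norm (z l n \<omega>) ^ 8 + norm (z p n \<omega>) ^ 8))"
    by (intro integral_mono i le) (use i8 in auto)
  then show "expectation (\<lambda>\<omega>. norm (z k n \<omega>) * norm (z l n \<omega>) * norm (z p n \<omega>)) \<le> 1 + 3 * B8"
    using i8 by (simp add: prob_space)
qed

end

lemma limit_coeff_summable: "summable limit_coeff"
proof (rule summable_comparison_test')
  show "summable (\<lambda>m. - fourier_coeff (2 * int m + 1))" using fourier_coeff_sums by (rule sums_summable)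
  show "norm (limit_coeff m) \<le> - fourier_coeff (2 * int m + 1)" for m
    using limit_coeff_nonneg[of m] limit_coeff_le[of m] by simp
qed

context circle_sample
begin

text \<open>Crude in n but independent of K: the domination for letting K tend to infinity at fixed
  n.\<close>

lemma abs_V_trunc_le_n: "\<bar>V_trunc K n \<omega>\<bar> \<le> real n"
proof (cases "n = 0")
  case False
  have "(\<Sum>i<n. dist_trunc K (X i \<omega>) (X j \<omega>)) ^ 2 \<le> (real n * (1 / 2)) ^ 2" for j
  proof (rule power_mono)
    show "(\<Sum>i<n. dist_trunc K (X i \<omega>) (X j \<omega>)) \<le> real n * (1 / 2)"
      using sum_bounded_above[of "{..<n}" "\<lambda>i. dist_trunc K (X i \<omega>) (X j \<omega>)" "1 / 2"] dist_trunc_bounds(2) by simp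
  qed (intro sum_nonneg dist_trunc_bounds)
  then have "(\<Sum>j<n. (\<Sum>i<n. dist_trunc K (X i \<omega>) (X j \<omega>)) ^ 2) \<le> real n * (real n * (1 / 2)) ^ 2"
    using sum_bounded_above[of "{..<n}" "\<lambda>j. (\<Sum>i<n. dist_trunc K (X i \<omega>) (X j \<omega>)) ^ 2"] by simp
  also have "\<dots> = 1 / 4 * real n ^ 3" by (simp add: power2_eq_square power3_eq_cube)
  finally have "(\<Sum>j<n. (\<Sum>i<n. dist_trunc K (X i \<omega>) (X j \<omega>)) ^ 2) / real n ^ 3 \<le> 1 / 4"
    using False by (simp add: divide_le_eq)
  moreover have "0 \<le> (\<Sum>j<n. (\<Sum>i<n. dist_trunc K (X i \<omega>) (X j \<omega>)) ^ 2) / real n ^ 3"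
    by (intro divide_nonneg_nonneg sum_nonneg) auto
  ultimately have "\<bar>1 / 16 - (\<Sum>j<n. (\<Sum>i<n. dist_trunc K (X i \<omega>) (X j \<omega>)) ^ 2) / real n ^ 3\<bar> \<le> 1"
    by linarith
  then have "real n * \<bar>1 / 16 - (\<Sum>j<n. (\<Sum>i<n. dist_trunc K (X i \<omega>) (X j \<omega>)) ^ 2) / real n ^ 3\<bar> \<le> real n * 1"
    by (rule mult_left_mono) simp
  then show ?thesis unfolding V_trunc_def abs_mult by simp
qed (simp add: V_trunc_def)

lemma abs_V_le_n: "\<bar>V n \<omega>\<bar> \<le> real n"
  by (rule LIMSEQ_le_const2[OF tendsto_rabs[OF V_trunc_tendsto]]) (blast intro: abs_V_trunc_le_n)

lemma integrable_V: "integrable M (V n)" "integrable M (\<lambda>\<omega>. V n \<omega> ^ j)"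
proof -
  show "integrable M (V n)"
    by (rule integrable_const_bound[where B = "real n"]) (use abs_V_le_n in auto)
  show "integrable M (\<lambda>\<omega>. V n \<omega> ^ j)"
    by (rule integrable_const_bound[where B = "real n ^ j"])
       (use power_mono[OF abs_V_le_n abs_ge_zero] in \<open>auto simp: power_abs\<close>)
qed

lemma odd_int_nonzero: "2 * int m + 1 \<noteq> 0"
  by presburger

lemma integrable_U: "integrable M (U K n)"
  unfolding U_def[abs_def]
  by (intro Bochner_Integration.integrable_sum integrable_mult_right norm_z_square_moment odd_int_nonzero)

lemma expectation_U_le: "expectation (U K n) \<le> 1 + B8"
proof -
  have "expectation (U K n) = (\<Sum>m<K. limit_coeff m * expectation (\<lambda>\<omega>. norm (z (2 * int m + 1) n \<omega>) ^ 2))"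
    unfolding U_def[abs_def] using norm_z_square_moment(2)[OF odd_int_nonzero]
    by (subst Bochner_Integration.integral_sum) auto
  also have "\<dots> \<le> (\<Sum>m<K. - fourier_coeff (2 * int m + 1) * (1 + B8))"
    by (intro sum_mono mult_mono limit_coeff_le norm_z_square_moment odd_int_nonzero) (auto simp: fourier_coeff_nonpos)
  also have "\<dots> \<le> 1 / 8 * (1 + B8)"
    unfolding sum_distrib_right[symmetric] using sum_fourier_coeff_le B8_nonneg by (intro mult_right_mono) auto
  also have "\<dots> \<le> 1 + B8" using B8_nonneg by simp
  finally show ?thesis .
qed

text \<open>Two applications of weighted Cauchy-Schwarz bound the fourth power of the sum of a_k
  |z_k|^2 by s^3 times the sum of a_k |z_k|^8, where s <= 1/4 is the total weight. The eighth
  moments are bounded uniformly, and K then tends to infinity.\<close>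

lemma expectation_V_power4_le: "expectation (\<lambda>\<omega>. V n \<omega> ^ 4) \<le> B8"
proof (cases "n = 0")
  case True
  then show ?thesis using B8_nonneg by (simp add: V_def)
next
  case False
  then have n: "n \<ge> 1" by simp
  have V4: "V_trunc K n \<omega> ^ 4 \<le> real n ^ 4" for K \<omega>
    using power_mono[OF abs_V_trunc_le_n abs_ge_zero, of K n \<omega> 4] by simp
  have "expectation (\<lambda>\<omega>. V_trunc K n \<omega> ^ 4) \<le> B8" for K
  proof -
    define a where "a k = \<bar>fourier_coeff k\<bar>" for k
    have a: "0 \<le> a k" for k by (simp add: a_def)
    define A where "A = odd_ints K"
    define s where "s = (\<Sum>k\<in>A. a k)"
    have s: "0 \<le> s" "s \<le> 1 / 4"
      using sum_abs_fourier_coeff_le[of K] by (auto simp: s_def a_def A_def intro: sum_nonneg)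
    have pow: "V_trunc K n \<omega> ^ 4 \<le> s ^ 3 * (\<Sum>k\<in>A. a k * norm (z k n \<omega>) ^ 8)" for \<omega>
    proof -
      define y where "y k = norm (z k n \<omega>)" for k
      have "V_trunc K n \<omega> ^ 4 = (\<bar>V_trunc K n \<omega>\<bar> ^ 2) ^ 2" by (simp flip: power_mult)
      also have "\<dots> \<le> ((\<Sum>k\<in>A. a k * y k ^ 2) ^ 2) ^ 2"
        using abs_V_trunc_le[OF n, of K \<omega>] by (intro power_mono) (auto simp: a_def A_def y_def)
      also have "\<dots> \<le> (s * (\<Sum>k\<in>A. a k * (y k ^ 2) ^ 2)) ^ 2"
        unfolding s_def by (intro power_mono sum_weighted_square_le a) simp
      also have "\<dots> = s ^ 2 * (\<Sum>k\<in>A. a k * (y k ^ 2) ^ 2) ^ 2" by (rule power_mult_distrib)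
      also have "\<dots> \<le> s ^ 2 * (s * (\<Sum>k\<in>A. a k * ((y k ^ 2) ^ 2) ^ 2))"
        unfolding s_def by (intro mult_left_mono sum_weighted_square_le a) simp
      also have "\<dots> = s ^ 3 * (\<Sum>k\<in>A. a k * y k ^ 8)"
        by (simp add: power2_eq_square[of s] power3_eq_cube flip: power_mult)
      finally show ?thesis unfolding y_def .
    qed
    have nz: "k \<in> A \<Longrightarrow> k \<noteq> 0" for k by (simp add: A_def zero_notin_odd_ints)
    have "expectation (\<lambda>\<omega>. V_trunc K n \<omega> ^ 4) \<le> expectation (\<lambda>\<omega>. s ^ 3 * (\<Sum>k\<in>A. a k * norm (z k n \<omega>) ^ 8))"
    proof (rule integral_mono)
      show "integrable M (\<lambda>\<omega>. V_trunc K n \<omega> ^ 4)"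
        by (rule integrable_const_bound[where B = "real n ^ 4"]) (use V4 in auto)
    qed (use nz pow norm_z_power8 in auto)
    also have "\<dots> = s ^ 3 * (\<Sum>k\<in>A. a k * expectation (\<lambda>\<omega>. norm (z k n \<omega>) ^ 8))"
      using nz norm_z_power8 by (simp add: Bochner_Integration.integral_sum)
    also have "\<dots> \<le> s ^ 3 * (\<Sum>k\<in>A. a k * B8)"
      using nz norm_z_power8 s a by (intro mult_left_mono sum_mono) auto
    also have "\<dots> = s ^ 4 * B8" by (simp add: s_def sum_distrib_right[symmetric] power_numeral_reduce)
    also have "\<dots> \<le> 1 * B8"
      using s B8_nonneg power_le_one[of s 4] by (intro mult_right_mono) auto
    finally show ?thesis by simp
  qed
  moreover have "(\<lambda>K. expectation (\<lambda>\<omega>. V_trunc K n \<omega> ^ 4)) \<longlonglongrightarrow> expectation (\<lambda>\<omega>. V n \<omega> ^ 4)"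
  proof (rule integral_dominated_convergence[where w = "\<lambda>_. real n ^ 4"])
    show "AE \<omega> in M. (\<lambda>K. V_trunc K n \<omega> ^ 4) \<longlonglongrightarrow> V n \<omega> ^ 4"
      by (intro AE_I2 tendsto_power V_trunc_tendsto)
    show "AE \<omega> in M. norm (V_trunc K n \<omega> ^ 4) \<le> real n ^ 4" for K
      using V4 by simp
  qed auto
  ultimately show ?thesis by (intro LIMSEQ_le_const2) auto
qed

text \<open>Two errors remain once the auxiliary level K has gone to infinity: the frequencies
  beyond \<open>K\<^sub>0\<close>, small uniformly in n, and the off-diagonal triple products, of
  order n^(-1/2) uniformly in \<open>K\<^sub>0\<close>.\<close>

lemma expectation_V_minus_U_le:
  assumes "n \<ge> 1"
  shows "expectation (\<lambda>\<omega>. \<bar>V n \<omega> - U K\<^sub>0 n \<omega>\<bar>) \<le>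
    (1 + B8) * (1 / 8 - (\<Sum>m<K\<^sub>0. - fourier_coeff (2 * int m + 1))) + (1 + 3 * B8) / sqrt (real n)"
proof -
  have bound: "expectation (\<lambda>\<omega>. \<bar>V_trunc K n \<omega> - U K\<^sub>0 n \<omega>\<bar>) \<le>
    (1 + B8) * (1 / 8 - (\<Sum>m<K\<^sub>0. - fourier_coeff (2 * int m + 1))) + (1 + 3 * B8) / sqrt (real n)"
    if K: "K\<^sub>0 \<le> K" for K
  proof -
    define A where "A = odd_ints K"
    define a where "a k = \<bar>fourier_coeff k\<bar>" for k
    define F where "F \<omega> = (\<Sum>m\<in>{K\<^sub>0..<K}. limit_coeff m * norm (z (2 * int m + 1) n \<omega>) ^ 2)" for \<omega>
    define G where "G \<omega> = (\<Sum>k\<in>A. \<Sum>l\<in>A - {- k}. a k * a l *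
       (norm (z k n \<omega>) * norm (z l n \<omega>) * norm (z (k + l) n \<omega>)))" for \<omega>
    \<comment> \<open>Excluding \<open>l = - k\<close> keeps the third frequency nonzero. Otherwise
      its moments would grow with n and absorb the factor n^(-1/2).\<close>
    have nz: "k \<noteq> 0 \<and> l \<noteq> 0 \<and> k + l \<noteq> 0" if "k \<in> A" "l \<in> A - {- k}" for k l
      using that zero_notin_odd_ints by (auto simp: A_def)
    have iF: "integrable M F"
      unfolding F_def using norm_z_square_moment(2)[OF odd_int_nonzero] by auto
    have int: "integrable M (\<lambda>\<omega>. a k * a l * (norm (z k n \<omega>) * norm (z l n \<omega>) * norm (z (k + l) n \<omega>)))"
      if "k \<in> A" "l \<in> A - {- k}" for k l
      using nz[OF that] by (intro integrable_mult_right norm_z_triple_moment) auto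
    have iG: "integrable M G"
      unfolding G_def by (intro Bochner_Integration.integrable_sum int)
    have "expectation (\<lambda>\<omega>. \<bar>V_trunc K n \<omega> - U K\<^sub>0 n \<omega>\<bar>) \<le> expectation (\<lambda>\<omega>. F \<omega> + G \<omega> / sqrt (real n))"
    proof (rule integral_mono)
      have "integrable M (V_trunc K n)"
        by (rule integrable_const_bound[where B = "real n"]) (use abs_V_trunc_le_n in auto)
      then show "integrable M (\<lambda>\<omega>. \<bar>V_trunc K n \<omega> - U K\<^sub>0 n \<omega>\<bar>)" using integrable_U by auto
      show "integrable M (\<lambda>\<omega>. F \<omega> + G \<omega> / sqrt (real n))" using iF iG by auto
      show "\<bar>V_trunc K n \<omega> - U K\<^sub>0 n \<omega>\<bar> \<le> F \<omega> + G \<omega> / sqrt (real n)" for \<omega>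
        unfolding F_def G_def a_def A_def by (rule abs_V_trunc_minus_U_le[OF assms K])
    qed
    also have "\<dots> = expectation F + expectation G / sqrt (real n)" using iF iG by simp
    also have "expectation F \<le> (1 + B8) * (1 / 8 - (\<Sum>m<K\<^sub>0. - fourier_coeff (2 * int m + 1)))"
    proof -
      have "expectation F = (\<Sum>m\<in>{K\<^sub>0..<K}. limit_coeff m * expectation (\<lambda>\<omega>. norm (z (2 * int m + 1) n \<omega>) ^ 2))"
        unfolding F_def using norm_z_square_moment(2)[OF odd_int_nonzero] by (subst Bochner_Integration.integral_sum) auto
      also have "\<dots> \<le> (\<Sum>m\<in>{K\<^sub>0..<K}. - fourier_coeff (2 * int m + 1) * (1 + B8))"
        by (intro sum_mono mult_mono limit_coeff_le norm_z_square_moment odd_int_nonzero) (auto simp: fourier_coeff_nonpos)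
      also have "\<dots> = (1 + B8) * ((\<Sum>m<K. - fourier_coeff (2 * int m + 1)) - (\<Sum>m<K\<^sub>0. - fourier_coeff (2 * int m + 1)))"
      proof -
        have "(\<Sum>m<K. - fourier_coeff (2 * int m + 1)) - (\<Sum>m<K\<^sub>0. - fourier_coeff (2 * int m + 1)) =
            (\<Sum>m\<in>{K\<^sub>0..<K}. - fourier_coeff (2 * int m + 1))"
          using sum_diff_nat_ivl[of 0 K\<^sub>0 K "\<lambda>m. - fourier_coeff (2 * int m + 1)"] K by (simp add: atLeast0LessThan)
        then show ?thesis by (simp only: sum_distrib_right[symmetric]) (simp only: mult.commute)
      qed
      also have "\<dots> \<le> (1 + B8) * (1 / 8 - (\<Sum>m<K\<^sub>0. - fourier_coeff (2 * int m + 1)))"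
        using sum_fourier_coeff_le[of K] B8_nonneg by (intro mult_left_mono diff_right_mono) auto
      finally show ?thesis .
    qed
    also have "expectation G / sqrt (real n) \<le> (1 + 3 * B8) / sqrt (real n)"
    proof (rule divide_right_mono)
      have "expectation G = (\<Sum>k\<in>A. \<Sum>l\<in>A - {- k}. a k * a l *
          expectation (\<lambda>\<omega>. norm (z k n \<omega>) * norm (z l n \<omega>) * norm (z (k + l) n \<omega>)))"
      proof -
        have "expectation G = (\<Sum>k\<in>A. expectation (\<lambda>\<omega>. \<Sum>l\<in>A - {- k}. a k * a l *
            (norm (z k n \<omega>) * norm (z l n \<omega>) * norm (z (k + l) n \<omega>))))"
          unfolding G_def by (intro Bochner_Integration.integral_sum Bochner_Integration.integrable_sum int)
        also have "\<dots> = (\<Sum>k\<in>A. \<Sum>l\<in>A - {- k}. expectation (\<lambda>\<omega>. a k * a l *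
            (norm (z k n \<omega>) * norm (z l n \<omega>) * norm (z (k + l) n \<omega>))))"
          by (intro sum.cong refl Bochner_Integration.integral_sum int)
        finally show ?thesis by simp
      qed
      also have "\<dots> \<le> (\<Sum>k\<in>A. \<Sum>l\<in>A - {- k}. a k * a l * (1 + 3 * B8))"
        by (intro sum_mono mult_left_mono norm_z_triple_moment) (use nz in \<open>auto simp: a_def\<close>)
      also have "\<dots> \<le> (\<Sum>k\<in>A. \<Sum>l\<in>A. a k * a l * (1 + 3 * B8))"
        using B8_nonneg by (intro sum_mono sum_mono2) (auto simp: A_def a_def)
      also have "\<dots> = (\<Sum>k\<in>A. a k) * (\<Sum>l\<in>A. a l) * (1 + 3 * B8)"
        unfolding sum_product by (simp only: sum_distrib_right)
      also have "\<dots> \<le> 1 * (1 + 3 * B8)"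
      proof (rule mult_right_mono)
        have s: "0 \<le> (\<Sum>k\<in>A. a k)" "(\<Sum>k\<in>A. a k) \<le> 1"
          using sum_abs_fourier_coeff_le[of K] by (auto simp: a_def A_def intro!: sum_nonneg)
        then show "(\<Sum>k\<in>A. a k) * (\<Sum>l\<in>A. a l) \<le> 1" by (intro mult_le_one)
      qed (use B8_nonneg in simp)
      finally show "expectation G \<le> 1 + 3 * B8" by simp
    qed simp
    finally show ?thesis by simp
  qed
  have "(\<lambda>K. expectation (\<lambda>\<omega>. \<bar>V_trunc K n \<omega> - U K\<^sub>0 n \<omega>\<bar>)) \<longlonglongrightarrow> expectation (\<lambda>\<omega>. \<bar>V n \<omega> - U K\<^sub>0 n \<omega>\<bar>)"
  proof (rule integral_dominated_convergence[where w = "\<lambda>\<omega>. real n + U K\<^sub>0 n \<omega>"])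
    show "AE \<omega> in M. (\<lambda>K. \<bar>V_trunc K n \<omega> - U K\<^sub>0 n \<omega>\<bar>) \<longlonglongrightarrow> \<bar>V n \<omega> - U K\<^sub>0 n \<omega>\<bar>"
      by (intro AE_I2 tendsto_intros V_trunc_tendsto)
    show "AE \<omega> in M. norm \<bar>V_trunc K n \<omega> - U K\<^sub>0 n \<omega>\<bar> \<le> real n + U K\<^sub>0 n \<omega>" for K
    proof (rule AE_I2)
      fix \<omega>
      show "norm \<bar>V_trunc K n \<omega> - U K\<^sub>0 n \<omega>\<bar> \<le> real n + U K\<^sub>0 n \<omega>"
        using abs_V_trunc_le_n[of K n \<omega>] U_nonneg[of K\<^sub>0 n \<omega>] unfolding real_norm_def by linarith
    qed
  qed (use integrable_U in auto)
  then show ?thesis by (rule LIMSEQ_le_const2) (use bound in blast)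
qed

section \<open>Limit law of the statistic\<close>

text \<open>|z_k|^2 is half the sum of two squares that become independent standard Gaussian
  squares, which is a standard exponential variable. The two factors 1/sqrt(1 + s b) for real and
  imaginary part multiply to 1/(1 + s b).\<close>

lemma laplace_U_tendsto:
  assumes "0 \<le> s"
  shows "(\<lambda>n. expectation (\<lambda>\<omega>. exp (- s * U K n \<omega>))) \<longlonglongrightarrow> (\<Prod>m<K. 1 / (1 + s * limit_coeff m))"
proof -
  define J where "J = {..<K} \<times> (UNIV :: bool set)"
  define r :: "nat \<times> bool \<Rightarrow> circle \<Rightarrow> real" where
    "r = (\<lambda>(m, h) a. sqrt 2 * (if h then Re (circle_exp (2 * int m + 1) a) else Im (circle_exp (2 * int m + 1) a)))"
  \<comment> \<open>The factor 1/2 compensates the normalisation of \<open>r\<close> by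
    \<open>sqrt 2\<close>.\<close>
  define \<beta> :: "nat \<times> bool \<Rightarrow> real" where "\<beta> = (\<lambda>(m, h). s * limit_coeff m / 2)"
  have fin: "finite J" by (simp add: J_def)
  have meas: "r j \<in> borel_measurable circle_measure" for j
    by (cases j) (auto simp: r_def)
  have le: "\<bar>r j a\<bar> \<le> sqrt 2" for j a
    using abs_Re_le_cmod[of "circle_exp k a" for k] abs_Im_le_cmod[of "circle_exp k a" for k]
    by (cases j) (simp add: r_def abs_mult)
  \<comment> \<open>All frequencies are positive, so the contributions of k + l = 0 to the product
    integrals are absent.\<close>
  have odd: "2 * int m + 1 \<noteq> 0" "2 * int m + 1 + (2 * int m' + 1) \<noteq> 0" for m m' by presburger+
  have mean: "(\<integral>a. r j a \<partial>circle_measure) = 0" for j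
  proof -
    obtain m h where "j = (m, h)" by (cases j)
    then show ?thesis using odd by (cases h) (simp_all add: r_def integral_Re_Im_circle_exp)
  qed
  have orth: "(\<integral>a. r i a * r j a \<partial>circle_measure) = of_bool (i = j)" for i j
  proof -
    obtain m h m' h' where ij: "i = (m, h)" "j = (m', h')" by (cases i, cases j)
    have "r i a * r j a = 2 * ((if h then Re (circle_exp (2 * int m + 1) a) else Im (circle_exp (2 * int m + 1) a)) *
       (if h' then Re (circle_exp (2 * int m' + 1) a) else Im (circle_exp (2 * int m' + 1) a)))" for a
      by (simp add: r_def ij mult_ac)
    then have "(\<integral>a. r i a * r j a \<partial>circle_measure) =
       2 * (\<integral>a. (if h then Re (circle_exp (2 * int m + 1) a) else Im (circle_exp (2 * int m + 1) a)) *
       (if h' then Re (circle_exp (2 * int m' + 1) a) else Im (circle_exp (2 * int m' + 1) a)) \<partial>circle_measure)"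
      by simp
    also have "\<dots> = of_bool (i = j)"
    proof (cases h; cases h')
      assume "\<not> h" "h'"
      then show ?thesis
        using integral_Re_Im_products(3)[of "2 * int m' + 1" "2 * int m + 1"] by (simp add: ij mult.commute)
    qed (use odd in \<open>auto simp: ij integral_Re_Im_products\<close>)
    finally show ?thesis .
  qed
  have "\<beta> j \<ge> 0" for j using assms limit_coeff_nonneg by (cases j) (simp add: \<beta>_def)
  from laplace_nsum_tendsto[OF fin meas le mean orth this]
  have "(\<lambda>n. expectation (\<lambda>\<omega>. exp (- (\<Sum>j\<in>J. \<beta> j * nsum (r j) n \<omega> ^ 2)))) \<longlonglongrightarrow> (\<Prod>j\<in>J. 1 / sqrt (1 + 2 * \<beta> j))" .
  also have "(\<Prod>j\<in>J. 1 / sqrt (1 + 2 * \<beta> j)) = (\<Prod>m<K. \<Prod>h\<in>UNIV. 1 / sqrt (1 + 2 * \<beta> (m, h)))"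
    unfolding J_def by (subst prod.cartesian_product) (simp add: case_prod_unfold)
  also have "\<dots> = (\<Prod>m<K. 1 / (1 + s * limit_coeff m))"
    using assms limit_coeff_nonneg by (intro prod.cong refl) (simp add: UNIV_bool \<beta>_def)
  also have "(\<lambda>n. expectation (\<lambda>\<omega>. exp (- (\<Sum>j\<in>J. \<beta> j * nsum (r j) n \<omega> ^ 2)))) =
      (\<lambda>n. expectation (\<lambda>\<omega>. exp (- s * U K n \<omega>)))"
  proof -
    have "(\<Sum>j\<in>J. \<beta> j * nsum (r j) n \<omega> ^ 2) = s * U K n \<omega>" for n \<omega>
    proof -
      have r: "nsum (r (m, True)) n \<omega> = sqrt 2 * nsum (\<lambda>a. Re (circle_exp (2 * int m + 1) a)) n \<omega>"
        "nsum (r (m, False)) n \<omega> = sqrt 2 * nsum (\<lambda>a. Im (circle_exp (2 * int m + 1) a)) n \<omega>" for m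
        by (simp_all add: nsum_def r_def sum_distrib_left)
      have "(\<Sum>j\<in>J. \<beta> j * nsum (r j) n \<omega> ^ 2) = (\<Sum>m<K. \<Sum>h\<in>UNIV. \<beta> (m, h) * nsum (r (m, h)) n \<omega> ^ 2)"
        unfolding J_def by (subst sum.cartesian_product) (simp add: case_prod_unfold)
      also have "\<dots> = (\<Sum>m<K. s * (limit_coeff m * norm (z (2 * int m + 1) n \<omega>) ^ 2))"
        by (intro sum.cong refl)
           (simp add: UNIV_bool r \<beta>_def norm_z_square power_mult_distrib distrib_left mult.assoc add.commute)
      finally show ?thesis by (simp add: U_def sum_distrib_left)
    qed
    then show ?thesis by simp
  qed
  finally show ?thesis .
qed

text \<open>Characteristic functions are compared along \<open>V n\<close>, \<open>U K n\<close>,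
  \<open>psum K\<close>, \<open>total\<close>. The outer two errors are L^1 errors made small by
  choosing K (the first also for n large), and the middle one vanishes as n grows with K
  fixed.\<close>

lemma V_weak_conv:
  assumes "exponential_series N E limit_coeff"
  shows "weak_conv_m (\<lambda>n. distr M borel (V n)) (distr N borel (exponential_series.total E limit_coeff))"
proof -
  interpret S: exponential_series N E limit_coeff by fact
  show ?thesis
  proof (rule levy_continuity)
    fix t :: real
    define tail where "tail K = 1 / 8 - (\<Sum>m<K. - fourier_coeff (2 * int m + 1))" for K
    define tail' where "tail' K = (\<Sum>m. limit_coeff m) - (\<Sum>m<K. limit_coeff m)" for K
    have tail: "(\<lambda>K. \<bar>t\<bar> * ((1 + B8) * tail K)) \<longlonglongrightarrow> 0"
    proof -
      have "(\<lambda>K. \<bar>t\<bar> * ((1 + B8) * tail K)) \<longlonglongrightarrow> \<bar>t\<bar> * ((1 + B8) * (1 / 8 - 1 / 8))"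
        unfolding tail_def using fourier_coeff_sums unfolding sums_def by (intro tendsto_intros)
      then show ?thesis by simp
    qed
    have tail': "(\<lambda>K. \<bar>t\<bar> * tail' K) \<longlonglongrightarrow> 0"
    proof -
      have "(\<lambda>K. \<bar>t\<bar> * tail' K) \<longlonglongrightarrow> \<bar>t\<bar> * ((\<Sum>m. limit_coeff m) - (\<Sum>m. limit_coeff m))"
        unfolding tail'_def by (intro tendsto_intros summable_LIMSEQ limit_coeff_summable)
      then show ?thesis by simp
    qed
    have rate: "(\<lambda>n. \<bar>t\<bar> * ((1 + 3 * B8) / sqrt (real n))) \<longlonglongrightarrow> 0" by real_asymp
    have psum: "integrable N (S.psum K)" for K using S.psum_moments by blast
    note total = S.total_moments[OF summable_sums[OF limit_coeff_summable]
        summable_sums[OF S.summable_b_power] summable_sums[OF S.summable_b_power], simplified]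
    have conv: "(\<lambda>n. expectation (\<lambda>\<omega>. iexp (t * U K n \<omega>))) \<longlonglongrightarrow> S.expectation (\<lambda>x. iexp (t * S.psum K x))" for K
    proof (rule laplace_imp_char_tendsto[OF prob_space_axioms S.prob_space_axioms integrable_U U_nonneg _ psum S.psum_nonneg])
      show "expectation (U K n) \<le> max (1 + B8) (S.expectation (S.psum K))" for n
        using expectation_U_le[of K n] by simp
      show "(\<lambda>n. expectation (\<lambda>\<omega>. exp (- s * U K n \<omega>))) \<longlonglongrightarrow> S.expectation (\<lambda>x. exp (- s * S.psum K x))"
        if "0 \<le> s" for s
        unfolding S.laplace_psum[OF that] by (rule laplace_U_tendsto[OF that])
    qed simp
    have "(\<lambda>n. expectation (\<lambda>\<omega>. iexp (t * V n \<omega>))) \<longlonglongrightarrow> S.expectation (\<lambda>x. iexp (t * S.total x))"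
    proof (rule LIMSEQ_I)
      fix e :: real assume "e > 0"
      then have e4: "e / 4 > 0" by simp
      have "\<forall>\<^sub>F K in sequentially. \<bar>t\<bar> * ((1 + B8) * tail K) < e / 4 \<and> \<bar>t\<bar> * tail' K < e / 4"
        using order_tendstoD(2)[OF tail e4] order_tendstoD(2)[OF tail' e4] by (rule eventually_conj)
      then obtain K where K: "\<bar>t\<bar> * ((1 + B8) * tail K) < e / 4" "\<bar>t\<bar> * tail' K < e / 4"
        by (auto dest: eventually_happens)
      have "\<forall>\<^sub>F n in sequentially. \<bar>t\<bar> * ((1 + 3 * B8) / sqrt (real n)) < e / 4 \<and>
          dist (expectation (\<lambda>\<omega>. iexp (t * U K n \<omega>))) (S.expectation (\<lambda>x. iexp (t * S.psum K x))) < e / 4"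
        using order_tendstoD(2)[OF rate e4] tendstoD[OF conv e4] by (rule eventually_conj)
      then obtain n0 where n0: "\<And>n. n \<ge> n0 \<Longrightarrow> \<bar>t\<bar> * ((1 + 3 * B8) / sqrt (real n)) < e / 4 \<and>
          dist (expectation (\<lambda>\<omega>. iexp (t * U K n \<omega>))) (S.expectation (\<lambda>x. iexp (t * S.psum K x))) < e / 4"
        unfolding eventually_sequentially by blast
      have "norm (S.expectation (\<lambda>x. iexp (t * S.total x)) - S.expectation (\<lambda>x. iexp (t * S.psum K x)))
          \<le> \<bar>t\<bar> * tail' K"
        using norm_expectation_iexp_diff_le[OF S.prob_space_axioms S.total_measurable S.psum_measurable, of K t]
          total(1) psum[of K] unfolding tail'_def S.expectation_total_minus_psum[symmetric] by simp
      then have 1: "norm (S.expectation (\<lambda>x. iexp (t * S.psum K x)) - S.expectation (\<lambda>x. iexp (t * S.total x))) < e / 4"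
        using K(2) by (simp add: norm_minus_commute)
      show "\<exists>n0. \<forall>n\<ge>n0. norm (expectation (\<lambda>\<omega>. iexp (t * V n \<omega>)) - S.expectation (\<lambda>x. iexp (t * S.total x))) < e"
      proof (intro exI[of _ "max 1 n0"] allI impI)
        fix n assume n: "max 1 n0 \<le> n"
        have "norm (expectation (\<lambda>\<omega>. iexp (t * V n \<omega>)) - expectation (\<lambda>\<omega>. iexp (t * U K n \<omega>))) \<le>
            \<bar>t\<bar> * expectation (\<lambda>\<omega>. \<bar>V n \<omega> - U K n \<omega>\<bar>)"
          by (rule norm_expectation_iexp_diff_le[OF prob_space_axioms])
             (use integrable_V(1)[of n] integrable_U[of K n] in auto)
        also have "\<dots> \<le> \<bar>t\<bar> * ((1 + B8) * tail K + (1 + 3 * B8) / sqrt (real n))"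
          unfolding tail_def using expectation_V_minus_U_le[of n K] n by (intro mult_left_mono) auto
        also have "\<dots> < e / 2"
          using K(1) n0[of n] n unfolding distrib_left by linarith
        finally show "norm (expectation (\<lambda>\<omega>. iexp (t * V n \<omega>)) - S.expectation (\<lambda>x. iexp (t * S.total x))) < e"
          using 1 n0[of n] n
            norm_triangle_ineq[of "expectation (\<lambda>\<omega>. iexp (t * V n \<omega>)) - expectation (\<lambda>\<omega>. iexp (t * U K n \<omega>))"
              "expectation (\<lambda>\<omega>. iexp (t * U K n \<omega>)) - S.expectation (\<lambda>x. iexp (t * S.psum K x))"]
            norm_triangle_ineq[of "expectation (\<lambda>\<omega>. iexp (t * V n \<omega>)) - S.expectation (\<lambda>x. iexp (t * S.psum K x))"
              "S.expectation (\<lambda>x. iexp (t * S.psum K x)) - S.expectation (\<lambda>x. iexp (t * S.total x))"]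
          unfolding dist_norm by simp
      qed
    qed
    then show "(\<lambda>n. char (distr M borel (V n)) t) \<longlonglongrightarrow> char (distr N borel S.total) t"
      by (simp add: char_def integral_distr)
  qed (auto intro!: real_distribution_distr S.real_distribution_distr)
qed

end

section \<open>The observable and the limit law\<close>

text \<open>As the image of the uniform measure on the indices, the empirical measure counts
  coinciding sample points with multiplicity, and integrals against it become averages over
  indices.\<close>

lemma empirical_measure_eq_distr:
  fixes x :: "nat \<Rightarrow> 'a"
  assumes "n \<ge> 1"
  shows "empirical_measure n x = distr (uniform_count_measure {1..n}) (count_space (x ` {1..n})) x"
proof (rule measure_eqI)
  fix A assume "A \<in> sets (empirical_measure n x)"
  then have A: "A \<subseteq> x ` {1..n}" by simp
  have meas: "x \<in> uniform_count_measure {1..n} \<rightarrow>\<^sub>M count_space (x ` {1..n})"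
    by (auto simp: measurable_def space_uniform_count_measure sets_uniform_count_measure)
  have "(\<Sum>i = 1..n. indicator A (x i)) = ennreal (real (card (x -` A \<inter> {1..n})))"
  proof -
    have "(\<Sum>i = 1..n. indicator A (x i) :: ennreal) = (\<Sum>i\<in>x -` A \<inter> {1..n}. 1)"
      by (intro sum.mono_neutral_cong_right) (auto simp: indicator_def)
    then show ?thesis by (simp add: ennreal_of_nat_eq_real_of_nat)
  qed
  moreover have "emeasure (distr (uniform_count_measure {1..n}) (count_space (x ` {1..n})) x) A =
      ennreal (real (card (x -` A \<inter> {1..n})) / real n)"
    using A by (subst emeasure_distr[OF meas])
      (auto simp: emeasure_uniform_count_measure space_uniform_count_measure)
  ultimately show "emeasure (empirical_measure n x) A =
      emeasure (distr (uniform_count_measure {1..n}) (count_space (x ` {1..n})) x) A"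
    using A assms
    by (simp add: emeasure_empirical_measure ennreal_of_nat_eq_real_of_nat divide_ennreal)
qed simp

lemma prob_space_empirical_measure: "n \<ge> 1 \<Longrightarrow> prob_space (empirical_measure n x)"
  by (subst empirical_measure_eq_distr, assumption, rule prob_space.prob_space_distr)
     (auto intro!: prob_space_uniform_count_measure
       simp: measurable_def space_uniform_count_measure sets_uniform_count_measure)

lemma integral_empirical_measure:
  fixes f :: "'a \<Rightarrow> real"
  assumes "n \<ge> 1"
  shows "(\<integral>a. f a \<partial>empirical_measure n x) = (\<Sum>i = 1..n. f (x i)) / real n"
  unfolding empirical_measure_eq_distr[OF assms]
  by (subst integral_distr)
     (auto simp: integral_uniform_count_measure measurable_def space_uniform_count_measure
       sets_uniform_count_measure)

lemma integral_triple_product: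
  fixes f :: "'a \<Rightarrow> 'a \<Rightarrow> 'a \<Rightarrow> real"
  assumes "prob_space m"
    and [measurable]: "(\<lambda>(x, y, z). f x y z) \<in> borel_measurable (m \<Otimes>\<^sub>M (m \<Otimes>\<^sub>M m))"
    and bound: "\<And>x y z. x \<in> space m \<Longrightarrow> y \<in> space m \<Longrightarrow> z \<in> space m \<Longrightarrow> \<bar>f x y z\<bar> \<le> 1"
  shows "(\<integral>(x, y, z). f x y z \<partial>(m \<Otimes>\<^sub>M (m \<Otimes>\<^sub>M m))) = (\<integral>x. \<integral>y. \<integral>z. f x y z \<partial>m \<partial>m \<partial>m)"
proof -
  interpret m: prob_space m by fact
  interpret mm: pair_prob_space m m ..
  interpret mmm: pair_prob_space m "m \<Otimes>\<^sub>M m" ..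
  have "integrable (m \<Otimes>\<^sub>M (m \<Otimes>\<^sub>M m)) (\<lambda>(x, y, z). f x y z)"
    by (rule mmm.integrable_const_bound[where B = 1])
       (use bound in \<open>auto simp: space_pair_measure intro!: AE_I2\<close>)
  then have "(\<integral>(x, y, z). f x y z \<partial>(m \<Otimes>\<^sub>M (m \<Otimes>\<^sub>M m))) = (\<integral>x. \<integral>p. (case p of (y, z) \<Rightarrow> f x y z) \<partial>(m \<Otimes>\<^sub>M m) \<partial>m)"
    using mmm.integral_fst'[of "\<lambda>(x, y, z). f x y z"] by simp
  also have "\<dots> = (\<integral>x. \<integral>y. \<integral>z. f x y z \<partial>m \<partial>m \<partial>m)"
  proof (rule Bochner_Integration.integral_cong[OF refl])
    fix x assume x: "x \<in> space m"
    have [measurable]: "(\<lambda>(y, z). f x y z) \<in> borel_measurable (m \<Otimes>\<^sub>M m)"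
      using measurable_compose[OF measurable_Pair1'[OF x, of "m \<Otimes>\<^sub>M m"] assms(2)] by simp
    have "integrable (m \<Otimes>\<^sub>M m) (\<lambda>(y, z). f x y z)"
      by (rule mm.integrable_const_bound[where B = 1])
         (use bound x in \<open>auto simp: space_pair_measure intro!: AE_I2\<close>)
    then show "(\<integral>p. (case p of (y, z) \<Rightarrow> f x y z) \<partial>(m \<Otimes>\<^sub>M m)) = (\<integral>y. \<integral>z. f x y z \<partial>m \<partial>m)"
      using mm.integral_fst'[of "\<lambda>(y, z). f x y z"] by simp
  qed
  finally show ?thesis .
qed

text \<open>For a fixed middle point the outer two points separate, and symmetry of the distance
  makes their double sum a square.\<close>

lemma observable_sample_model:
  fixes x :: "nat \<Rightarrow> circle"
  assumes n: "n \<ge> 1"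
  shows "observable (sample_model dist n x) =
    (\<Sum>j<n. (\<Sum>i<n. dist (x (Suc i)) (x (Suc j))) ^ 2) / real n ^ 3"
proof -
  define m where "m = empirical_measure n x"
  define S where "S = x ` {1..n}"
  have S: "countable S" by (simp add: S_def)
  \<comment> \<open>The support is countable, so the product sigma-algebra contains every subset of
    the triple product and measurability is automatic.\<close>
  have "sets (m \<Otimes>\<^sub>M (m \<Otimes>\<^sub>M m)) = sets (count_space S \<Otimes>\<^sub>M (count_space S \<Otimes>\<^sub>M count_space S))"
    by (intro sets_pair_measure_cong) (simp_all add: m_def S_def)
  also have "\<dots> = sets (count_space (S \<times> S \<times> S))"
    using S by (simp only: pair_measure_countable countable_SIGMA)
  finally have sets: "sets (m \<Otimes>\<^sub>M (m \<Otimes>\<^sub>M m)) = sets (count_space (S \<times> S \<times> S))" .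
  have dist: "min 1 (dist a b) = dist a b" for a b :: circle
    using dist_circle_le[of a b] by simp
  have "observable (sample_model dist n x) =
      (\<integral>(a, b, c). dist a b * dist b c \<partial>(m \<Otimes>\<^sub>M (m \<Otimes>\<^sub>M m)))"
    by (simp add: observable_def sample_model_def m_def dist)
  also have "\<dots> = (\<integral>a. \<integral>b. \<integral>c. dist a b * dist b c \<partial>m \<partial>m \<partial>m)"
  proof (rule integral_triple_product)
    show "prob_space m" unfolding m_def by (rule prob_space_empirical_measure[OF n])
    show "(\<lambda>(a, b, c). dist a b * dist b c) \<in> borel_measurable (m \<Otimes>\<^sub>M (m \<Otimes>\<^sub>M m))"
      by (subst measurable_cong_sets[OF sets refl]) simp
    fix a b c :: circle
    have "dist a b * dist b c \<le> 1 * 1"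
      using dist_circle_le[of a b] dist_circle_le[of b c] by (intro mult_mono) auto
    then show "\<bar>dist a b * dist b c\<bar> \<le> 1" by simp
  qed
  also have "\<dots> = (\<Sum>i = 1..n. (\<Sum>j = 1..n. (\<Sum>k = 1..n. dist (x i) (x j) * dist (x j) (x k)) / real n) / real n) / real n"
    unfolding m_def integral_empirical_measure[OF n] ..
  also have "\<dots> = (\<Sum>i = 1..n. \<Sum>j = 1..n. \<Sum>k = 1..n. dist (x i) (x j) * dist (x j) (x k)) / real n ^ 3"
    by (simp add: sum_divide_distrib power3_eq_cube)
  also have "(\<Sum>i = 1..n. \<Sum>j = 1..n. \<Sum>k = 1..n. dist (x i) (x j) * dist (x j) (x k)) =
      (\<Sum>j = 1..n. (\<Sum>i = 1..n. dist (x i) (x j)) ^ 2)"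
    by (subst sum.swap) (simp add: power2_eq_square sum_product dist_commute)
  finally show ?thesis by (simp add: sum.atLeast1_atMost_eq)
qed

lemma observable_circle_space: "observable circle_space = 1 / 16"
proof -
  have dist: "min 1 (dist a b) = dist a b" for a b :: circle
    using dist_circle_le[of a b] by simp
  have "observable circle_space =
      (\<integral>(a, b, c). dist a b * dist b c \<partial>(circle_measure \<Otimes>\<^sub>M (circle_measure \<Otimes>\<^sub>M circle_measure)))"
    by (simp add: observable_def circle_space_def dist)
  also have "\<dots> = (\<integral>a. \<integral>b. \<integral>c. dist a b * dist b c \<partial>circle_measure \<partial>circle_measure \<partial>circle_measure)"
  proof (rule integral_triple_product[OF prob_space_circle_measure])
    show "(\<lambda>(a, b, c). dist a b * dist b c)
        \<in> borel_measurable (circle_measure \<Otimes>\<^sub>M (circle_measure \<Otimes>\<^sub>M circle_measure))"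
      by measurable
    fix a b c :: circle
    have "dist a b * dist b c \<le> 1 * 1"
      using dist_circle_le[of a b] dist_circle_le[of b c] by (intro mult_mono) auto
    then show "\<bar>dist a b * dist b c\<bar> \<le> 1" by simp
  qed
  also have "\<dots> = 1 / 16"
    using circle_measure.prob_space by (simp add: integral_dist_circle)
  finally show ?thesis .
qed

text \<open>Serves to set aside n = 0, where the sample is empty and the formulas for it do not
  apply.\<close>

lemma weak_conv_m_cong_from:
  assumes "weak_conv_m \<mu> L" "\<And>n. n \<ge> n0 \<Longrightarrow> \<mu> n = \<nu> n"
  shows "weak_conv_m \<nu> L"
  unfolding weak_conv_m_def weak_conv_def
proof (intro allI impI)
  fix x assume "isCont (cdf L) x"
  then have "(\<lambda>n. cdf (\<mu> n) x) \<longlonglongrightarrow> cdf L x"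
    using assms(1) unfolding weak_conv_m_def weak_conv_def by blast
  then show "(\<lambda>n. cdf (\<nu> n) x) \<longlonglongrightarrow> cdf L x"
    by (rule Lim_transform_eventually) (auto intro: eventually_sequentiallyI[of n0] simp: assms(2))
qed

lemma (in prob_space) indep_vars_Suc:
  assumes "indep_vars M' X {1..}"
  shows "indep_vars (\<lambda>i. M' (Suc i)) (\<lambda>i. X (Suc i)) UNIV"
  unfolding indep_vars_def2
proof (intro conjI ballI indep_setsI)
  show "random_variable (M' (Suc i)) (X (Suc i))" for i
    using assms by (auto simp: indep_vars_def2)
  show "{X (Suc i) -` A \<inter> space M |A. A \<in> sets (M' (Suc i))} \<subseteq> events" for i
    using assms by (auto simp: indep_vars_def2 intro!: measurable_sets)
  fix A J
  assume J: "J \<noteq> {}" "finite J" and A: "\<forall>j\<in>J. A j \<in> {X (Suc j) -` A \<inter> space M |A. A \<in> sets (M' (Suc j))}"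
  have "indep_sets (\<lambda>i. {X i -` A \<inter> space M |A. A \<in> sets (M' i)}) {1..}"
    using assms by (simp add: indep_vars_def2)
  then have "prob (\<Inter>j\<in>Suc ` J. A (j - 1)) = (\<Prod>j\<in>Suc ` J. prob (A (j - 1)))"
    by (rule indep_setsD) (use J A in auto)
  then show "prob (\<Inter>j\<in>J. A j) = (\<Prod>j\<in>J. prob (A j))"
    by (simp add: prod.reindex)
qed

text \<open>Powers of w - 2 w^2 are expanded, and each w^j brings exactly the power of pi that its
  odd zeta value cancels. The three sums are the mean, the variance and half the third cumulant of
  \<open>total\<close>.\<close>

lemma limit_coeff_sums:
  "limit_coeff sums (5 / 48)"
  "(\<lambda>m. limit_coeff m ^ 2) sums (269 / 40320)"
  "(\<lambda>m. limit_coeff m ^ 3) sums (42209 / 79833600)"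
proof -
  define w where "w m = 1 / (pi * real (2 * m + 1)) ^ 2" for m :: nat
  have w_pow: "(\<lambda>m. w m ^ j) sums (odd_cos_series j 0 / pi ^ (2 * j))" if "j \<ge> 1" for j
  proof -
    have "w m ^ j = 1 / real (2 * m + 1) ^ (2 * j) / pi ^ (2 * j)" for m
      by (simp add: w_def power_mult_distrib power_divide mult.commute flip: power_mult)
    then show ?thesis using sums_divide[OF odd_zeta_sums[OF that], of "pi ^ (2 * j)"] by simp
  qed
  have w: "(\<lambda>m. w m) sums (1 / 8)" "(\<lambda>m. w m ^ 2) sums (1 / 96)" "(\<lambda>m. w m ^ 3) sums (1 / 960)"
    "(\<lambda>m. w m ^ 4) sums (17 / 161280)" "(\<lambda>m. w m ^ 5) sums (31 / 2903040)"
    "(\<lambda>m. w m ^ 6) sums (691 / 638668800)"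
    using w_pow[of 1] w_pow[of 2] w_pow[of 3] w_pow[of 4] w_pow[of 5] w_pow[of 6]
    unfolding odd_zeta_values by simp_all
  have lc: "limit_coeff m = w m - 2 * w m ^ 2" for m
    by (simp add: limit_coeff_def fourier_coeff_def w_def add.commute)
  have "(\<lambda>m. w m - 2 * w m ^ 2) sums (1 / 8 - 2 * (1 / 96))"
    by (intro sums_diff sums_mult w)
  then show "limit_coeff sums (5 / 48)" by (simp add: lc[abs_def])
  have "(\<lambda>m. w m ^ 2 - 4 * w m ^ 3 + 4 * w m ^ 4) sums (1 / 96 - 4 * (1 / 960) + 4 * (17 / 161280))"
    by (intro sums_diff sums_add sums_mult w)
  also have "(\<lambda>m. w m ^ 2 - 4 * w m ^ 3 + 4 * w m ^ 4) = (\<lambda>m. limit_coeff m ^ 2)"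
    unfolding lc by (rule ext) (simp add: eval_nat_numeral algebra_simps)
  finally show "(\<lambda>m. limit_coeff m ^ 2) sums (269 / 40320)" by simp
  have "(\<lambda>m. w m ^ 3 - 6 * w m ^ 4 + 12 * w m ^ 5 - 8 * w m ^ 6) sums
      (1 / 960 - 6 * (17 / 161280) + 12 * (31 / 2903040) - 8 * (691 / 638668800))"
    by (intro sums_diff sums_add sums_mult w)
  also have "(\<lambda>m. w m ^ 3 - 6 * w m ^ 4 + 12 * w m ^ 5 - 8 * w m ^ 6) = (\<lambda>m. limit_coeff m ^ 3)"
    unfolding lc by (rule ext) (simp add: eval_nat_numeral algebra_simps)
  finally show "(\<lambda>m. limit_coeff m ^ 3) sums (42209 / 79833600)" by simp
qed

text \<open>The root is bracketed to within 10^(-6), and the factor in front is below 4.\<close>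

lemma third_cumulant_approx:
  "\<bar>- (168836 / 44385) * sqrt (70 / 269) - (- 1.94044 :: real)\<bar> < 10 powi (-5)"
proof -
  have "sqrt (70 / 269) < 0.510121" by (rule real_less_lsqrt) (simp_all add: power2_eq_square)
  moreover have "0.51012 < sqrt (70 / 269)" by (rule real_less_rsqrt) (simp add: power2_eq_square)
  ultimately show ?thesis by (simp add: power_int_def abs_less_iff power_divide)
qed

text \<open>A vanishing mean forces \<open>m = 0\<close>, and the density is then even. A nonzero
  third moment of a centered law thus excludes every Gaussian.\<close>

lemma normal_density_third_moment:
  assumes "0 < s" "L = density lborel (normal_density m s)" "(\<integral>x. x \<partial>L) = 0"
  shows "(\<integral>x. x ^ 3 \<partial>L) = 0"
proof -
  have "(\<integral>x. x \<partial>L) = (\<integral>x. normal_density m s x * x \<partial>lborel)"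
    unfolding assms(2) by (subst integral_density) auto
  then have "m = 0" using assms(3) integral_normal_moment_nz_1[OF assms(1), of m] by simp
  have "(\<integral>x. x ^ 3 \<partial>L) = (\<integral>x. normal_density m s x * x ^ 3 \<partial>lborel)"
    unfolding assms(2) by (subst integral_density) auto
  then show ?thesis
    using \<open>m = 0\<close> integral_normal_moment_odd[OF assms(1), of 0 1] by simp
qed

context circle_sample
begin

lemma variance_V: "variance (V n) = expectation (\<lambda>\<omega>. V n \<omega> ^ 2) - expectation (V n) ^ 2"
  using integrable_V[of n] by (intro variance_eq) auto

text \<open>Weak convergence together with the uniform fourth moment bound carries the first two
  moments to those of \<open>total\<close>.\<close>

lemma V_moments_tendsto:
  assumes "exponential_series N E limit_coeff"
  shows "(\<lambda>n. expectation (V n)) \<longlonglongrightarrow> 5 / 48" "(\<lambda>n. variance (V n)) \<longlonglongrightarrow> 269 / 40320"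
proof -
  interpret S: exponential_series N E limit_coeff by fact
  note total = S.total_moments[OF limit_coeff_sums]
  have conv: "(\<lambda>n. expectation (\<lambda>\<omega>. f (V n \<omega>))) \<longlonglongrightarrow> S.expectation (\<lambda>x. f (S.total x))"
    if f: "\<And>x. isCont f x" "\<And>x. \<bar>f x\<bar> \<le> 1 + x ^ 2" for f :: "real \<Rightarrow> real"
  proof -
    have [measurable]: "f \<in> borel_measurable borel"
      using f(1) by (intro borel_measurable_continuous_onI continuous_at_imp_continuous_on) auto
    have "(\<lambda>n. \<integral>x. f x \<partial>distr M borel (V n)) \<longlonglongrightarrow> (\<integral>x. f x \<partial>distr N borel S.total)"
    proof (rule weak_conv_m_integral_growth2[OF _ _ V_weak_conv[OF assms] _ _ _ f])
      show "integrable (distr M borel (V n)) (\<lambda>x. x ^ 4)" for n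
        using integrable_V(2) by (subst integrable_distr_eq) auto
      show "(\<integral>x. x ^ 4 \<partial>distr M borel (V n)) \<le> B8" for n
        using expectation_V_power4_le by (subst integral_distr) auto
      show "integrable (distr N borel S.total) (\<lambda>x. x ^ 2)"
        using total(3) by (subst integrable_distr_eq) auto
    qed (auto intro!: real_distribution_distr S.real_distribution_distr)
    then show ?thesis by (simp add: integral_distr)
  qed
  have "\<bar>x\<bar> \<le> 1 + x ^ 2" for x :: real
    using zero_le_power2[of "\<bar>x\<bar> - 1"] by (simp add: power2_diff)
  then show 1: "(\<lambda>n. expectation (V n)) \<longlonglongrightarrow> 5 / 48"
    using conv[of "\<lambda>x. x"] total(2) by simp
  have "(\<lambda>n. expectation (\<lambda>\<omega>. V n \<omega> ^ 2)) \<longlonglongrightarrow> (5 / 48) ^ 2 + 269 / 40320"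
    using conv[of "\<lambda>x. x ^ 2"] total(4) by simp
  from tendsto_diff[OF this tendsto_power[OF 1, of 2]]
  show "(\<lambda>n. variance (V n)) \<longlonglongrightarrow> 269 / 40320"
    unfolding variance_V by simp
qed

lemma expectation_abs_V_le: "expectation (\<lambda>\<omega>. \<bar>V n \<omega>\<bar>) \<le> 1 + B8"
proof -
  have "\<bar>x\<bar> \<le> 1 + x ^ 4" for x :: real
  proof (cases "\<bar>x\<bar> \<le> 1")
    case True
    moreover have "0 \<le> x ^ 4" by simp
    ultimately show ?thesis by linarith
  next
    case False
    then have "\<bar>x\<bar> ^ 1 \<le> \<bar>x\<bar> ^ 4" by (intro power_increasing) auto
    then show ?thesis by simp
  qed
  then have "expectation (\<lambda>\<omega>. \<bar>V n \<omega>\<bar>) \<le> expectation (\<lambda>\<omega>. 1 + V n \<omega> ^ 4)"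
    using integrable_V[of n] by (intro integral_mono) auto
  also have "\<dots> \<le> 1 + B8"
    using integrable_V(2)[of n 4] expectation_V_power4_le[of n] by (simp add: prob_space)
  finally show ?thesis .
qed

end

text \<open>The expectation of the observable of the sample differs from that of the circle by about
  -5/(48 n), while the standard deviation is about sqrt(269/40320)/n. The quotient of these
  constants is 5/2 sqrt(70/269): centering at the expectation gives the centered law
  \<open>L\<close>, centering at the observable of the circle gives \<open>L\<close> shifted by that
  amount. The shift affects neither the variance nor the third cumulant.\<close>

theorem proposition6p4:
  fixes M :: "'a measure" and X :: "nat \<Rightarrow> 'a \<Rightarrow> circle" and \<Phi>\<^sub>n :: "nat \<Rightarrow> 'a \<Rightarrow> real"
  assumes "prob_space M"
    and "prob_space.indep_vars M (\<lambda>_. borel) X {1..}"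
    and "\<And>i. i \<ge> 1 \<Longrightarrow> distr M borel (X i) = circle_measure"
    and "\<And>n \<omega>. \<Phi>\<^sub>n n \<omega> = observable (sample_model dist n (\<lambda>i. X i \<omega>))"
  shows "(\<exists>L. real_distribution L \<and>
      weak_conv_m
        (\<lambda>n. distr M borel (\<lambda>\<omega>. (\<Phi>\<^sub>n n \<omega> - prob_space.expectation M (\<Phi>\<^sub>n n)) / sqrt (prob_space.variance M (\<Phi>\<^sub>n n))))
        L \<and>
      weak_conv_m
        (\<lambda>n. distr M borel (\<lambda>\<omega>. (\<Phi>\<^sub>n n \<omega> - observable circle_space) / sqrt (prob_space.variance M (\<Phi>\<^sub>n n))))
        (distr L borel (\<lambda>x. x - 5 / 2 * sqrt (70 / 269))) \<and>
      integrable L (\<lambda>x. x ^ 3) \<and>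
      prob_space.expectation L (\<lambda>x. x) = 0 \<and>
      prob_space.variance L (\<lambda>x. x) = 1 \<and>
      third_cumulant L (\<lambda>x. x) = - (168836 / 44385) * sqrt (70 / 269) \<and>
      (\<forall>m s. 0 < s \<longrightarrow> L \<noteq> density lborel (normal_density m s))) \<and>
    \<bar>- (168836 / 44385) * sqrt (70 / 269) - (- 1.94044 :: real)\<bar> < 10 powi (-5)"
proof (intro conjI third_cumulant_approx)
  interpret M: prob_space M by fact
  have X [measurable]: "X (Suc i) \<in> M \<rightarrow>\<^sub>M borel" for i
    using assms(2) by (simp add: M.indep_vars_def2)
  interpret circle_sample M "\<lambda>i. X (Suc i)"
  proof
    have "M.indep_vars (\<lambda>_. borel) (\<lambda>i. X (Suc i)) UNIV"
      using M.indep_vars_Suc[OF assms(2)] .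
    then show "M.indep_vars (\<lambda>_. circle_measure) (\<lambda>i. X (Suc i)) UNIV"
      using M.indep_vars_compose2[of "\<lambda>_. borel" "\<lambda>i. X (Suc i)" UNIV "\<lambda>_ a. a" "\<lambda>_. circle_measure"]
      by (simp add: measurable_ident_sets)
    show "distr M circle_measure (X (Suc i)) = circle_measure" for i
    proof -
      have "distr M circle_measure (X (Suc i)) = distr M borel (X (Suc i))"
        by (rule distr_cong) simp_all
      then show ?thesis using assms(3)[of "Suc i"] by simp
    qed
  qed
  define N where "N = PiM UNIV (\<lambda>_::nat. density lborel (exponential_density 1))"
  define E :: "nat \<Rightarrow> (nat \<Rightarrow> real) \<Rightarrow> real" where "E = (\<lambda>k x. \<bar>x k\<bar>)"
  have series: "exponential_series N E limit_coeff"
    unfolding N_def E_def by (intro exponential_series_PiM limit_coeff_nonneg limit_coeff_summable)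
  interpret S: exponential_series N E limit_coeff by (rule series)
  note total = S.total_moments[OF limit_coeff_sums]
  define \<sigma> where "\<sigma> = sqrt (269 / 40320)"
  have \<sigma>: "\<sigma> > 0" "\<sigma> ^ 2 = 269 / 40320" by (simp_all add: \<sigma>_def)
  \<comment> \<open>Since 40320 = 24^2 * 70.\<close>
  have \<sigma>_inverse: "1 / \<sigma> = 24 * sqrt (70 / 269)"
  proof -
    have "24 * sqrt (70 / 269) = sqrt (24 ^ 2 * (70 / 269))" by (simp only: real_sqrt_mult real_sqrt_abs abs_numeral)
    also have "\<dots> = 1 / \<sigma>" by (simp add: \<sigma>_def real_sqrt_divide)
    finally show ?thesis by simp
  qed
  \<comment> \<open>The standardised \<open>total\<close> with its sign reversed, because
    \<open>V\<close> carries the opposite sign of the fluctuation.\<close>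
  define W where "W x = (- (1 / \<sigma>)) * S.total x + 5 / 48 * (1 / \<sigma>)" for x
  have [measurable]: "W \<in> borel_measurable N" unfolding W_def by measurable
  define L where "L = distr N borel W"
  have V: "\<Phi>\<^sub>n n \<omega> = 1 / 16 - V n \<omega> / real n" if "n \<ge> 1" for n \<omega>
    using that by (simp add: assms(4) observable_sample_model V_def)
  have \<Phi>: "\<Phi>\<^sub>n n = (\<lambda>\<omega>. 1 / 16 - V n \<omega> / real n)"
    "M.expectation (\<Phi>\<^sub>n n) = 1 / 16 - M.expectation (V n) / real n"
    "M.variance (\<Phi>\<^sub>n n) = M.variance (V n) / real n ^ 2" if "n \<ge> 1" for n
  proof -
    show 1: "\<Phi>\<^sub>n n = (\<lambda>\<omega>. 1 / 16 - V n \<omega> / real n)" using V[OF that] by (rule ext)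
    show 2: "M.expectation (\<Phi>\<^sub>n n) = 1 / 16 - M.expectation (V n) / real n"
      unfolding 1 using integrable_V(1)[of n] M.prob_space by simp
    have "(\<Phi>\<^sub>n n \<omega> - M.expectation (\<Phi>\<^sub>n n)) ^ 2 = (V n \<omega> - M.expectation (V n)) ^ 2 / real n ^ 2" for \<omega>
    proof -
      have "\<Phi>\<^sub>n n \<omega> - M.expectation (\<Phi>\<^sub>n n) = - ((V n \<omega> - M.expectation (V n)) / real n)"
        unfolding 2 unfolding V[OF that] by (simp add: diff_divide_distrib)
      then show ?thesis by (simp only: power2_minus power_divide)
    qed
    then show "M.variance (\<Phi>\<^sub>n n) = M.variance (V n) / real n ^ 2" by simp
  qed
  define \<alpha> where "\<alpha> n = - (1 / sqrt (M.variance (V n)))" for n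
  have \<alpha>: "\<alpha> \<longlonglongrightarrow> - (1 / \<sigma>)"
    unfolding \<alpha>_def \<sigma>_def by (intro tendsto_intros V_moments_tendsto[OF series]) simp
  have conv: "weak_conv_m (\<lambda>n. distr M borel (\<lambda>\<omega>. \<alpha> n * V n \<omega> + \<beta> n))
      (distr N borel (\<lambda>x. (- (1 / \<sigma>)) * S.total x + b))" if "\<beta> \<longlonglongrightarrow> b" for \<beta> b
    by (rule weak_conv_m_affine[OF M.prob_space_axioms S.prob_space_axioms integrable_V(1)
        expectation_abs_V_le S.total_measurable V_weak_conv[OF series] \<alpha> that])
  have sd: "sqrt (M.variance (\<Phi>\<^sub>n n)) = sqrt (M.variance (V n)) / real n" if "n \<ge> 1" for n
    unfolding \<Phi>(3)[OF that] by (simp add: real_sqrt_divide)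
  have lim1: "weak_conv_m
        (\<lambda>n. distr M borel (\<lambda>\<omega>. (\<Phi>\<^sub>n n \<omega> - M.expectation (\<Phi>\<^sub>n n)) / sqrt (M.variance (\<Phi>\<^sub>n n)))) L"
  proof (rule weak_conv_m_cong_from[of _ _ 1])
    have "(\<lambda>n. M.expectation (V n) * - \<alpha> n) \<longlonglongrightarrow> 5 / 48 * - (- (1 / \<sigma>))"
      by (intro tendsto_intros \<alpha> V_moments_tendsto[OF series])
    then show "weak_conv_m (\<lambda>n. distr M borel (\<lambda>\<omega>. \<alpha> n * V n \<omega> + M.expectation (V n) * - \<alpha> n)) L"
      unfolding L_def W_def by (intro conv) simp
    fix n :: nat assume n: "n \<ge> 1"
    have "\<alpha> n * V n \<omega> + M.expectation (V n) * - \<alpha> n =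
        (\<Phi>\<^sub>n n \<omega> - M.expectation (\<Phi>\<^sub>n n)) / sqrt (M.variance (\<Phi>\<^sub>n n))" for \<omega>
    proof -
      \<comment> \<open>A zero variance is covered too, since division by 0 gives 0 on both
        sides.\<close>
      have "- (1 / S) * v + e * - (- (1 / S)) = (1 / 16 - v / r - (1 / 16 - e / r)) / (S / r)"
        if "r > 0" for S v e r :: real
        using that by (cases "S = 0") (simp_all add: field_simps)
      then show ?thesis
        unfolding sd[OF n] unfolding \<Phi>(2)[OF n] V[OF n] \<alpha>_def using n by simp
    qed
    then show "distr M borel (\<lambda>\<omega>. \<alpha> n * V n \<omega> + M.expectation (V n) * - \<alpha> n) =
        distr M borel (\<lambda>\<omega>. (\<Phi>\<^sub>n n \<omega> - M.expectation (\<Phi>\<^sub>n n)) / sqrt (M.variance (\<Phi>\<^sub>n n)))"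
      by simp
  qed
  have lim2: "weak_conv_m
        (\<lambda>n. distr M borel (\<lambda>\<omega>. (\<Phi>\<^sub>n n \<omega> - observable circle_space) / sqrt (M.variance (\<Phi>\<^sub>n n))))
        (distr L borel (\<lambda>x. x - 5 / 2 * sqrt (70 / 269)))"
  proof (rule weak_conv_m_cong_from[of _ _ 1])
    \<comment> \<open>Removing the shift (5/48)/\<open>\<sigma>\<close> leaves the normalised
      \<open>total\<close> without centering.\<close>
    have "distr L borel (\<lambda>x. x - 5 / 2 * sqrt (70 / 269)) =
        distr N borel (\<lambda>x. (- (1 / \<sigma>)) * S.total x + 0)"
      unfolding L_def by (subst distr_distr) (simp_all add: comp_def W_def \<sigma>_inverse)
    then show "weak_conv_m (\<lambda>n. distr M borel (\<lambda>\<omega>. \<alpha> n * V n \<omega> + 0))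
        (distr L borel (\<lambda>x. x - 5 / 2 * sqrt (70 / 269)))"
      using conv[of "\<lambda>_. 0" 0] by simp
    fix n :: nat assume n: "n \<ge> 1"
    have "\<alpha> n * V n \<omega> + 0 = (\<Phi>\<^sub>n n \<omega> - observable circle_space) / sqrt (M.variance (\<Phi>\<^sub>n n))" for \<omega>
      unfolding sd[OF n] observable_circle_space using n by (simp add: V \<alpha>_def)
    then show "distr M borel (\<lambda>\<omega>. \<alpha> n * V n \<omega> + 0) =
        distr M borel (\<lambda>\<omega>. (\<Phi>\<^sub>n n \<omega> - observable circle_space) / sqrt (M.variance (\<Phi>\<^sub>n n)))"
      by simp
  qed
  have W_eq: "W x = - (1 / \<sigma>) * (S.total x - 5 / 48)" for x by (simp add: W_def algebra_simps)
  have T3: "(t - c) ^ 3 = t ^ 3 - 3 * c * t ^ 2 + 3 * c ^ 2 * t - c ^ 3"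
    and T2: "(t - c) ^ 2 = t ^ 2 - 2 * c * t + c ^ 2" for t c :: real
    by (simp_all add: power3_eq_cube power2_eq_square algebra_simps)
  have m1: "S.expectation W = 0"
    unfolding W_def by (simp add: total S.prob_space)
  have m2: "S.expectation (\<lambda>x. W x ^ 2) = 1"
  proof -
    have "S.expectation (\<lambda>x. W x ^ 2) = (1 / \<sigma>) ^ 2 *
        S.expectation (\<lambda>x. S.total x ^ 2 - 2 * (5 / 48) * S.total x + (5 / 48) ^ 2)"
      unfolding W_eq power_mult_distrib T2 by simp
    also have "S.expectation (\<lambda>x. S.total x ^ 2 - 2 * (5 / 48) * S.total x + (5 / 48) ^ 2) = \<sigma> ^ 2"
      unfolding \<sigma>(2) by (simp add: total S.prob_space power_divide)
    finally show ?thesis using \<sigma>(1) by (simp add: power_divide)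
  qed
  have m3: "S.expectation (\<lambda>x. W x ^ 3) = - (168836 / 44385) * sqrt (70 / 269)"
    and int3: "integrable N (\<lambda>x. W x ^ 3)"
  proof -
    have eq: "W x ^ 3 = (- (1 / \<sigma>)) ^ 3 * (S.total x ^ 3 - 3 * (5 / 48) * S.total x ^ 2 +
        3 * (5 / 48) ^ 2 * S.total x - (5 / 48) ^ 3)" for x
      unfolding W_eq power_mult_distrib T3 ..
    show "integrable N (\<lambda>x. W x ^ 3)" unfolding eq using total by simp
    \<comment> \<open>The third central moment equals the third cumulant of \<open>total\<close>,
      which is 2 s3.\<close>
    have e3: "S.expectation (\<lambda>x. S.total x ^ 3 - 3 * (5 / 48) * S.total x ^ 2 +
        3 * (5 / 48) ^ 2 * S.total x - (5 / 48) ^ 3) = 2 * (42209 / 79833600)"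
      by (simp add: total S.prob_space power_divide)
    \<comment> \<open>Separating 1/\<open>\<sigma>\<close>^2, which is rational, leaves a single
      square root.\<close>
    have s3: "(- (1 / \<sigma>)) ^ 3 = - (24 * sqrt (70 / 269)) * (40320 / 269)"
    proof -
      have "(- (1 / \<sigma>)) ^ 3 = - (1 / \<sigma>) * (1 / \<sigma> ^ 2)"
        by (simp add: power3_eq_cube power2_eq_square)
      then show ?thesis unfolding \<sigma>_inverse \<sigma>(2) by simp
    qed
    show "S.expectation (\<lambda>x. W x ^ 3) = - (168836 / 44385) * sqrt (70 / 269)"
      unfolding eq integral_mult_right_zero e3 s3 by simp
  qed
  have L: "(\<integral>x. f x \<partial>L) = S.expectation (\<lambda>x. f (W x))" if "f \<in> borel_measurable borel" for f :: "real \<Rightarrow> real"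
    unfolding L_def using that by (subst integral_distr) auto
  have L1: "(\<integral>x. x \<partial>L) = 0" using L[of "\<lambda>x. x"] m1 by simp
  have L3: "(\<integral>x. x ^ 3 \<partial>L) = - (168836 / 44385) * sqrt (70 / 269)" using L[of "\<lambda>x. x ^ 3"] m3 by simp
  show "\<exists>L. real_distribution L \<and>
      weak_conv_m
        (\<lambda>n. distr M borel (\<lambda>\<omega>. (\<Phi>\<^sub>n n \<omega> - prob_space.expectation M (\<Phi>\<^sub>n n)) / sqrt (prob_space.variance M (\<Phi>\<^sub>n n))))
        L \<and>
      weak_conv_m
        (\<lambda>n. distr M borel (\<lambda>\<omega>. (\<Phi>\<^sub>n n \<omega> - observable circle_space) / sqrt (prob_space.variance M (\<Phi>\<^sub>n n))))
        (distr L borel (\<lambda>x. x - 5 / 2 * sqrt (70 / 269))) \<and>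
      integrable L (\<lambda>x. x ^ 3) \<and>
      prob_space.expectation L (\<lambda>x. x) = 0 \<and>
      prob_space.variance L (\<lambda>x. x) = 1 \<and>
      third_cumulant L (\<lambda>x. x) = - (168836 / 44385) * sqrt (70 / 269) \<and>
      (\<forall>m s. 0 < s \<longrightarrow> L \<noteq> density lborel (normal_density m s))"
  proof (intro exI[of _ L] conjI allI impI lim1 lim2)
    show "real_distribution L" unfolding L_def by (rule S.real_distribution_distr) simp
    show "integrable L (\<lambda>x. x ^ 3)" unfolding L_def using int3 by (subst integrable_distr_eq) auto
    show "(\<integral>x. x \<partial>L) = 0" by (rule L1)
    show "(\<integral>x. (x - (\<integral>x. x \<partial>L)) ^ 2 \<partial>L) = 1" unfolding L1 using L[of "\<lambda>x. x ^ 2"] m2 by simp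
    show "third_cumulant L (\<lambda>x. x) = - (168836 / 44385) * sqrt (70 / 269)"
      by (simp add: third_cumulant_def L1 L3)
    fix m s :: real assume "0 < s"
    show "L \<noteq> density lborel (normal_density m s)"
    proof
      assume "L = density lborel (normal_density m s)"
      from normal_density_third_moment[OF \<open>0 < s\<close> this L1] show False unfolding L3 by simp
    qed
  qed
qed

end
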